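(* Let $n\ge 1$ and $r\ge 1$ be integers, $\check{n}:=\frac{n-1}{2}$, $I_n:=(-\check{n}-1,\check{n}+1)\subset\mathbb{R}$ and $\xi^{\pm}_n(s):=1+\check{n}\pm s$. Then there exist even polynomials $f_{n,r}(s)$ and $\beta_{n,r}(s,l)$ ($1\le l\le 2r+n-2$) in $s$ with rational coefficients such that for every $s\in I_n$ $$\mathrm{Det}_{r}\bigl(L_n(s)\bigr)=\bigl(\check{n}^2-s^2\bigr)^{(\check{n}^2-s^2)^{r-1}\delta_{|s|<\check{n}}}\cdot e^{f_{n,r}(s)}\prod^{2r+n-2}_{l=1}\Bigl(\Gamma_l\bigl(\xi^{+}_n(s)\bigr)\Gamma_l\bigl(\xi^{-}_n(s)\bigr)\Bigr)^{\beta_{n,r}(s,l)},$$ where $\delta_{|s|<\check{n}}:=1$ if $|s|<\check{n}$ and $0$ otherwise. Moreover, $f_{n,r}(s)$ is identically $0$ if $n$ is odd.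
   Context: $\Delta_n$ denotes the (nonnegative) Laplacian on the unit sphere $S^n\subset\mathbb{R}^{n+1}$ with the standard metric: its eigenvalues are $k(k+n-1)$, $k=0,1,2,\dots$, where $0$ has multiplicity $1$ and, for $k\ge1$, $k(k+n-1)$ has multiplicity $\binom{n+k}{n}-\binom{n+k-2}{n}$. For $s\in\mathbb{R}$, $L_n(s):=\Delta_n+\check{n}^2-s^2$. For an operator $A$ with real discrete spectrum, $\zeta_A(w):=\sum_{\lambda}\lambda^{-w}$, the sum being over all (strictly) positive eigenvalues of $A$ counted with multiplicity, and $\mathrm{Det}_r(A):=\exp\bigl(-\frac{\partial}{\partial w}\zeta_A(w)\big|_{w=1-r}\bigr)$, using the meromorphic continuation of $\zeta_A$. For $A=L_n(s)$ with $s\in I_n$ the series converges absolutely for $\mathrm{Re}(w)>\frac n2$ and continues meromorphically to $\mathbb{C}$, holomorphic at the non-positive integers. The Barnes multiple gamma function is $\Gamma_l(z):=\exp\bigl(\frac{\partial}{\partial w}\zeta_l(w,z)\big|_{w=0}\bigr)$, where $\zeta_l(w,z):=\sum_{m_1,\dots,m_l\ge0}(m_1+\cdots+m_l+z)^{-w}$ ($\mathrm{Re}(w)>l$), continued meromorphically in $w$. (In particular $\Gamma_1(z)=\Gamma(z)/\sqrt{2\pi}$.) For $s\in I_n$ one has $\xi_n^\pm(s)>0$, so all values $\Gamma_l(\xi^\pm_n(s))$ are positive reals. The first factor on the right-hand side is read as $1$ when $\delta_{|s|<\check n}=0$. *)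

theory Defs
  imports
    "HOL-Complex_Analysis.Complex_Analysis"
    "HOL-Computational_Algebra.Computational_Algebra"
    "HOL-Library.Function_Algebras"
begin

interpretation real_fun: vector_space "\<lambda>(c::real) (u::'a \<Rightarrow> real) x. c * u x"
  by unfold_locales (auto simp: algebra_simps)

subsection \<open>Smooth functions and the Laplacian on the unit sphere\<close>

definition partial_deriv :: "'a::euclidean_space \<Rightarrow> ('a \<Rightarrow> real) \<Rightarrow> 'a \<Rightarrow> real" where
  "partial_deriv b F x = deriv (\<lambda>t::real. F (x + t *\<^sub>R b)) 0"

primrec Ck_on :: "'a::euclidean_space set \<Rightarrow> nat \<Rightarrow> ('a \<Rightarrow> real) \<Rightarrow> bool" where
  "Ck_on S 0 F \<longleftrightarrow> continuous_on S F"
| "Ck_on S (Suc k) F \<longleftrightarrow> continuous_on S F \<and>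
     (\<forall>b\<in>Basis. (\<forall>x\<in>S. (\<lambda>t::real. F (x + t *\<^sub>R b)) differentiable (at 0)) \<and>
                Ck_on S k (partial_deriv b F))"

definition radial_extension :: "('a::euclidean_space \<Rightarrow> real) \<Rightarrow> 'a \<Rightarrow> real" where
  "radial_extension u x = u (x /\<^sub>R norm x)"

text \<open>
  A function on the sphere is represented by a function on the ambient space that vanishes off
  the sphere, so that distinct elements are distinct functions on the sphere.  It is smooth on
  the sphere iff its extension that is constant along rays is smooth away from the origin.
\<close>
definition smooth_on_sphere :: "('a::euclidean_space \<Rightarrow> real) set" where
  "smooth_on_sphere =
     {u. (\<forall>x. norm x \<noteq> 1 \<longrightarrow> u x = 0) \<and> (\<forall>k. Ck_on (- {0}) k (radial_extension u))}"

text \<open>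
  The Laplace--Beltrami operator of the round metric is the restriction to the sphere of the
  Euclidean Laplacian of the extension constant along rays; the sign makes it nonnegative.
\<close>
definition sphere_laplacian :: "('a::euclidean_space \<Rightarrow> real) \<Rightarrow> 'a \<Rightarrow> real" where
  "sphere_laplacian u x =
     (if norm x = 1
      then - (\<Sum>b\<in>Basis. partial_deriv b (partial_deriv b (radial_extension u)) x)
      else 0)"

definition ncheck :: "nat \<Rightarrow> real" where
  "ncheck n = (real n - 1) / 2"

definition L_op :: "nat \<Rightarrow> real \<Rightarrow> ('a::euclidean_space \<Rightarrow> real) \<Rightarrow> 'a \<Rightarrow> real" where
  "L_op n s u x = sphere_laplacian u x + ((ncheck n)\<^sup>2 - s\<^sup>2) * u x"

subsection \<open>Meromorphic continuation\<close>

text \<open>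
  The meromorphic continuation to the plane of a series that converges (absolutely) on some
  right half-plane.  Nicely meromorphic functions have the value 0 at poles and no removable
  singularities, so the continuation is unique when it exists.
\<close>
definition series_continuation :: "('i \<Rightarrow> complex \<Rightarrow> complex) \<Rightarrow> 'i set \<Rightarrow> complex \<Rightarrow> complex" where
  "series_continuation a I =
     (THE g. g nicely_meromorphic_on UNIV \<and>
             (\<exists>\<sigma>::real. \<forall>w. Re w > \<sigma> \<longrightarrow> ((\<lambda>i. a i w) has_sum g w) I))"

subsection \<open>Spectral zeta functions and higher depth determinants\<close>

text \<open>\<open>A\<close> is an operator with domain \<open>D\<close>.\<close>
definition eigenspace ::
    "('a \<Rightarrow> real) set \<Rightarrow> (('a \<Rightarrow> real) \<Rightarrow> 'a \<Rightarrow> real) \<Rightarrow> real \<Rightarrow> ('a \<Rightarrow> real) set" where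
  "eigenspace D A \<mu> = {u\<in>D. A u = (\<lambda>x. \<mu> * u x)}"

definition pos_eigenvalues ::
    "('a \<Rightarrow> real) set \<Rightarrow> (('a \<Rightarrow> real) \<Rightarrow> 'a \<Rightarrow> real) \<Rightarrow> real set" where
  "pos_eigenvalues D A = {\<mu>. \<mu> > 0 \<and> (\<exists>u\<in>eigenspace D A \<mu>. \<exists>x. u x \<noteq> 0)}"

definition spectral_zeta ::
    "('a \<Rightarrow> real) set \<Rightarrow> (('a \<Rightarrow> real) \<Rightarrow> 'a \<Rightarrow> real) \<Rightarrow> complex \<Rightarrow> complex" where
  "spectral_zeta D A =
     series_continuation
       (\<lambda>\<mu> w. of_nat (real_fun.dim (eigenspace D A \<mu>)) * complex_of_real \<mu> powr (- w))
       (pos_eigenvalues D A)"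

definition Det ::
    "nat \<Rightarrow> ('a \<Rightarrow> real) set \<Rightarrow> (('a \<Rightarrow> real) \<Rightarrow> 'a \<Rightarrow> real) \<Rightarrow> complex" where
  "Det r D A = exp (- deriv (spectral_zeta D A) (1 - of_nat r))"

subsection \<open>Barnes multiple gamma functions\<close>

definition barnes_zeta :: "nat \<Rightarrow> complex \<Rightarrow> complex \<Rightarrow> complex" where
  "barnes_zeta l z =
     series_continuation
       (\<lambda>m w. (of_nat (sum_list m) + z) powr (- w)) {m :: nat list. length m = l}"

definition multiple_Gamma :: "nat \<Rightarrow> complex \<Rightarrow> complex" where
  "multiple_Gamma l z = exp (deriv (barnes_zeta l z) 0)"

subsection \<open>Even rational polynomials\<close>

definition even_poly :: "'a::comm_ring_1 poly \<Rightarrow> bool" where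
  "even_poly p \<longleftrightarrow> pcompose p [:0, -1:] = p"

definition rpoly :: "rat poly \<Rightarrow> real \<Rightarrow> real" where
  "rpoly p s = poly (map_poly of_rat p) s"

end

theory Submission
  imports Defs
begin

text \<open>
  Put \<open>a = 1 + ncheck n\<close> and \<open>x = j + a\<close>.  The eigenvalues of \<open>L_op n s\<close> with index \<open>j + 1\<close> are
  \<open>x\<^sup>2 - s\<^sup>2 = (x + s) (x - s)\<close>, with a multiplicity that is a polynomial in \<open>x\<close> of the parity
  of \<open>n - 1\<close>.  After multiplication by the power \<open>r - 1\<close> of the eigenvalue, the weight is
  a polynomial \<open>\<Sum>q. p\<^sub>q x ^ q\<close> whose coefficients are even in \<open>s\<close>, so
  formally minus the logarithm of the determinant is the sum of the weights times
  \<open>- ln (x + s) - ln (x - s)\<close>; expanding the weight in the basis \<open>(j + l - 1) choose (l - 1)\<close> gives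
  the exponents of the multiple gamma functions.  The three regularised sums, with summands
  \<open>x ^ q (x\<^sup>2 - s\<^sup>2) powr - w\<close> and \<open>x ^ q (x \<plusminus> s) powr - w\<close>, are expanded binomially into Hurwitz zeta
  functions of argument \<open>a\<close>.  Their derivatives at \<open>w = 0\<close> differ only where a coefficient vanishing
  at \<open>0\<close> meets the pole of the Hurwitz zeta function, which happens for odd \<open>q\<close> only.  This produces
  the polynomial \<open>f\<close>, and it vanishes for odd \<open>n\<close> since then the weight is even in \<open>x\<close>.

  The spectrum is found inside the spaces of restrictions of homogeneous polynomials of
  degree \<open>k\<close>, on which the Laplacian acts as \<open>k (k + n - 1)\<close> modulo polynomials of degree \<open>k - 2\<close>.
  Nothing else occurs because the Laplacian is symmetric and polynomials are dense.
\<close>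

subsection \<open>Remainders of the binomial series\<close>

text \<open>Every zeta function is continued by one elementary device: \<open>N\<close> terms of a
  binomial series are subtracted, the remainder is bounded locally uniformly in \<open>w\<close>,
  and a larger \<open>N\<close> moves the half-plane to the left. Applied to a telescoping sum, the
  same device continues the Hurwitz zeta function itself. The comparison at \<open>0\<close> is
  finite because the derivatives of the remainders for \<open>x + s\<close> and \<open>x - s\<close>
  add up, summand by summand, to the one for \<open>x ^ 2 - s ^ 2\<close>, by
  \<open>ln (1 + t) + ln (1 - t) = ln (1 - t ^ 2)\<close>; only finitely many Hurwitz terms are left
  to compare. The depth enters through a shift of \<open>w\<close> by \<open>r - 1\<close>, which
  moves the point \<open>1 - r\<close> to \<open>0\<close> and the power of the eigenvalue into the
  weight. The eigenvalue of index \<open>0\<close> is kept apart because its sign depends on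
  \<open>s\<close>; it yields the first factor. In \<open>x\<close> the weight has degree below
  \<open>n + 2 * (r - 1)\<close>, whence the range of \<open>l\<close>. On the sphere all
  integration takes place in the ambient space, so that symmetry of the Laplacian rests on
  translation invariance of Lebesgue measure.\<close>

definition binomial_rem :: "nat \<Rightarrow> complex \<Rightarrow> complex \<Rightarrow> complex" where
  "binomial_rem N v t = (1 + t) powr v - (\<Sum>i<N. (v gchoose i) * t ^ i)"

text \<open>The factors \<open>v - i\<close> of the numerator have modulus at most
  \<open>V + i\<close>, that of \<open>- V - i\<close>. So the coefficients are dominated by those
  for the single real exponent \<open>- V\<close>.\<close>

lemma norm_gbinomial_le:
  fixes v :: complex
  assumes "norm v \<le> V"
  shows "norm (v gchoose m) \<le> \<bar>(- V) gchoose m\<bar>"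
proof -
  have "norm (v - of_nat i) \<le> \<bar>- V - real i\<bar>" for i
    using norm_triangle_ineq4[of v "of_nat i"] assms by simp
  then show ?thesis
    by (auto simp: gbinomial_prod_rev norm_divide abs_divide divide_simps abs_prod
             simp flip: prod_norm intro!: prod_mono)
qed

text \<open>The tail is dominated by that of the series of \<open>(1 - \<theta>) powr (- V)\<close>,
  whose terms are nonnegative: \<open>norm t ^ (i + N)\<close> is at most
  \<open>(norm t / \<theta>) ^ N * \<theta> ^ (i + N)\<close>. The bound is uniform in
  \<open>v\<close>, which later gives convergence locally uniform in \<open>w\<close>.\<close>

lemma norm_binomial_rem_le:
  assumes "norm t \<le> \<theta>" "0 < \<theta>" "\<theta> < 1" "norm v \<le> V"
  shows "norm (binomial_rem N v t) \<le> (norm t / \<theta>) ^ N * (1 - \<theta>) powr (- V)"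
proof -
  have s1: "(\<lambda>i. (v gchoose i) * t ^ i) sums (1 + t) powr v"
    using assms by (intro gen_binomial_complex) auto
  have s2: "(\<lambda>i. (v gchoose (i + N)) * t ^ (i + N)) sums binomial_rem N v t"
    unfolding binomial_rem_def by (rule sums_split_initial_segment[OF s1])
  have "V \<ge> 0" using assms(4) norm_ge_zero order_trans by blast
  \<comment> \<open>At \<open>- \<theta>\<close> the alternating signs of the coefficients for the
    exponent \<open>- V\<close> cancel.\<close>
  have sgn: "((- V) gchoose i) * (- \<theta>) ^ i = \<bar>(- V) gchoose i\<bar> * \<theta> ^ i" for i
  proof -
    have "((- V) gchoose i) = (- 1) ^ i * \<bar>(- V) gchoose i\<bar>"
    proof -
      have "(\<Prod>j=0..<i. - V - real j) = (\<Prod>j=0..<i. - 1 * (V + real j))"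
        by (intro prod.cong) auto
      also have "\<dots> = (- 1) ^ i * (\<Prod>j=0..<i. V + real j)"
        by (simp only: prod.distrib) simp
      finally show ?thesis
        using \<open>V \<ge> 0\<close> by (simp add: gbinomial_prod_rev abs_mult abs_prod power_abs)
    qed
    then have "((- V) gchoose i) * (- \<theta>) ^ i = (- 1) ^ i * \<bar>(- V) gchoose i\<bar> * (- \<theta>) ^ i"
      by simp
    also have "\<dots> = \<bar>(- V) gchoose i\<bar> * ((-1) * (- \<theta>)) ^ i"
      by (simp only: power_mult_distrib mult_ac)
    finally show ?thesis by simp
  qed
  have s3: "(\<lambda>i. \<bar>(- V) gchoose i\<bar> * \<theta> ^ i) sums (1 - \<theta>) powr (- V)"
    using gen_binomial_real[of "- \<theta>" "- V"] assms by (simp add: sgn)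
  have s4: "(\<lambda>i. \<bar>(- V) gchoose (i + N)\<bar> * \<theta> ^ (i + N)) sums
      ((1 - \<theta>) powr (- V) - (\<Sum>i<N. \<bar>(- V) gchoose i\<bar> * \<theta> ^ i))"
    by (rule sums_split_initial_segment[OF s3])
  have le: "norm ((v gchoose (i + N)) * t ^ (i + N))
      \<le> (norm t / \<theta>) ^ N * (\<bar>(- V) gchoose (i + N)\<bar> * \<theta> ^ (i + N))" for i
  proof -
    have "norm t ^ (i + N) \<le> \<theta> ^ i * norm t ^ N"
      using assms by (simp add: power_add mult_right_mono power_mono)
    also have "\<dots> = (norm t / \<theta>) ^ N * \<theta> ^ (i + N)"
      using assms by (simp add: power_add power_divide)
    finally have "norm (v gchoose (i + N)) * norm t ^ (i + N) \<le>
        \<bar>(- V) gchoose (i + N)\<bar> * ((norm t / \<theta>) ^ N * \<theta> ^ (i + N))"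
      by (intro mult_mono norm_gbinomial_le assms) auto
    then show ?thesis by (simp add: norm_mult norm_power mult_ac)
  qed
  have sm: "summable (\<lambda>i. (norm t / \<theta>) ^ N * (\<bar>(- V) gchoose (i + N)\<bar> * \<theta> ^ (i + N)))"
    using s4 sums_summable by (intro summable_mult) blast
  have "norm (binomial_rem N v t) = norm (\<Sum>i. (v gchoose (i + N)) * t ^ (i + N))"
    using s2 by (simp add: sums_iff)
  also have "\<dots> \<le> (\<Sum>i. (norm t / \<theta>) ^ N * (\<bar>(- V) gchoose (i + N)\<bar> * \<theta> ^ (i + N)))"
    by (rule norm_suminf_le[OF le sm])
  also have "\<dots> = (norm t / \<theta>) ^ N * ((1 - \<theta>) powr (- V) - (\<Sum>i<N. \<bar>(- V) gchoose i\<bar> * \<theta> ^ i))"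
    using s4 by (simp add: sums_iff suminf_mult)
  also have "\<dots> \<le> (norm t / \<theta>) ^ N * (1 - \<theta>) powr (- V)"
    using assms by (intro mult_left_mono) (auto intro!: sum_nonneg)
  finally show ?thesis .
qed

lemma holomorphic_gbinomial [holomorphic_intros]:
  "f holomorphic_on A \<Longrightarrow> (\<lambda>w. f w gchoose i) holomorphic_on A"
  by (auto simp: gbinomial_prod_rev intro!: holomorphic_intros)

lemma analytic_gbinomial [analytic_intros]:
  "f analytic_on A \<Longrightarrow> (\<lambda>w. f w gchoose i) analytic_on A"
  by (auto simp: gbinomial_prod_rev intro!: analytic_intros)

lemma gbinomial_Suc_over: "(v::complex) gchoose Suc i = (v gchoose i) * (v - of_nat i) / of_nat (Suc i)"
  by (simp add: gbinomial_prod_rev mult_ac)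

text \<open>These are the coefficients of \<open>- ln (1 + t)\<close>, the derivative at
  \<open>w = 0\<close> of \<open>(1 + t) powr (- w)\<close>.\<close>

lemma gbinomial_deriv_0:
  assumes "i \<ge> 1"
  shows "((\<lambda>w. (- w gchoose i) :: complex) has_field_derivative (- 1) ^ i / of_nat i) (at 0)"
  using assms
proof (induction i rule: dec_induct)
  case base
  show ?case by (auto intro!: derivative_eq_intros)
next
  case (step i)
  have "((\<lambda>w. (- w gchoose i) * (- w - of_nat i) / of_nat (Suc i)) has_field_derivative
     (- 1) ^ Suc i / of_nat (Suc i)) (at (0::complex))"
  proof -
    have "i > 0" using step by simp
    have "((\<lambda>w. (- w gchoose i) * (- w - of_nat i) / of_nat (Suc i)) has_field_derivative
      (((- 1) ^ i / of_nat i) * (- 0 - of_nat i) + (- 1) * (- 0 gchoose i)) / of_nat (Suc i)) (at (0::complex))"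
      by (intro DERIV_cdivide DERIV_mult step.IH) (auto intro!: derivative_eq_intros)
    moreover have "(((- 1) ^ i / of_nat i) * (- 0 - of_nat i) + (- 1) * (- 0 gchoose i)) / of_nat (Suc i)
        = ((- 1) ^ Suc i / of_nat (Suc i) :: complex)"
      using \<open>i > 0\<close> by (simp add: gbinomial_0_left del: of_nat_Suc)
    ultimately show ?thesis by simp
  qed
  then show ?case by (simp only: gbinomial_Suc_over)
qed

section \<open>Sums of binomial remainders over the index\<close>

lemma powr_diff_tail_summable:
  assumes "(p::real) > 1" "a > 0"
  shows "summable (\<lambda>j. (real j + a) powr (- p))"
proof (rule summable_comparison_test_ev)
  show "summable (\<lambda>j. real j powr (- p))"
    using assms by (simp add: summable_real_powr_iff)
  show "\<forall>\<^sub>F j in sequentially. norm ((real j + a) powr (- p)) \<le> real j powr (- p)"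
    using eventually_gt_at_top[of 0]
    by eventually_elim (use assms in \<open>auto intro!: powr_mono2'\<close>)
qed

text \<open>With \<open>x = j + a\<close> this is the summand
  \<open>x ^ q * (x ^ c + \<kappa>) powr (- w)\<close> less the first \<open>N\<close> terms of its
  expansion in descending powers of \<open>x\<close>; see \<open>rem_term_expand\<close>.\<close>

definition rem_term :: "real \<Rightarrow> nat \<Rightarrow> nat \<Rightarrow> real \<Rightarrow> nat \<Rightarrow> nat \<Rightarrow> complex \<Rightarrow> complex" where
  "rem_term a c q \<kappa> N j w = of_real (real j + a) powr (of_nat q - of_nat c * w) *
     binomial_rem N (- w) (of_real (\<kappa> / (real j + a) ^ c))"

text \<open>The derivative of \<open>rem_term\<close> at \<open>w = 0\<close>: minus a logarithm,
  less the start of its Taylor series, times \<open>x ^ q\<close>.\<close>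

definition rem_term' :: "real \<Rightarrow> nat \<Rightarrow> nat \<Rightarrow> real \<Rightarrow> nat \<Rightarrow> nat \<Rightarrow> complex" where
  "rem_term' a c q \<kappa> N j = of_real ((real j + a) ^ q * (- ln (1 + \<kappa> / (real j + a) ^ c)
     - (\<Sum>i=1..<N. (- \<kappa> / (real j + a) ^ c) ^ i / real i)))"

definition rem_sum :: "real \<Rightarrow> nat \<Rightarrow> nat \<Rightarrow> real \<Rightarrow> nat \<Rightarrow> complex \<Rightarrow> complex" where
  "rem_sum a c q \<kappa> N w = (\<Sum>j. rem_term a c q \<kappa> N j w)"

lemma abs_kappa_ratio_le:
  assumes "a > 0" "\<bar>\<kappa>\<bar> < a ^ c"
  obtains \<theta> where "0 < \<theta>" "\<theta> < 1" "\<And>j. \<bar>\<kappa> / (real j + a) ^ c\<bar> \<le> \<theta>"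
proof
  \<comment> \<open>The value \<open>1/2\<close> keeps the bound positive when
    \<open>\<kappa> = 0\<close>; it will be divided by.\<close>
  let ?th = "max (1/2) (\<bar>\<kappa>\<bar> / a ^ c)"
  show "0 < ?th" "?th < 1" using assms by auto
  fix j
  have "\<bar>\<kappa> / (real j + a) ^ c\<bar> = \<bar>\<kappa>\<bar> / (real j + a) ^ c" using assms by (simp add: abs_divide)
  also have "\<dots> \<le> \<bar>\<kappa>\<bar> / a ^ c"
    using assms by (intro divide_left_mono power_mono) auto
  finally show "\<bar>\<kappa> / (real j + a) ^ c\<bar> \<le> ?th" by simp
qed

text \<open>The remainder is of order \<open>x powr (q - c * Re w - c * N)\<close>, so each further
  term of the expansion moves the half-plane of convergence one unit to the left. The bound starts
  at \<open>j = 1\<close> because exponents are compared for \<open>x \<ge> 1\<close>.\<close>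

lemma rem_term_bound:
  assumes "a > 0" "\<bar>\<kappa>\<bar> < a ^ c" "c > 0" "Re (of_nat c * w) > real q + 1 - real (c * N)"
  obtains d h where "d > 0" "summable h" "\<And>n. h n \<ge> 0"
    "\<And>j y. j \<ge> 1 \<Longrightarrow> y \<in> ball w d \<Longrightarrow> norm (rem_term a c q \<kappa> N j y) \<le> h j"
proof -
  obtain \<theta> where th: "0 < \<theta>" "\<theta> < 1" "\<And>j. \<bar>\<kappa> / (real j + a) ^ c\<bar> \<le> \<theta>"
    using abs_kappa_ratio_le[OF assms(1,2)] by blast
  \<comment> \<open>\<open>e\<close> is the surplus over the critical exponent. The radius
    \<open>e / (2 * c)\<close> spends half of it, which leaves the summable exponent
    \<open>- (1 + e / 2)\<close>.\<close>
  define e where "e = real c * Re w - (real q + 1 - real (c * N))"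
  have e: "e > 0" using assms by (simp add: e_def)
  define d where "d = e / (2 * real c)"
  have d: "d > 0" using e assms by (simp add: d_def)
  define V where "V = norm w + d"
  define K where "K = (\<bar>\<kappa>\<bar> / \<theta>) ^ N * (1 - \<theta>) powr (- V)"
  define h where "h j = K * (real j + a) powr (- (1 + e/2))" for j
  show ?thesis
  proof
    show "d > 0" by fact
    show "summable h" unfolding h_def
      using e assms by (intro summable_mult powr_diff_tail_summable) auto
    show "h n \<ge> 0" for n using th by (auto simp: h_def K_def)
    fix j :: nat and y assume j: "j \<ge> 1" and y: "y \<in> ball w d"
    define x where "x = real j + a"
    have x: "x \<ge> 1" using j assms by (simp add: x_def)
    have ny: "norm (- y) \<le> V"
      using y norm_triangle_ineq2[of y w] by (simp add: V_def dist_norm norm_minus_commute)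
    have "Re w - Re y \<le> norm (w - y)" using complex_Re_le_cmod[of "w - y"] by simp
    then have "Re w - Re y \<le> d" using y by (simp add: dist_norm)
    then have "real c * (Re w - Re y) \<le> real c * d" by (intro mult_left_mono) auto
    also have "real c * d = e / 2" using assms by (simp add: d_def)
    finally have ex: "real q - real c * Re y - real (c * N) \<le> - (1 + e/2)"
      unfolding e_def right_diff_distrib by argo
    have "norm (binomial_rem N (- y) (of_real (\<kappa> / x ^ c)))
        \<le> (norm (of_real (\<kappa> / x ^ c) :: complex) / \<theta>) ^ N * (1 - \<theta>) powr (- V)"
      using th(3)[of j] by (intro norm_binomial_rem_le th ny) (simp add: x_def norm_of_real del: of_real_divide of_real_power)
    also have "\<dots> = K * x powr (- real (c * N))"
      using x by (simp add: K_def norm_of_real norm_divide norm_power abs_divide power_divide power_mult powr_minus powr_realpow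
         powr_powr field_simps flip: powr_realpow)
    finally have b: "norm (binomial_rem N (- y) (of_real (\<kappa> / x ^ c))) \<le> K * x powr (- real (c * N))" .
    have "norm (rem_term a c q \<kappa> N j y) =
       x powr (real q - real c * Re y) * norm (binomial_rem N (- y) (of_real (\<kappa> / x ^ c)))"
      unfolding rem_term_def x_def[symmetric] norm_mult using x by (subst norm_powr_real_powr) auto
    also have "\<dots> \<le> x powr (real q - real c * Re y) * (K * x powr (- real (c * N)))"
      by (intro mult_left_mono b) auto
    also have "\<dots> = K * x powr (real q - real c * Re y - real (c * N))"
      using x by (simp add: powr_diff powr_minus powr_add field_simps)
    also have "\<dots> \<le> K * x powr (- (1 + e/2))"
      using x ex th by (intro mult_left_mono powr_mono) (auto simp: K_def)
    finally show "norm (rem_term a c q \<kappa> N j y) \<le> h j" by (simp add: h_def x_def)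
  qed
qed

lemma rem_term_holomorphic: "a > 0 \<Longrightarrow> \<bar>\<kappa>\<bar> < a ^ c \<Longrightarrow> rem_term a c q \<kappa> N j holomorphic_on A"
proof -
  assume a: "a > 0" "\<bar>\<kappa>\<bar> < a ^ c"
  obtain \<theta> where th: "0 < \<theta>" "\<theta> < 1" "\<And>j. \<bar>\<kappa> / (real j + a) ^ c\<bar> \<le> \<theta>"
    using abs_kappa_ratio_le[OF a] by blast
  have p: "1 + \<kappa> / (real j + a) ^ c > 0" using th(3)[of j] th(2) by linarith
  show ?thesis
    unfolding rem_term_def[abs_def] binomial_rem_def
    using a p by (auto intro!: holomorphic_intros simp: complex_eq_iff)
qed

lemma rem_term_deriv_0:
  assumes "a > 0" "\<bar>\<kappa>\<bar> < a ^ c" "N \<ge> 1"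
  shows "(rem_term a c q \<kappa> N j has_field_derivative rem_term' a c q \<kappa> N j) (at 0)"
proof -
  define x where "x = real j + a"
  define t where "t = \<kappa> / x ^ c"
  have x: "x > 0" using assms by (simp add: x_def)
  obtain \<theta> where th: "0 < \<theta>" "\<theta> < 1" "\<And>j. \<bar>\<kappa> / (real j + a) ^ c\<bar> \<le> \<theta>"
    using abs_kappa_ratio_le[OF assms(1,2)] by blast
  have p: "1 + t > 0" using th(3)[of j] th(2) unfolding t_def x_def by linarith
  have p0: "(1::complex) + of_real t \<noteq> 0" using p by (metis less_irrefl of_real_1 of_real_add of_real_eq_0_iff)
  have split: "{..<N} = insert 0 {1..<N}" using assms by auto
  have b: "((\<lambda>w. binomial_rem N (- w) (of_real t)) has_field_derivative
      of_real (- ln (1 + t) - (\<Sum>i=1..<N. (- t) ^ i / real i))) (at 0)"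
  proof -
    have pw: "((\<lambda>w. (1 + of_real t) powr (- w)) has_field_derivative - Ln (1 + of_real t)) (at (0::complex))"
      using p0 by (auto intro!: derivative_eq_intros simp: powr_def)
    have "((\<lambda>w. (1 + of_real t) powr (- w) - (1 + (\<Sum>i=1..<N. (- w gchoose i) * of_real t ^ i)))
       has_field_derivative (- Ln (1 + of_real t)
         - (\<Sum>i=1..<N. (- 1) ^ i / of_nat i * of_real t ^ i))) (at (0::complex))"
      by (auto intro!: derivative_eq_intros gbinomial_deriv_0 pw)
    moreover have "Ln (1 + of_real t) = of_real (ln (1 + t))"
      using p by (metis Ln_of_real of_real_1 of_real_add)
    moreover have "(\<Sum>i=1..<N. (- 1) ^ i / of_nat i * of_real t ^ i)
        = (of_real (\<Sum>i=1..<N. (- t) ^ i / real i) :: complex)"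
      by (auto simp: power_minus[of t] intro!: sum.cong)
    ultimately show ?thesis
      unfolding binomial_rem_def split by simp
  qed
  \<comment> \<open>At \<open>w = 0\<close> the remainder vanishes because the term
    \<open>i = 0\<close> has been subtracted, so the derivative of the power of \<open>x\<close>
    contributes nothing.\<close>
  have b0: "binomial_rem N (- 0) (of_real t) = 0"
    unfolding binomial_rem_def split using p0 by (auto simp: gbinomial_0_left)
  have xq: "of_real x powr (of_nat q) = (of_real (x ^ q) :: complex)"
    using x by (subst powr_nat') auto
  have "((\<lambda>w. of_real x powr (of_nat q - of_nat c * w)) has_field_derivative
      (- of_nat c) * Ln (of_real x) * of_real x powr (of_nat q - of_nat c * 0)) (at (0::complex))"
    using x unfolding powr_def by (auto intro!: derivative_eq_intros)
  from DERIV_mult[OF this b]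
  have "((\<lambda>w. of_real x powr (of_nat q - of_nat c * w) * binomial_rem N (- w) (of_real t))
     has_field_derivative of_real (- ln (1 + t) - (\<Sum>i=1..<N. (- t) ^ i / real i)) * of_real (x ^ q)) (at 0)"
    unfolding b0 using xq by simp
  moreover have "rem_term a c q \<kappa> N j =
      (\<lambda>w. of_real x powr (of_nat q - of_nat c * w) * binomial_rem N (- w) (of_real t))"
    by (simp add: fun_eq_iff rem_term_def t_def x_def)
  moreover have "rem_term' a c q \<kappa> N j =
      of_real (- ln (1 + t) - (\<Sum>i=1..<N. (- t) ^ i / real i)) * of_real (x ^ q)"
    by (simp only: rem_term'_def t_def x_def of_real_mult mult.commute minus_divide_left)
  ultimately show ?thesis by simp
qed

text \<open>The local bound permits termwise differentiation. The last claim gives the derivative at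
  \<open>0\<close> as an explicit series of logarithms, the form in which remainders for different
  \<open>c\<close> can be compared.\<close>

lemma rem_sum_properties:
  fixes q N :: nat
  assumes "a > 0" "\<bar>\<kappa>\<bar> < a ^ c" "c > 0"
  defines "S \<equiv> {w. Re (of_nat c * w) > real q + 1 - real (c * N)}"
  shows "open S" and "w \<in> S \<Longrightarrow> (\<lambda>j. rem_term a c q \<kappa> N j w) sums rem_sum a c q \<kappa> N w"
    and "rem_sum a c q \<kappa> N holomorphic_on S"
    and "w \<in> S \<Longrightarrow> summable (\<lambda>j. norm (rem_term a c q \<kappa> N j w))"
    and "0 \<in> S \<Longrightarrow> N \<ge> 1 \<Longrightarrow>
      rem_term' a c q \<kappa> N sums deriv (rem_sum a c q \<kappa> N) 0"
proof -
  let ?f = "rem_term a c q \<kappa> N"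
  show o: "open S" unfolding S_def by (intro open_Collect_less continuous_intros)
  have hol: "?f n holomorphic_on UNIV" for n using assms by (intro rem_term_holomorphic)
  have df: "(?f n has_field_derivative deriv (?f n) x) (at x)" for n x
    using hol[of n] by (simp add: holomorphic_derivI)
  have bd: "\<exists>d h. 0 < d \<and> summable h \<and> range h \<subseteq> \<real>\<^sub>\<ge>\<^sub>0 \<and>
      (\<forall>\<^sub>F n in sequentially. \<forall>y\<in>ball x d \<inter> S. norm (?f n y) \<le> norm (h n :: complex))" if "x \<in> S" for x
  proof -
    have xS: "Re (of_nat c * x) > real q + 1 - real (c * N)" using that by (simp add: S_def)
    obtain d h where dh: "d > 0" "summable h" "\<And>n. h n \<ge> (0::real)"
      "\<And>j y. j \<ge> 1 \<Longrightarrow> y \<in> ball x d \<Longrightarrow> norm (?f j y) \<le> h j"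
      using rem_term_bound[OF assms(1,2,3) xS] by blast
    show ?thesis
    proof (intro exI conjI)
      show "d > 0" by fact
      show "summable (\<lambda>n. complex_of_real (h n))" using dh(2) summable_of_real by blast
      show "range (\<lambda>n. complex_of_real (h n)) \<subseteq> \<real>\<^sub>\<ge>\<^sub>0" using dh(3) by auto
      show "\<forall>\<^sub>F n in sequentially. \<forall>y\<in>ball x d \<inter> S. norm (?f n y) \<le> norm (of_real (h n) :: complex)"
        using eventually_ge_at_top[of 1] by eventually_elim (use dh in auto)
    qed
  qed
  obtain g g' where g: "\<And>x. x \<in> S \<Longrightarrow> (\<lambda>n. ?f n x) sums g x"
    "\<And>x. x \<in> S \<Longrightarrow> (\<lambda>n. deriv (?f n) x) sums g' x" "\<And>x. x \<in> S \<Longrightarrow> (g has_field_derivative g' x) (at x)"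
    using series_and_derivative_comparison_complex[OF o df bd] by metis
  have ge: "g x = rem_sum a c q \<kappa> N x" if "x \<in> S" for x
    using g(1)[OF that] by (simp add: rem_sum_def sums_iff)
  show "w \<in> S \<Longrightarrow> (\<lambda>j. ?f j w) sums rem_sum a c q \<kappa> N w" using g(1) ge by auto
  have d': "(rem_sum a c q \<kappa> N has_field_derivative g' x) (at x)" if "x \<in> S" for x
    by (rule has_field_derivative_transform_within_open[OF g(3)[OF that] o that]) (use ge in auto)
  then show "rem_sum a c q \<kappa> N holomorphic_on S"
    using o holomorphic_onI field_differentiable_at_within field_differentiable_def by metis
  show "summable (\<lambda>j. norm (?f j w))" if "w \<in> S"
  proof -
    have xS: "Re (of_nat c * w) > real q + 1 - real (c * N)" using that by (simp add: S_def)
    obtain d h where dh: "d > 0" "summable h" "\<And>n. h n \<ge> (0::real)"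
      "\<And>j y. j \<ge> 1 \<Longrightarrow> y \<in> ball w d \<Longrightarrow> norm (?f j y) \<le> h j"
      using rem_term_bound[OF assms(1,2,3) xS] by blast
    show ?thesis
    proof (rule summable_comparison_test_ev[OF _ dh(2)])
      show "\<forall>\<^sub>F n in sequentially. norm (norm (?f n w)) \<le> h n"
        using eventually_ge_at_top[of 1] by eventually_elim (use dh in auto)
    qed
  qed
  show "rem_term' a c q \<kappa> N sums deriv (rem_sum a c q \<kappa> N) 0" if "0 \<in> S" "N \<ge> 1"
  proof -
    have "deriv (?f n) 0 = rem_term' a c q \<kappa> N n" for n
      by (rule DERIV_imp_deriv[OF rem_term_deriv_0]) (use assms that in auto)
    then show ?thesis using g(2)[OF that(1)] DERIV_imp_deriv[OF d'[OF that(1)]] by simp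
  qed
qed

subsection \<open>Meromorphic continuation and the Hurwitz zeta function\<close>

lemma connected_halfspace_Re_gt: "connected {w. Re w > b}"
  by (rule convex_connected) (rule convex_halfspace_Re_gt)

text \<open>Identity theorem: the difference, with its singularities removed, is nicely meromorphic
  and vanishes on an open set, hence everywhere. It agrees with the plain difference near each
  point, though perhaps not at it.\<close>

lemma meromorphic_eventually_eq:
  assumes "f meromorphic_on A" "g meromorphic_on A" "open A" "connected A"
    "open B" "B \<noteq> {}" "B \<subseteq> A" "\<And>w. w \<in> B \<Longrightarrow> f w = g w" "z \<in> A"
  shows "eventually (\<lambda>w. f w = g w) (at z)"
proof -
  let ?h = "\<lambda>w. f w - g w"
  have m: "?h meromorphic_on A" using assms by (intro meromorphic_intros)
  then have iso: "isolated_singularity_at ?h x" if "x \<in> A" for x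
    using m that unfolding meromorphic_on_altdef by blast
  obtain b where b: "b \<in> B" using assms by auto
  have "eventually (\<lambda>w. w \<in> B) (at b)" using b assms by (intro eventually_at_in_open') auto
  moreover have "eventually (\<lambda>w. remove_sings ?h w = ?h w) (at b)"
    using iso b assms by (intro eventually_remove_sings_eq_at) auto
  ultimately have "eventually (\<lambda>w. remove_sings ?h w = 0) (at b)"
    by eventually_elim (use assms in auto)
  then have fr: "frequently (\<lambda>w. remove_sings ?h w = 0) (at b)"
    by (simp add: eventually_frequently)
  have z0: "remove_sings ?h w = 0" if "w \<in> A" for w
    by (rule frequently_eq_meromorphic_imp_constant[OF fr remove_sings_nicely_meromorphic[OF m] \<open>open A\<close> \<open>connected A\<close> _ that])
      (use b assms in blast)
  have "eventually (\<lambda>w. remove_sings ?h w = ?h w) (at z)"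
    using iso assms by (intro eventually_remove_sings_eq_at) auto
  moreover have "eventually (\<lambda>w. w \<in> A) (at z)" using assms by (intro eventually_at_in_open') auto
  ultimately show ?thesis by eventually_elim (use z0 in auto)
qed

text \<open>The value of a nicely meromorphic function is determined by a punctured neighbourhood:
  it is the limit, or \<open>0\<close> at a pole.\<close>

lemma nicely_meromorphic_at_unique:
  assumes "f nicely_meromorphic_on {z}" "g nicely_meromorphic_on {z}"
    "eventually (\<lambda>w. f w = g w) (at z)"
  shows "f z = g z"
proof -
  have lim: "f \<midarrow>z\<rightarrow> l \<longleftrightarrow> g \<midarrow>z\<rightarrow> l" for l by (rule tendsto_cong[OF assms(3)])
  have pole: "is_pole f z \<longleftrightarrow> is_pole g z" by (rule is_pole_cong[OF assms(3) refl])
  have np: "\<not> is_pole h z" if "h \<midarrow>z\<rightarrow> l" for h :: "complex \<Rightarrow> complex" and l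
    using that at_neq_bot not_tendsto_and_filterlim_at_infinity unfolding is_pole_def by blast
  have cf: "is_pole f z \<and> f z = 0 \<or> f \<midarrow>z\<rightarrow> f z" and cg: "is_pole g z \<and> g z = 0 \<or> g \<midarrow>z\<rightarrow> g z"
    using assms(1,2) by (auto simp: nicely_meromorphic_on_def)
  show ?thesis
  proof (cases "is_pole f z")
    case True
    then show ?thesis using cf cg pole np by auto
  next
    case False
    then have "g \<midarrow>z\<rightarrow> f z" "g \<midarrow>z\<rightarrow> g z" using cf cg lim pole by auto
    then show ?thesis by (rule LIM_unique)
  qed
qed

lemma nicely_meromorphic_on_iff_at:
  "f nicely_meromorphic_on A \<longleftrightarrow> (\<forall>z\<in>A. f nicely_meromorphic_on {z})"
  unfolding nicely_meromorphic_on_def by (subst meromorphic_on_meromorphic_at) auto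

lemma nicely_meromorphic_on_unique:
  assumes "f nicely_meromorphic_on A" "g nicely_meromorphic_on A" "open A" "connected A"
    "open B" "B \<noteq> {}" "B \<subseteq> A" "\<And>w. w \<in> B \<Longrightarrow> f w = g w" "z \<in> A"
  shows "f z = g z"
proof (rule nicely_meromorphic_at_unique[where f = f and g = g and z = z])
  show "f nicely_meromorphic_on {z}" "g nicely_meromorphic_on {z}"
    using assms nicely_meromorphic_on_subset by (metis empty_subsetI insert_subset)+
  show "eventually (\<lambda>w. f w = g w) (at z)"
    by (rule meromorphic_eventually_eq[of f A g B]) (use assms in \<open>auto simp: nicely_meromorphic_on_def\<close>)
qed

lemma nicely_meromorphic_at_cong:
  assumes "f nicely_meromorphic_on {z}" "eventually (\<lambda>w. f w = g w) (nhds z)"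
  shows "g nicely_meromorphic_on {z}"
proof -
  have ev: "eventually (\<lambda>w. f w = g w) (at z)" and eq: "f z = g z"
    using assms(2) by (auto simp: eventually_nhds_conv_at)
  have "g meromorphic_on {z}"
    using assms(1) ev meromorphic_on_cong[of "{z}" f g "{z}"] by (auto simp: nicely_meromorphic_on_def)
  moreover have "f \<midarrow>z\<rightarrow> l \<longleftrightarrow> g \<midarrow>z\<rightarrow> l" for l by (rule tendsto_cong[OF ev])
  moreover have "is_pole f z \<longleftrightarrow> is_pole g z" by (rule is_pole_cong[OF ev refl])
  ultimately show ?thesis using assms(1) eq by (auto simp: nicely_meromorphic_on_def)
qed

text \<open>On a common half-plane two of the functions agree by the identity theorem, as both equal
  \<open>f\<close> far to the right. The value at \<open>w\<close> may therefore be taken from any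
  half-plane that contains \<open>w\<close>.\<close>

lemma nicely_meromorphic_glue:
  assumes nm: "\<And>M::nat. g M nicely_meromorphic_on {w. Re w > - real M}"
    and eq: "\<And>M w. Re w > \<sigma> \<Longrightarrow> g M w = f w"
  obtains h where "h nicely_meromorphic_on UNIV" "\<And>M w. Re w > - real M \<Longrightarrow> h w = g M w"
proof -
  define K where "K w = nat \<lceil>- Re w\<rceil> + 1" for w
  have K: "Re w > - real (K w)" for w unfolding K_def by linarith
  define h where "h w = g (K w) w" for w
  have le: "g M w = g M' w" if "M \<le> M'" "Re w > - real M" for M M' w
  proof (rule nicely_meromorphic_on_unique[where f = "g M" and g = "g M'" and z = w and A = "{w. Re w > - real M}" and B = "{w. Re w > max \<sigma> (- real M)}"])
    show "g M' nicely_meromorphic_on {w. Re w > - real M}"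
      by (rule nicely_meromorphic_on_subset[OF nm[of M']]) (use that in auto)
    have "of_real (max \<sigma> (- real M) + 1) \<in> {w. Re w > max \<sigma> (- real M)}" unfolding mem_Collect_eq Re_complex_of_real by linarith
    then show "{w. Re w > max \<sigma> (- real M)} \<noteq> {}" by blast
    show "open {w. Re w > max \<sigma> (- real M)}" by (rule open_halfspace_Re_gt)
    show "g M v = g M' v" if "v \<in> {w. Re w > max \<sigma> (- real M)}" for v
      using that eq[of v M] eq[of v M'] by simp
    show "{w. Re w > max \<sigma> (- real M)} \<subseteq> {w. Re w > - real M}" by auto
    show "g M nicely_meromorphic_on {w. Re w > - real M}" by (rule nm)
    show "open {w. Re w > - real M}" by (rule open_halfspace_Re_gt)
    show "connected {w. Re w > - real M}" by (rule connected_halfspace_Re_gt)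
    show "w \<in> {w. Re w > - real M}" using that by blast
  qed
  have hg: "h w = g M w" if "Re w > - real M" for M w
  proof (cases "M \<le> K w")
    case True
    show ?thesis unfolding h_def by (rule le[OF True that, symmetric])
  next
    case False
    then show ?thesis unfolding h_def by (intro le K) simp
  qed
  have "h nicely_meromorphic_on UNIV"
  proof (subst nicely_meromorphic_on_iff_at, rule ballI)
    fix z
    have "g (K z) nicely_meromorphic_on {z}"
      by (rule nicely_meromorphic_on_subset[OF nm[of "K z"]]) (use K[of z] in auto)
    moreover have "eventually (\<lambda>w. w \<in> {w. Re w > - real (K z)}) (nhds z)"
      using K[of z] by (intro eventually_nhds_in_open) (auto simp: open_halfspace_Re_gt)
    then have "eventually (\<lambda>w. g (K z) w = h w) (nhds z)"
      by (rule eventually_mono) (use hg in force)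
    ultimately show "h nicely_meromorphic_on {z}" by (rule nicely_meromorphic_at_cong)
  qed
  then show thesis using hg that by blast
qed

text \<open>A competing continuation comes with its own abscissa; to the right of both abscissas the
  two functions are the same sum.\<close>

lemma series_continuation_eqI:
  assumes "g nicely_meromorphic_on UNIV"
    "\<And>w. Re w > \<sigma> \<Longrightarrow> ((\<lambda>i. a i w) has_sum g w) I"
  shows "series_continuation a I = g"
  unfolding series_continuation_def
proof (rule the_equality)
  show "g nicely_meromorphic_on UNIV \<and> (\<exists>\<sigma>. \<forall>w. \<sigma> < Re w \<longrightarrow> ((\<lambda>i. a i w) has_sum g w) I)"
    using assms by blast
  fix h assume h: "h nicely_meromorphic_on UNIV \<and> (\<exists>\<sigma>. \<forall>w. \<sigma> < Re w \<longrightarrow> ((\<lambda>i. a i w) has_sum h w) I)"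
  then obtain \<sigma>' where s': "\<And>w. \<sigma>' < Re w \<Longrightarrow> ((\<lambda>i. a i w) has_sum h w) I" by blast
  have "of_real (max \<sigma> \<sigma>' + 1) \<in> {w. Re w > max \<sigma> \<sigma>'}" unfolding mem_Collect_eq Re_complex_of_real by linarith
  then have ne: "{w. Re w > max \<sigma> \<sigma>'} \<noteq> {}" by blast
  show "h = g"
  proof
    fix z show "h z = g z"
    proof (rule nicely_meromorphic_on_unique[where f = h and g = g and z = z and A = UNIV and B = "{w. Re w > max \<sigma> \<sigma>'}"])
      show "open {w. Re w > max \<sigma> \<sigma>'}" by (rule open_halfspace_Re_gt)
      show "h w = g w" if "w \<in> {w. Re w > max \<sigma> \<sigma>'}" for w
        using has_sum_unique[OF s' assms(2)] that by simp
    qed (use h assms ne in auto)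
  qed
qed

section \<open>The Hurwitz zeta function by telescoping\<close>

lemma powr_of_real_pos: "x > 0 \<Longrightarrow> complex_of_real x powr v = exp (v * of_real (ln x))"
  by (simp add: powr_def Ln_of_real)

text \<open>All bases are positive reals, so
  \<open>x powr (q - c * w) * (1 + \<kappa> / x ^ c) powr (- w)\<close> can be recombined through
  exponentials of real logarithms, with no branch to watch.\<close>

lemma rem_term_expand:
  assumes "a > 0" "\<bar>\<kappa>\<bar> < a ^ c"
  defines "x \<equiv> \<lambda>j. real j + a"
  shows "x j ^ c + \<kappa> > 0"
    and "rem_term a c q \<kappa> N j w = of_real (x j ^ q) * of_real (x j ^ c + \<kappa>) powr (- w)
      - (\<Sum>i<N. (- w gchoose i) * of_real \<kappa> ^ i * of_real (x j) powr (- (of_nat c * w + of_nat (c * i) - of_nat q)))"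
proof -
  have x: "x j > 0" using assms by (simp add: x_def)
  have "a ^ c \<le> x j ^ c" using assms by (intro power_mono) auto
  then show pos: "x j ^ c + \<kappa> > 0" using assms(2) by linarith
  have "1 + \<kappa> / x j ^ c = (x j ^ c + \<kappa>) / x j ^ c" using x by (simp add: field_simps)
  then have p: "1 + \<kappa> / x j ^ c > 0" and l: "ln (1 + \<kappa> / x j ^ c) = ln (x j ^ c + \<kappa>) - c * ln (x j)"
    using pos x by (auto simp: ln_div ln_realpow)
  have q: "complex_of_real (x j ^ q) = exp (of_nat q * of_real (ln (x j)))"
    using x by (simp add: exp_of_real exp_of_nat_mult of_real_exp[symmetric] flip: of_real_power)
  have xj: "real j + a = x j" by (simp add: x_def)
  have e1: "of_real (x j) powr (of_nat q - of_nat c * w) * (1 + of_real (\<kappa> / x j ^ c)) powr (- w)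
     = of_real (x j ^ q) * of_real (x j ^ c + \<kappa>) powr (- w)"
  proof -
    have "1 + complex_of_real (\<kappa> / x j ^ c) = of_real (1 + \<kappa> / x j ^ c)" by simp
    then have "of_real (x j) powr (of_nat q - of_nat c * w) * (1 + of_real (\<kappa> / x j ^ c)) powr (- w)
      = exp ((of_nat q - of_nat c * w) * of_real (ln (x j))) * exp (- w * of_real (ln (x j ^ c + \<kappa>) - c * ln (x j)))"
      using x p by (simp only: powr_of_real_pos l)
    also have "\<dots> = exp (of_nat q * of_real (ln (x j))) * exp (- w * of_real (ln (x j ^ c + \<kappa>)))"
      by (simp add: exp_add[symmetric] algebra_simps)
    finally show ?thesis using pos by (simp only: q powr_of_real_pos)
  qed
  have e2: "of_real (x j) powr (of_nat q - of_nat c * w) * ((- w gchoose i) * of_real (\<kappa> / x j ^ c) ^ i)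
     = (- w gchoose i) * of_real \<kappa> ^ i * of_real (x j) powr (- (of_nat c * w + of_nat (c * i) - of_nat q))" for i
  proof -
    have "of_real (x j) powr (- (of_nat c * w + of_nat (c * i) - of_nat q))
      = exp ((of_nat q - of_nat c * w) * of_real (ln (x j))) * exp (- (of_nat (c * i) * of_real (ln (x j))))"
      using x by (simp add: powr_of_real_pos exp_add[symmetric] algebra_simps)
    also have "exp (- (of_nat (c * i) * complex_of_real (ln (x j)))) = inverse (of_real (x j) ^ (c * i))"
      using x by (simp add: exp_minus exp_of_nat_mult exp_of_real del: of_nat_mult)
    finally show ?thesis
      using x by (simp add: powr_of_real_pos power_divide power_mult field_simps)
  qed
  show "rem_term a c q \<kappa> N j w = of_real (x j ^ q) * of_real (x j ^ c + \<kappa>) powr (- w)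
      - (\<Sum>i<N. (- w gchoose i) * of_real \<kappa> ^ i * of_real (x j) powr (- (of_nat c * w + of_nat (c * i) - of_nat q)))"
    unfolding rem_term_def binomial_rem_def xj right_diff_distrib sum_distrib_left e1 e2 ..
qed

text \<open>The differences of \<open>x powr (1 - w)\<close> along \<open>x = j + a\<close>
  telescope to \<open>- a powr (1 - w)\<close>. In their binomial expansion the term
  \<open>i = 1\<close> gives \<open>- H w\<close>, and the terms \<open>i \<ge> 2\<close> involve
  \<open>H (w + i - 1)\<close>, which lies further to the right; solving for \<open>H w\<close>
  gains one unit. The increment \<open>1\<close> takes the place of \<open>\<kappa>\<close>, whence
  \<open>a > 1\<close>.\<close>

lemma hurwitz_step:
  assumes a: "a > 1"
    and H: "H holomorphic_on {w. Re w > 1 - real M}"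
    and sums: "\<And>w. Re w > 1 \<Longrightarrow> (\<lambda>j. of_real (real j + a) powr (- w)) sums (H w / (w - 1))"
  obtains H' where "H' holomorphic_on {w. Re w > 1 - real (Suc M)}" "\<And>w. Re w > 1 \<Longrightarrow> H' w = H w" "H' 1 = 1"
proof -
  \<comment> \<open>With \<open>M + 2\<close> terms the remainder, evaluated at
    \<open>w - 1\<close>, converges for \<open>Re w > - M\<close>, the half-plane aimed at.\<close>
  define N where "N = M + 2"
  have [simp]: "\<bar>1\<bar> < a ^ 1" "a > 0" using a by auto
  note RS = rem_sum_properties[where a = a and \<kappa> = 1 and c = 1 and q = 0 and N = N]
  define H' where "H' w = rem_sum a 1 0 1 N (w - 1) + of_real a powr (1 - w)
    - (\<Sum>i=2..<N. ((1 - w) gchoose (i - 1)) / of_nat i * H (w + of_nat i - 1))" for w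
  have hol: "H' holomorphic_on {w. Re w > 1 - real (Suc M)}"
  proof -
    have 1: "(\<lambda>w. rem_sum a 1 0 1 N (w - 1)) holomorphic_on {w. Re w > 1 - real (Suc M)}"
    proof -
      have "rem_sum a 1 0 1 N \<circ> (\<lambda>w. w - 1) holomorphic_on {w. Re w > 1 - real (Suc M)}"
        by (rule holomorphic_on_compose_gen[OF _ RS(3)]) (use a in \<open>auto simp: N_def intro!: holomorphic_intros\<close>)
      then show ?thesis by (simp add: o_def)
    qed
    have 2: "(\<lambda>w. H (w + of_nat i - 1)) holomorphic_on {w. Re w > 1 - real (Suc M)}" if "i \<ge> 2" for i
    proof -
      have "H \<circ> (\<lambda>w. w + of_nat i - 1) holomorphic_on {w. Re w > 1 - real (Suc M)}"
        by (rule holomorphic_on_compose_gen[OF _ H]) (use that in \<open>auto intro!: holomorphic_intros\<close>)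
      then show ?thesis by (simp add: o_def)
    qed
    show ?thesis unfolding H'_def
      by (intro holomorphic_intros 1 2) (use a in auto)
  qed
  have eq: "H' w = H w" if w: "Re w > 1" for w
  proof -
    define u where "u j = complex_of_real (real j + a) powr (1 - w)" for j
    have "u \<longlonglongrightarrow> 0"
    proof (rule tendsto_norm_zero_cancel)
      have "filterlim (\<lambda>j. real j + a) at_top sequentially"
        using filterlim_real_sequentially filterlim_tendsto_add_at_top[OF tendsto_const] by (simp add: add.commute)
      then have "(\<lambda>j. (real j + a) powr (1 - Re w)) \<longlonglongrightarrow> 0"
        using w by (intro tendsto_neg_powr) auto
      moreover have "norm (u j) = (real j + a) powr (1 - Re w)" for j
        unfolding u_def using a by (subst norm_powr_real_powr) auto
      ultimately show "(\<lambda>j. norm (u j)) \<longlonglongrightarrow> 0" by simp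
    qed
    then have tel: "(\<lambda>j. u (Suc j) - u j) sums (0 - u 0)" by (rule telescope_sums)
    have xi: "(\<lambda>j. (- (w - 1) gchoose i) * of_real (real j + a) powr (- (w - 1 + of_nat i)))
        sums ((- (w - 1) gchoose i) * (H (w + of_nat i - 1) / (w + of_nat i - 1 - 1)))" if "i \<ge> 1" for i
      using sums[of "w + of_nat i - 1"] w that by (intro sums_mult) (simp add: algebra_simps)
    \<comment> \<open>The binomial coefficient has the factor \<open>- (w + i - 2)\<close>, which
      cancels the denominator of the Hurwitz sum.\<close>
    have cf: "(- (w - 1) gchoose i) * (H (w + of_nat i - 1) / (w + of_nat i - 1 - 1)) =
        - ((1 - w) gchoose (i - 1)) / of_nat i * H (w + of_nat i - 1)" if "i \<ge> 1" for i
    proof -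
      have nz: "w + of_nat i - 1 - 1 \<noteq> 0" using w that by (auto simp: complex_eq_iff)
      obtain m where m: "i = Suc m" using \<open>i \<ge> 1\<close> by (cases i) auto
      have fr: "g * (- d) / k * (h / d) = - g / k * h" if "d \<noteq> 0" for g d k h :: complex
        using that by simp
      have gi: "(- (w - 1) gchoose i) = ((1 - w) gchoose m) * (- (w + of_nat i - 1 - 1)) / of_nat i"
        unfolding m gbinomial_Suc_over by (simp add: algebra_simps)
      show ?thesis unfolding gi fr[OF nz] using m by simp
    qed
    have "(\<lambda>j. (u (Suc j) - u j) - (\<Sum>i=1..<N. (- (w - 1) gchoose i) * of_real (real j + a) powr (- (w - 1 + of_nat i))))
        sums ((0 - u 0) - (\<Sum>i=1..<N. - ((1 - w) gchoose (i - 1)) / of_nat i * H (w + of_nat i - 1)))"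
      using xi cf by (intro sums_diff tel sums_sum) auto
    moreover have "(u (Suc j) - u j) - (\<Sum>i=1..<N. (- (w - 1) gchoose i) * of_real (real j + a) powr (- (w - 1 + of_nat i)))
        = rem_term a 1 0 1 N j (w - 1)" for j
    proof -
      have N: "{..<N} = insert 0 {1..<N}" by (auto simp: N_def)
      have "rem_term a 1 0 1 N j (w - 1) = of_real (real j + a + 1) powr (- (w - 1)) -
        (\<Sum>i<N. (- (w - 1) gchoose i) * of_real (real j + a) powr (- (w - 1 + of_nat i)))"
        using rem_term_expand(2)[of a 1 1 0 N j "w - 1"] a by simp
      then show ?thesis unfolding N by (simp add: u_def add_ac)
    qed
    ultimately have "rem_sum a 1 0 1 N (w - 1) =
        - u 0 - (\<Sum>i=1..<N. - ((1 - w) gchoose (i - 1)) / of_nat i * H (w + of_nat i - 1))"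
      unfolding rem_sum_def by (simp add: sums_iff)
    moreover have "{1..<N} = insert 1 {2..<N}" by (auto simp: N_def)
    ultimately show ?thesis unfolding H'_def by (simp add: u_def sum_negf)
  qed
  \<comment> \<open>At \<open>w = 1\<close> the remainder and all coefficients with
    \<open>i \<ge> 2\<close> vanish; only \<open>a powr 0\<close> survives.\<close>
  have "rem_term a 1 0 1 N j 0 = 0" for j
  proof -
    have "{..<N} = insert 0 {1..<N}" by (auto simp: N_def)
    moreover have "1 + complex_of_real (1 / (real j + a)) \<noteq> 0"
    proof -
      have "1 + 1 / (real j + a) > 0" using a by (simp add: add_pos_pos)
      then have "complex_of_real (1 + 1 / (real j + a)) \<noteq> 0" unfolding of_real_eq_0_iff by linarith
      then show ?thesis by simp
    qed
    ultimately show ?thesis by (simp add: rem_term_def binomial_rem_def gbinomial_0_left)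
  qed
  then have "H' 1 = 1" using a by (auto simp: H'_def rem_sum_def gbinomial_0_left)
  then show thesis using hol eq that by blast
qed

lemma hurwitz_exists_gt_1:
  assumes a: "a > 1"
  shows "\<exists>H. H holomorphic_on UNIV \<and> H 1 = 1 \<and>
    (\<forall>w. Re w > 1 \<longrightarrow> (\<lambda>j. of_real (real j + a) powr (- w)) sums (H w / (w - 1)))"
proof -
  let ?S = "\<lambda>M w. Re w > 1 - real M"
  have ex: "\<exists>H. H holomorphic_on {w. ?S (Suc M) w} \<and> H 1 = 1 \<and>
    (\<forall>w. Re w > 1 \<longrightarrow> (\<lambda>j. of_real (real j + a) powr (- w)) sums (H w / (w - 1)))" for M
  proof (induction M)
    case 0
    \<comment> \<open>With \<open>N = 0\<close> nothing is subtracted and the remainder is the power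
      itself. One extension is made at once because the point \<open>1\<close>, where the value is
      prescribed, lies outside the half-plane of convergence.\<close>
    have [simp]: "\<bar>0\<bar> < a ^ 1" using a by auto
    note RS = rem_sum_properties[where a = a and \<kappa> = 0 and c = 1 and q = 0 and N = 0]
    let ?H = "\<lambda>w. (w - 1) * rem_sum a 1 0 0 0 w"
    have h: "?H holomorphic_on {w. ?S 0 w}"
      using RS(3) a by (intro holomorphic_intros) auto
    have s: "(\<lambda>j. of_real (real j + a) powr (- w)) sums (?H w / (w - 1))" if "Re w > 1" for w
      using RS(2)[where w=w] that a by (auto simp: rem_term_def binomial_rem_def)
    obtain H' where H': "H' holomorphic_on {w. ?S (Suc 0) w}" "\<And>w. Re w > 1 \<Longrightarrow> H' w = ?H w" "H' 1 = 1"
      using hurwitz_step[OF a h s] by blast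
    have "(\<lambda>j. of_real (real j + a) powr (- w)) sums (H' w / (w - 1))" if "Re w > 1" for w
      unfolding H'(2)[OF that] by (rule s[OF that])
    with H'(1,3) show ?case by blast
  next
    case (Suc M)
    then obtain H where H: "H holomorphic_on {w. ?S (Suc M) w}"
      "\<And>w. Re w > 1 \<Longrightarrow> (\<lambda>j. of_real (real j + a) powr (- w)) sums (H w / (w - 1))" by blast
    obtain H' where H': "H' holomorphic_on {w. ?S (Suc (Suc M)) w}" "\<And>w. Re w > 1 \<Longrightarrow> H' w = H w" "H' 1 = 1"
      using hurwitz_step[OF a H] by blast
    have "(\<lambda>j. of_real (real j + a) powr (- w)) sums (H' w / (w - 1))" if "Re w > 1" for w
      unfolding H'(2)[OF that] by (rule H(2)[OF that])
    with H'(1,3) show ?case by blast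
  qed
  then obtain H where H: "\<And>M. H M holomorphic_on {w. ?S (Suc M) w}" "\<And>M. H M 1 = 1"
    "\<And>M w. Re w > 1 \<Longrightarrow> (\<lambda>j. of_real (real j + a) powr (- w)) sums (H M w / (w - 1))"
    by metis
  have an: "H M analytic_on {w. Re w > - real M}" for M
    using H(1)[of M] by (simp add: analytic_on_open open_halfspace_Re_gt)
  have eq: "H M w = H 0 w" if "Re w > 1" for M w
  proof -
    have "H M w / (w - 1) = H 0 w / (w - 1)" by (rule sums_unique2[OF H(3)[OF that] H(3)[OF that]])
    moreover have "w - 1 \<noteq> 0" using that by auto
    ultimately show ?thesis by simp
  qed
  obtain h where h: "h nicely_meromorphic_on UNIV" "\<And>M w. Re w > - real M \<Longrightarrow> h w = H M w"
    using nicely_meromorphic_glue[OF analytic_on_imp_nicely_meromorphic_on[OF an] eq] by blast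
  have "h analytic_on {z}" for z
  proof -
    obtain M :: nat where M: "Re z > - real M" using reals_Archimedean2[of "- Re z"] by (auto simp: minus_less_iff)
    have "eventually (\<lambda>w. w \<in> {w. Re w > - real M}) (nhds z)"
      using M by (intro eventually_nhds_in_open) (auto simp: open_halfspace_Re_gt)
    then have "eventually (\<lambda>w. H M w = h w) (nhds z)" by eventually_elim (simp add: h)
    moreover have "H M analytic_on {z}" using an[of M] M by (auto intro: analytic_on_subset)
    ultimately show ?thesis using analytic_at_cong by blast
  qed
  then have "h analytic_on UNIV" by (subst analytic_on_analytic_at) blast
  then have "h holomorphic_on UNIV" by (rule analytic_imp_holomorphic)
  moreover have h0: "h w = H 0 w" if "Re w > 0" for w using h(2)[where M = 0] that by simp
  have "h 1 = 1" using h0[of 1] H(2)[of 0] by simp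
  moreover have "(\<lambda>j. of_real (real j + a) powr (- w)) sums (h w / (w - 1))" if "Re w > 1" for w
    using H(3)[OF that, of 0] h0[of w] that by (simp del: of_real_add)
  ultimately show ?thesis by blast
qed

text \<open>The term \<open>j = 0\<close> is entire in \<open>w\<close>; splitting it off replaces
  \<open>a\<close> by \<open>a + 1 > 1\<close>.\<close>

lemma hurwitz_exists:
  assumes a: "a > 0"
  shows "\<exists>H. H holomorphic_on UNIV \<and> H 1 = 1 \<and>
    (\<forall>w. Re w > 1 \<longrightarrow> (\<lambda>j. of_real (real j + a) powr (- w)) sums (H w / (w - 1)))"
proof -
  obtain H where H: "H holomorphic_on UNIV" "H 1 = 1"
     "\<And>w. Re w > 1 \<Longrightarrow> (\<lambda>j. of_real (real j + (a + 1)) powr (- w)) sums (H w / (w - 1))"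
    using hurwitz_exists_gt_1[of "a + 1"] a by auto
  show ?thesis
  proof (intro exI[of _ "\<lambda>w. H w + (w - 1) * of_real a powr (- w)"] conjI allI impI)
    show "(\<lambda>w. H w + (w - 1) * of_real a powr (- w)) holomorphic_on UNIV"
      using a H by (auto intro!: holomorphic_intros)
    fix w :: complex assume w: "Re w > 1"
    have "(\<lambda>j. of_real (real (Suc j) + a) powr (- w)) sums (H w / (w - 1))"
      using H(3)[OF w] by (simp add: add_ac)
    from sums_Suc[OF this] show "(\<lambda>j. of_real (real j + a) powr (- w)) sums
      ((H w + (w - 1) * of_real a powr (- w)) / (w - 1))"
      using w by (auto simp: add_divide_distrib)
  qed (use H in auto)
qed

text \<open>This is \<open>w - 1\<close> times the Hurwitz zeta function with parameter
  \<open>a\<close>; the value \<open>1\<close> at \<open>1\<close> is the residue of the latter.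
  Working with the entire function keeps the pole visible as a denominator.\<close>

definition hurwitz_entire :: "real \<Rightarrow> complex \<Rightarrow> complex" where
  "hurwitz_entire a = (SOME H. H holomorphic_on UNIV \<and> H 1 = 1 \<and>
    (\<forall>w. Re w > 1 \<longrightarrow> (\<lambda>j. of_real (real j + a) powr (- w)) sums (H w / (w - 1))))"

lemma
  assumes "a > 0"
  shows hurwitz_entire_holomorphic: "hurwitz_entire a holomorphic_on A"
    and hurwitz_entire_1: "hurwitz_entire a 1 = 1"
    and hurwitz_entire_sums: "Re w > 1 \<Longrightarrow>
      (\<lambda>j. of_real (real j + a) powr (- w)) sums (hurwitz_entire a w / (w - 1))"
  using someI_ex[OF hurwitz_exists[OF assms]] holomorphic_on_subset[of "hurwitz_entire a" UNIV A]
  unfolding hurwitz_entire_def[symmetric] by auto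

lemma hurwitz_entire_analytic [analytic_intros]:
  assumes "a > 0" "f analytic_on A"
  shows "(\<lambda>w. hurwitz_entire a (f w)) analytic_on A"
proof -
  have "hurwitz_entire a analytic_on UNIV" using hurwitz_entire_holomorphic[OF assms(1)] by (simp add: analytic_on_open)
  then show ?thesis
    using analytic_on_compose_gen[OF assms(2), of "hurwitz_entire a" UNIV] by (simp add: o_def)
qed

lemma cnj_powr_of_real_pos: "x > 0 \<Longrightarrow> cnj (of_real x powr v) = of_real x powr (cnj v)"
  by (simp add: powr_of_real_pos exp_cnj)

text \<open>Schwarz reflection. It makes derivatives at real points real, hence the multiple gamma
  values positive, so that their complex powers behave as real ones.\<close>

lemma hurwitz_entire_cnj:
  assumes a: "a > 0"
  shows "hurwitz_entire a (cnj w) = cnj (hurwitz_entire a w)"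
proof -
  let ?g = "\<lambda>w. cnj (hurwitz_entire a (cnj w))"
  have "(cnj \<circ> hurwitz_entire a \<circ> cnj) holomorphic_on UNIV"
    by (rule holomorphic_on_compose_cnj_cnj) (use a in \<open>auto intro: hurwitz_entire_holomorphic\<close>)
  then have g: "?g holomorphic_on UNIV" by (simp add: o_def)
  have eq: "?g z = hurwitz_entire a z" if z: "Re z > 1" for z
  proof -
    have "(\<lambda>j. cnj (of_real (real j + a) powr (- cnj z))) sums cnj (hurwitz_entire a (cnj z) / (cnj z - 1))"
      by (subst sums_cnj) (use hurwitz_entire_sums[OF a, of "cnj z"] z in auto)
    then have "(\<lambda>j. of_real (real j + a) powr (- z)) sums (?g z / (z - 1))"
      using a by (simp add: cnj_powr_of_real_pos del: of_real_add)
    then have "?g z / (z - 1) = hurwitz_entire a z / (z - 1)"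
      using sums_unique2[OF _ hurwitz_entire_sums[OF a z]] by blast
    moreover have "z - 1 \<noteq> 0" using z by auto
    ultimately show ?thesis by simp
  qed
  have lim: "2 islimpt {z. Re z > 1}"
    by (rule interior_limit_point) (simp add: interior_open open_halfspace_Re_gt)
  have "?g z - hurwitz_entire a z = 0" for z
    by (rule analytic_continuation[of "\<lambda>z. ?g z - hurwitz_entire a z" UNIV "{z. Re z > 1}" 2])
      (use lim eq g a in \<open>auto intro!: holomorphic_intros hurwitz_entire_holomorphic\<close>)
  from this[of "cnj w"] show ?thesis by simp
qed

subsection \<open>Shifted power zeta functions at the origin\<close>

text \<open>A closed form that is known only in a punctured neighbourhood still determines the value
  and the derivative, because niceness excludes a removable singularity.\<close>

lemma nicely_meromorphic_eq_analytic:
  assumes "D nicely_meromorphic_on {z}" "E analytic_on {z}" "eventually (\<lambda>w. D w = E w) (at z)"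
  shows "D analytic_on {z}" "deriv D z = deriv E z"
proof -
  have "D z = E z"
    by (rule nicely_meromorphic_at_unique[OF assms(1) analytic_on_imp_nicely_meromorphic_on[OF assms(2)] assms(3)])
  then have ev: "eventually (\<lambda>w. D w = E w) (nhds z)"
    using assms(3) by (simp add: eventually_nhds_conv_at)
  show "D analytic_on {z}" using analytic_at_cong[OF ev refl] assms(2) by blast
  show "deriv D z = deriv E z" by (rule deriv_cong_ev[OF ev refl])
qed

text \<open>
  The case \<open>c = 2\<close>, \<open>\<kappa> = - s\<^sup>2\<close> occurs in the spectral zeta function, the cases \<open>c = 1\<close>, \<open>\<kappa> = \<plusminus> s\<close>
  in the Barnes zeta functions.
\<close>
definition poly_zeta :: "real \<Rightarrow> nat \<Rightarrow> nat \<Rightarrow> real \<Rightarrow> complex \<Rightarrow> complex" where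
  "poly_zeta a c q \<kappa> = series_continuation
     (\<lambda>j w. of_real ((real j + a) ^ q) * of_real ((real j + a) ^ c + \<kappa>) powr (- w)) UNIV"

text \<open>Hurwitz zeta values stand for the sums of the subtracted terms. At a pole, division by
  zero yields \<open>0\<close>, so values at such isolated points can be wrong; the function is
  therefore used through \<open>remove_sings\<close>, in punctured neighbourhoods, or where the
  original series converges.\<close>

definition binomial_cont :: "real \<Rightarrow> nat \<Rightarrow> nat \<Rightarrow> real \<Rightarrow> nat \<Rightarrow> complex \<Rightarrow> complex" where
  "binomial_cont a c q \<kappa> N w = (\<Sum>i<N. (- w gchoose i) * of_real \<kappa> ^ i *
     (hurwitz_entire a (of_nat c * w + of_nat (c * i) - of_nat q) / (of_nat c * w + of_nat (c * i) - of_nat q - 1)))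
     + rem_sum a c q \<kappa> N w"

definition hurwitz_zeta :: "real \<Rightarrow> complex \<Rightarrow> complex" where
  "hurwitz_zeta a u = hurwitz_entire a u / (u - 1)"

text \<open>
  The derivative at \<open>0\<close> of the summand with index \<open>i\<close> in \<open>binomial_cont\<close>, after removal of its singularity.
  The pole of the Hurwitz zeta function is met for \<open>c * i = q + 1\<close>; there the second-order term
  of the binomial coefficient contributes the harmonic number.
\<close>
definition binomial_coeff_deriv :: "real \<Rightarrow> nat \<Rightarrow> nat \<Rightarrow> real \<Rightarrow> nat \<Rightarrow> complex" where
  "binomial_coeff_deriv a c q \<kappa> i =
    (if i = 0 then of_nat c * deriv (hurwitz_zeta a) (- of_nat q)
     else of_real ((- \<kappa>) ^ i) / of_nat i *
       (if c * i = q + 1 then harm (i - 1) / of_nat c + deriv (hurwitz_entire a) 1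
        else hurwitz_zeta a (of_nat (c * i) - of_nat q)))"

text \<open>Splitting the factor \<open>- w / i\<close> off \<open>- w gchoose i\<close> leaves
  \<open>(- w - 1) gchoose (i - 1)\<close>. Its derivative is the second-order term that survives
  where the factor \<open>w\<close> meets a pole.\<close>

lemma gbinomial_m1_deriv_0:
  "((\<lambda>w. ((- w - 1) gchoose m) :: complex) has_field_derivative (- 1) ^ m * harm m) (at 0)"
proof (induction m)
  case 0
  then show ?case by (simp add: harm_def)
next
  case (Suc m)
  have g: "((- 0 - 1 :: complex) gchoose m) = (- 1) ^ m"
    using gbinomial_minus[of "1::complex" m] by (simp add: binomial_gbinomial[symmetric])
  have "((\<lambda>w. ((- w - 1) gchoose m) * (- w - 1 - of_nat m) / of_nat (Suc m)) has_field_derivative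
      (((- 1) ^ m * harm m) * (- 0 - 1 - of_nat m) + (- 1) * ((- 0 - 1) gchoose m)) / of_nat (Suc m)) (at (0::complex))"
    by (intro DERIV_cdivide DERIV_mult Suc.IH) (auto intro!: derivative_eq_intros)
  moreover have "(((- 1) ^ m * harm m) * (- 0 - 1 - of_nat m) + (- 1) * ((- 0 - 1) gchoose m)) / of_nat (Suc m)
      = (- 1) ^ Suc m * (harm (Suc m) :: complex)"
  proof -
    have "(e * h * (- k) + (- 1) * e) / k = (- e) * (h + inverse k)" if "k \<noteq> 0" for e h k :: complex
      using that by (simp add: field_simps)
    from this[of "of_nat (Suc m)" "(- 1) ^ m" "harm m"] show ?thesis
      unfolding g by (simp add: harm_Suc del: of_nat_Suc) (simp add: algebra_simps)
  qed
  ultimately show ?case unfolding gbinomial_Suc_over by simp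
qed

lemma binomial_cont_summand_at_0:
  assumes a: "a > 0" and c: "c > 0"
  shows "\<exists>E. E analytic_on {0} \<and> deriv E 0 = binomial_coeff_deriv a c q \<kappa> i \<and>
    eventually (\<lambda>w. (- w gchoose i) * of_real \<kappa> ^ i *
     (hurwitz_entire a (of_nat c * w + of_nat (c * i) - of_nat q) / (of_nat c * w + of_nat (c * i) - of_nat q - 1)) = E w) (at 0)"
proof (cases "c * i = q + 1")
  case True
  then have i: "i > 0" by (cases i) auto
  have ci: "of_nat (c * i) = of_nat q + (1::complex)" unfolding True by simp
  \<comment> \<open>The factor \<open>- w\<close> of the binomial coefficient has cancelled the
    \<open>c * w\<close> left in the denominator: this is the summand with its removable singularity
    filled in.\<close>
  define E where "E w = - (of_real \<kappa> ^ i / (of_nat i * of_nat c)) * (((- w - 1) gchoose (i - 1)) * hurwitz_entire a (of_nat c * w + 1))" for w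
  have "E analytic_on {0}" unfolding E_def using a i c by (auto intro!: analytic_intros)
  moreover have "deriv E 0 = binomial_coeff_deriv a c q \<kappa> i"
  proof -
    have "(hurwitz_entire a has_field_derivative deriv (hurwitz_entire a) 1) (at 1)"
      using hurwitz_entire_holomorphic[OF a, of UNIV] by (simp add: holomorphic_derivI)
    then have h: "((\<lambda>w. hurwitz_entire a (of_nat c * w + 1)) has_field_derivative deriv (hurwitz_entire a) 1 * of_nat c) (at 0)"
      by (intro DERIV_chain2[where f = "hurwitz_entire a"]) (auto intro!: derivative_eq_intros)
    have g: "((- 0 - 1 :: complex) gchoose (i - 1)) = (- 1) ^ (i - 1)"
      using gbinomial_minus[of "1::complex" "i - 1"] by (simp add: binomial_gbinomial[symmetric])
    have "(E has_field_derivative - (of_real \<kappa> ^ i / (of_nat i * of_nat c)) *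
       ((- 1) ^ (i - 1) * harm (i - 1) * 1 + deriv (hurwitz_entire a) 1 * of_nat c * (- 1) ^ (i - 1))) (at 0)"
      unfolding E_def using DERIV_cmult[OF DERIV_mult[OF gbinomial_m1_deriv_0 h], of "- (of_real \<kappa> ^ i / (of_nat i * of_nat c))" "i - 1"]
      by (simp add: hurwitz_entire_1[OF a] g[simplified])
    moreover have "- (of_real \<kappa> ^ i / (of_nat i * of_nat c)) *
       ((- 1) ^ (i - 1) * harm (i - 1) * 1 + deriv (hurwitz_entire a) 1 * of_nat c * (- 1) ^ (i - 1))
      = binomial_coeff_deriv a c q \<kappa> i"
    proof -
      obtain m where m: "i = Suc m" using i by (cases i) auto
      show ?thesis
        using True i c unfolding binomial_coeff_deriv_def
        by (simp add: power_minus[of \<kappa>] m field_simps del: of_nat_Suc)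
    qed
    ultimately show ?thesis by (simp add: DERIV_imp_deriv)
  qed
  moreover have "eventually (\<lambda>w. (- w gchoose i) * of_real \<kappa> ^ i *
     (hurwitz_entire a (of_nat c * w + of_nat (c * i) - of_nat q) / (of_nat c * w + of_nat (c * i) - of_nat q - 1)) = E w) (at 0)"
  proof -
    have "eventually (\<lambda>w::complex. w \<noteq> 0) (at 0)" by (rule eventually_neq_at_within)
    then show ?thesis
    proof eventually_elim
      case (elim w)
      have "(- w gchoose i) = - w / of_nat i * ((- w - 1) gchoose (i - 1))"
        using gbinomial_factors[of "- w - 1" "i - 1"] i by (simp add: field_simps)
      moreover have "- w / k * g * K * (h / (cc * w + 1 - 1)) = - (K / (k * cc)) * (g * h)"
        if "k \<noteq> 0" "cc \<noteq> 0" for k cc g K h :: complex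
        using elim that by simp
      moreover have "of_nat c * w + (of_nat q + 1) - of_nat q = of_nat c * w + 1" by simp
      ultimately show ?case unfolding E_def ci using c i by simp
    qed
  qed
  ultimately show ?thesis by blast
next
  case False
  define u where "u = (of_nat (c * i) - of_nat q :: complex)"
  have "of_nat (c * i) \<noteq> (of_nat (q + 1) :: complex)" using False of_nat_eq_iff by blast
  then have u: "u \<noteq> 1" by (auto simp: u_def algebra_simps)
  define Z where "Z w = hurwitz_zeta a (of_nat c * w + u)" for w
  define E where "E w = (- w gchoose i) * of_real \<kappa> ^ i * Z w" for w
  have Zan: "hurwitz_zeta a analytic_on {u}"
    unfolding hurwitz_zeta_def[abs_def] using a u by (auto intro!: analytic_intros)
  have "(hurwitz_zeta a has_field_derivative deriv (hurwitz_zeta a) u) (at (of_nat c * 0 + u))"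
    using Zan analytic_derivI by simp
  then have Zd: "(Z has_field_derivative deriv (hurwitz_zeta a) u * of_nat c) (at 0)"
    unfolding Z_def
    by (intro DERIV_chain2[where f = "hurwitz_zeta a"]) (auto intro!: derivative_eq_intros)
  have "E analytic_on {0}" unfolding E_def Z_def hurwitz_zeta_def using a u
    by (auto intro!: analytic_intros)
  \<comment> \<open>For \<open>i = 0\<close> the coefficient is constantly \<open>1\<close> and the
    zeta value is differentiated; for \<open>i > 0\<close> the coefficient vanishes at
    \<open>0\<close>, so only its own derivative contributes.\<close>
  moreover have "deriv E 0 = binomial_coeff_deriv a c q \<kappa> i"
  proof (cases "i = 0")
    case True
    then have "E = Z" "u = - of_nat q" by (auto simp: E_def u_def)
    then show ?thesis using DERIV_imp_deriv[OF Zd] True by (simp add: binomial_coeff_deriv_def)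
  next
    case i: False
    have "(E has_field_derivative ((- 1) ^ i / of_nat i * of_real \<kappa> ^ i * Z 0 + deriv (hurwitz_zeta a) u * of_nat c * ((- 0 gchoose i) * of_real \<kappa> ^ i))) (at 0)"
      unfolding E_def using i by (intro DERIV_mult Zd DERIV_cmult_right gbinomial_deriv_0) auto
    then have "deriv E 0 = (- 1) ^ i / of_nat i * of_real \<kappa> ^ i * Z 0"
      using i by (simp add: DERIV_imp_deriv gbinomial_0_left)
    then show ?thesis
      using i False unfolding binomial_coeff_deriv_def Z_def u_def
      by (simp add: power_minus[of \<kappa>])
  qed
  moreover have "eventually (\<lambda>w. (- w gchoose i) * of_real \<kappa> ^ i *
     (hurwitz_entire a (of_nat c * w + of_nat (c * i) - of_nat q) / (of_nat c * w + of_nat (c * i) - of_nat q - 1)) = E w) (at 0)"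
    unfolding E_def Z_def hurwitz_zeta_def u_def by (simp add: algebra_simps)
  ultimately show ?thesis by blast
qed

text \<open>Where the original series converges, the subtracted terms are themselves convergent
  Hurwitz sums, and adding them back undoes the subtraction for every \<open>N\<close>.\<close>

lemma binomial_cont_props:
  fixes a \<kappa> :: real and c q N :: nat
  assumes a: "a > 0" and \<kappa>: "\<bar>\<kappa>\<bar> < a ^ c" and c: "c > 0"
  shows "binomial_cont a c q \<kappa> N meromorphic_on {w. Re (of_nat c * w) > real q + 1 - real (c * N)}"
    and "Re (of_nat c * w) > real q + 1 \<Longrightarrow> binomial_cont a c q \<kappa> N w = rem_sum a c q \<kappa> 0 w"
proof -
  let ?S = "{w. Re (of_nat c * w) > real q + 1 - real (c * N)}"
  note RS = rem_sum_properties[OF a \<kappa> c, where q = q]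
  have "rem_sum a c q \<kappa> N analytic_on ?S"
    using RS(1,3)[where N = N] by (simp add: analytic_on_open)
  then have 1: "rem_sum a c q \<kappa> N meromorphic_on ?S" by (rule analytic_on_imp_meromorphic_on)
  have 2: "(\<lambda>w. hurwitz_entire a (f w)) meromorphic_on ?S" if "f analytic_on ?S" for f
    using a that by (intro analytic_on_imp_meromorphic_on hurwitz_entire_analytic)
  have 3: "(\<lambda>w. (- w gchoose i)) meromorphic_on ?S" for i
    by (intro analytic_on_imp_meromorphic_on analytic_intros)
  show "binomial_cont a c q \<kappa> N meromorphic_on ?S"
    unfolding binomial_cont_def[abs_def]
    by (intro meromorphic_intros 1 2 3 analytic_intros)
  show "binomial_cont a c q \<kappa> N w = rem_sum a c q \<kappa> 0 w" if w: "Re (of_nat c * w) > real q + 1"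
  proof -
    have w': "w \<in> {w. Re (of_nat c * w) > real q + 1 - real (c * M)}" for M
    proof -
      have "real (c * M) \<ge> 0" by simp
      then show ?thesis unfolding mem_Collect_eq using w by linarith
    qed
    define u where "u i = of_nat c * w + of_nat (c * i) - of_nat q" for i
    have u: "Re (u i) > 1" for i
    proof -
      have "Re (u i) = Re (of_nat c * w) + real (c * i) - real q" by (simp add: u_def)
      moreover have "real (c * i) \<ge> 0" by simp
      ultimately show ?thesis using w by linarith
    qed
    have "(\<lambda>j. rem_term a c q \<kappa> 0 j w - (\<Sum>i<N. (- w gchoose i) * of_real \<kappa> ^ i * of_real (real j + a) powr (- u i)))
       sums (rem_sum a c q \<kappa> 0 w - (\<Sum>i<N. (- w gchoose i) * of_real \<kappa> ^ i * (hurwitz_entire a (u i) / (u i - 1))))"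
      by (intro sums_diff RS(2) w' sums_sum sums_mult hurwitz_entire_sums a u)
    moreover have "rem_term a c q \<kappa> 0 j w - (\<Sum>i<N. (- w gchoose i) * of_real \<kappa> ^ i * of_real (real j + a) powr (- u i))
       = rem_term a c q \<kappa> N j w" for j
      unfolding rem_term_expand(2)[OF a \<kappa>] u_def by simp
    ultimately have "rem_sum a c q \<kappa> N w = rem_sum a c q \<kappa> 0 w - (\<Sum>i<N. (- w gchoose i) * of_real \<kappa> ^ i * (hurwitz_entire a (u i) / (u i - 1)))"
      unfolding rem_sum_def[of _ _ _ _ N] by (simp add: sums_iff)
    then show ?thesis unfolding binomial_cont_def u_def by simp
  qed
qed

lemma poly_zeta_continuation:
  fixes a \<kappa> :: real and c q :: nat
  assumes a: "a > 0" and \<kappa>: "\<bar>\<kappa>\<bar> < a ^ c" and c: "c > 0"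
  shows poly_zeta_nicely_meromorphic: "poly_zeta a c q \<kappa> nicely_meromorphic_on UNIV"
    and poly_zeta_sums: "Re (of_nat c * w) > real q + 1 \<Longrightarrow>
      (\<lambda>j. of_real ((real j + a) ^ q) * of_real ((real j + a) ^ c + \<kappa>) powr (- w)) sums poly_zeta a c q \<kappa> w"
    and poly_zeta_abs_summable: "Re (of_nat c * w) > real q + 1 \<Longrightarrow>
      summable (\<lambda>j. norm (of_real ((real j + a) ^ q) * complex_of_real ((real j + a) ^ c + \<kappa>) powr (- w)))"
    and poly_zeta_analytic: "poly_zeta a c q \<kappa> analytic_on {w. Re (of_nat c * w) > real q + 1}"
    and poly_zeta_analytic_0: "poly_zeta a c q \<kappa> analytic_on {0}"
    and poly_zeta_deriv_0: "c * N > q + 1 \<Longrightarrow> deriv (poly_zeta a c q \<kappa>) 0 =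
       (\<Sum>i<N. binomial_coeff_deriv a c q \<kappa> i) + deriv (rem_sum a c q \<kappa> N) 0"
    and poly_zeta_rem_sums: "c * N > q + 1 \<Longrightarrow> rem_term' a c q \<kappa> N sums deriv (rem_sum a c q \<kappa> N) 0"
proof -
  let ?B = "binomial_cont a c q \<kappa>"
  let ?R = "rem_sum a c q \<kappa> 0"
  let ?T = "{w. Re (of_nat c * w) > real q + 1}"
  let ?t = "\<lambda>j w. of_real ((real j + a) ^ q) * complex_of_real ((real j + a) ^ c + \<kappa>) powr (- w)"
  note RS = rem_sum_properties[OF a \<kappa> c, where q = q]
  have t: "rem_term a c q \<kappa> 0 = ?t"
    using rem_term_expand(2)[OF a \<kappa>, of q 0] by (simp add: fun_eq_iff)
  have o: "open ?T" using RS(1)[where N = 0] by simp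
  have Ran: "?R analytic_on ?T" using RS(3)[where N = 0] o by (simp add: analytic_on_open)
  have half: "Re (of_nat c * w) > x \<longleftrightarrow> Re w > x / real c" for w x
    using c by (simp add: field_simps)
  \<comment> \<open>With this many terms the half-plane contains \<open>Re w > - M\<close> for every
    \<open>c \<ge> 1\<close>, since \<open>q + 1 \<le> c * (q + 1)\<close>.\<close>
  define g where "g M = remove_sings (?B (M + q + 1))" for M
  have gnm: "g M nicely_meromorphic_on {w. Re w > - real M}" for M
  proof -
    have "?B (M + q + 1) meromorphic_on {w. Re w > - real M}"
    proof (rule meromorphic_on_subset[OF binomial_cont_props(1)[OF a \<kappa> c]], safe)
      fix w assume w: "- real M < Re w"
      have "real c * - real M < real c * Re w" using c w by (intro mult_strict_left_mono) auto
      moreover have "real q + 1 \<le> real c * (real q + 1)"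
        using mult_right_mono[of 1 "real c" "real q + 1"] c by simp
      ultimately show "real q + 1 - real (c * (M + q + 1)) < Re (of_nat c * w)"
        by (simp add: algebra_simps)
    qed
    then show ?thesis unfolding g_def by (rule remove_sings_nicely_meromorphic)
  qed
  have BR: "eventually (\<lambda>v. ?B N v = ?R v) (nhds w)" if "w \<in> ?T" for w N
  proof -
    have "eventually (\<lambda>v. v \<in> ?T) (nhds w)" using that o by (intro eventually_nhds_in_open)
    then show ?thesis
      by (rule eventually_mono) (use binomial_cont_props(2)[OF a \<kappa> c] in blast)
  qed
  have Ran1: "?R analytic_on {w}" if "w \<in> ?T" for w
    by (rule analytic_on_subset[OF Ran]) (use that in blast)
  have gR0: "g M w = ?R w" if "w \<in> ?T" for M w
  proof -
    have "?B (M + q + 1) analytic_on {w}"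
      using analytic_at_cong[OF BR[OF that] refl] Ran1[OF that] by blast
    then have "g M w = ?B (M + q + 1) w" unfolding g_def by (rule remove_sings_at_analytic)
    also have "\<dots> = ?R w" by (rule binomial_cont_props(2)[OF a \<kappa> c]) (use that in blast)
    finally show ?thesis .
  qed
  have gR: "g M w = ?R w" if "Re w > (real q + 1) / real c" for M w
    using gR0 that half by blast
  obtain D where D: "D nicely_meromorphic_on UNIV" "\<And>M w. Re w > - real M \<Longrightarrow> D w = g M w"
    using nicely_meromorphic_glue[OF gnm gR] by blast
  have DR: "D w = ?R w" if "w \<in> ?T" for w
  proof -
    have "Re (of_nat c * w) > real q + 1" using that by blast
    then have "Re w > (real q + 1) / real c" unfolding half .
    moreover have "(real q + 1) / real c \<ge> 0" by simp
    ultimately have "Re w > - real 0" by linarith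
    then show ?thesis using D(2) gR0[OF that] by metis
  qed
  have sm: "summable (\<lambda>j. norm (?t j w))" if "w \<in> ?T" for w
    using RS(4)[of w 0] that unfolding t by simp
  have sums: "(\<lambda>j. ?t j w) sums D w" if "w \<in> ?T" for w
    using RS(2)[of w 0] that unfolding t DR[OF that] by simp
  have eqD: "poly_zeta a c q \<kappa> = D" unfolding poly_zeta_def
  proof (rule series_continuation_eqI[OF D(1)])
    fix w assume "Re w > (real q + 1) / real c"
    then have w: "w \<in> ?T" using half by blast
    show "((\<lambda>j. ?t j w) has_sum D w) UNIV"
      using norm_summable_imp_has_sum[OF sm[OF w] sums[OF w]] .
  qed
  show "poly_zeta a c q \<kappa> nicely_meromorphic_on UNIV" unfolding eqD by (rule D(1))
  show "(\<lambda>j. ?t j w) sums poly_zeta a c q \<kappa> w" if "Re (of_nat c * w) > real q + 1"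
    unfolding eqD using sums that by blast
  show "summable (\<lambda>j. norm (?t j w))" if "Re (of_nat c * w) > real q + 1"
    using sm that by blast
  have "D holomorphic_on ?T"
    by (rule holomorphic_transform[OF analytic_imp_holomorphic[OF Ran]]) (use DR in simp)
  then show "poly_zeta a c q \<kappa> analytic_on ?T" unfolding eqD using o by (simp add: analytic_on_open)
  \<comment> \<open>\<open>N\<close> stays free here, so that the derivatives can later be computed
    with \<open>2 * N\<close> terms for \<open>c = 1\<close> and \<open>N\<close> terms for
    \<open>c = 2\<close>.\<close>
  have at0: "D analytic_on {0} \<and> deriv D 0 = (\<Sum>i<N. binomial_coeff_deriv a c q \<kappa> i) + deriv (rem_sum a c q \<kappa> N) 0"
    if N: "c * N > q + 1" for N
  proof -
    let ?S = "{w. Re (of_nat c * w) > real q + 1 - real (c * N)}"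
    have z: "0 \<in> ?S" using N of_nat_less_iff[of "q + 1" "c * N", where ?'a = real] by simp
    have oS: "open ?S" using RS(1)[where N = N] .
    have cS: "connected ?S" unfolding half by (rule connected_halfspace_Re_gt)
    have "Re (of_nat c * of_real ((real q + 2) / real c)) = real q + 2" using c by simp
    then have "of_real ((real q + 2) / real c) \<in> ?T" unfolding mem_Collect_eq by linarith
    then have ne: "?T \<noteq> {}" by blast
    have ev1: "eventually (\<lambda>w. D w = ?B N w) (at 0)"
    proof (rule meromorphic_eventually_eq[OF _ binomial_cont_props(1)[OF a \<kappa> c] oS cS o ne _ _ z])
      show "D meromorphic_on ?S" using D(1) nicely_meromorphic_on_def meromorphic_on_subset by blast
      have nn: "real (c * N) \<ge> 0" by simp
      show "?T \<subseteq> ?S"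
      proof
        fix w assume "w \<in> ?T"
        then show "w \<in> ?S" unfolding mem_Collect_eq using nn by linarith
      qed
      show "D w = ?B N w" if "w \<in> ?T" for w
        using DR[OF that] binomial_cont_props(2)[OF a \<kappa> c, of q w N] that by simp
    qed
    have "\<exists>E. \<forall>i. E i analytic_on {0} \<and> deriv (E i) 0 = binomial_coeff_deriv a c q \<kappa> i \<and>
    eventually (\<lambda>w. (- w gchoose i) * of_real \<kappa> ^ i *
     (hurwitz_entire a (of_nat c * w + of_nat (c * i) - of_nat q) / (of_nat c * w + of_nat (c * i) - of_nat q - 1)) = E i w) (at 0)"
      by (intro choice allI binomial_cont_summand_at_0 a c)
    then obtain E where E: "\<And>i. E i analytic_on {0}" "\<And>i. deriv (E i) 0 = binomial_coeff_deriv a c q \<kappa> i"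
     "\<And>i. eventually (\<lambda>w. (- w gchoose i) * of_real \<kappa> ^ i *
     (hurwitz_entire a (of_nat c * w + of_nat (c * i) - of_nat q) / (of_nat c * w + of_nat (c * i) - of_nat q - 1)) = E i w) (at 0)"
      by blast
    have "rem_sum a c q \<kappa> N analytic_on ?S" using RS(3)[where N = N] oS by (simp add: analytic_on_open)
    then have Ra: "rem_sum a c q \<kappa> N analytic_on {0}" by (rule analytic_on_subset) (use z in blast)
    let ?E = "\<lambda>w. (\<Sum>i<N. E i w) + rem_sum a c q \<kappa> N w"
    have Ean: "?E analytic_on {0}" using E Ra by (intro analytic_intros) auto
    have "((\<lambda>w. (\<Sum>i<N. E i w) + rem_sum a c q \<kappa> N w) has_field_derivative
      (\<Sum>i<N. binomial_coeff_deriv a c q \<kappa> i) + deriv (rem_sum a c q \<kappa> N) 0) (at 0)"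
    proof (intro DERIV_add DERIV_sum)
      show "(E i has_field_derivative binomial_coeff_deriv a c q \<kappa> i) (at 0)" for i
        using analytic_derivI[OF E(1)[of i]] unfolding E(2) .
      show "(rem_sum a c q \<kappa> N has_field_derivative deriv (rem_sum a c q \<kappa> N) 0) (at 0)"
        by (rule analytic_derivI[OF Ra])
    qed
    then have dE: "deriv ?E 0 = (\<Sum>i<N. binomial_coeff_deriv a c q \<kappa> i) + deriv (rem_sum a c q \<kappa> N) 0"
      by (rule DERIV_imp_deriv)
    have "eventually (\<lambda>w. \<forall>i\<in>{..<N}. (- w gchoose i) * of_real \<kappa> ^ i *
     (hurwitz_entire a (of_nat c * w + of_nat (c * i) - of_nat q) / (of_nat c * w + of_nat (c * i) - of_nat q - 1)) = E i w) (at 0)"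
      using E(3) by (intro eventually_ball_finite) auto
    with ev1 have ev: "eventually (\<lambda>w. D w = ?E w) (at 0)"
      by eventually_elim (simp add: binomial_cont_def)
    have "D nicely_meromorphic_on {0}" using D(1) nicely_meromorphic_on_subset by blast
    from nicely_meromorphic_eq_analytic[OF this Ean ev] dE show ?thesis by simp
  qed
  have "c * (q + 2) > q + 1" using c by (cases c) auto
  then show "poly_zeta a c q \<kappa> analytic_on {0}" unfolding eqD using at0 by blast
  show "deriv (poly_zeta a c q \<kappa>) 0 =
       (\<Sum>i<N. binomial_coeff_deriv a c q \<kappa> i) + deriv (rem_sum a c q \<kappa> N) 0" if "c * N > q + 1"
    unfolding eqD using at0[OF that] by blast
  show "rem_term' a c q \<kappa> N sums deriv (rem_sum a c q \<kappa> N) 0" if N: "c * N > q + 1"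
  proof (rule RS(5))
    show "0 \<in> {w. Re (of_nat c * w) > real q + 1 - real (c * N)}"
      using N of_nat_less_iff[of "q + 1" "c * N", where ?'a = real] by simp
    show "1 \<le> N" using N by (cases N) auto
  qed
qed

lemma sum_even_odd_split:
  fixes N :: nat
  shows "(\<Sum>i<2 * N. f i) = (\<Sum>i<N. f (2 * i) + f (2 * i + 1) :: 'a :: comm_monoid_add)"
  by (induction N) (simp_all add: add_ac)

text \<open>Term \<open>i\<close> of the expansion for \<open>c = 2\<close> is matched with the
  terms \<open>2 * i\<close> for \<open>c = 1\<close>; terms of odd index cancel between
  \<open>s\<close> and \<open>- s\<close>. The remainders agree because
  \<open>1 - t ^ 2 = (1 + t) * (1 - t)\<close>. Only at the pole, \<open>2 * i = q + 1\<close>, does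
  a difference remain, that of \<open>harm (2 * i - 1)\<close> and
  \<open>harm (i - 1) / 2\<close>.\<close>

lemma poly_zeta_deriv_anomaly:
  fixes a s :: real
  assumes a: "a > 0" and s: "\<bar>s\<bar> < a"
  shows "deriv (poly_zeta a 1 q s) 0 + deriv (poly_zeta a 1 q (- s)) 0 - deriv (poly_zeta a 2 q (- s\<^sup>2)) 0
    = (if odd q then of_real (s ^ (q + 1) * (2 * harm q - harm (q div 2)) / real (q + 1)) else 0)"
proof -
  define N where "N = q + 2"
  have s2: "s\<^sup>2 < a\<^sup>2" using a s by (simp add: abs_square_less_1 power2_strict_mono)
  have k: "\<bar>s\<bar> < a ^ 1" "\<bar>- s\<bar> < a ^ 1" "\<bar>- s\<^sup>2\<bar> < a ^ 2" using s s2 by auto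
  have N: "1 * (2 * N) > q + 1" "2 * N > q + 1" by (auto simp: N_def)
  note d1 = poly_zeta_deriv_0[OF a k(1) zero_less_one N(1)] poly_zeta_deriv_0[OF a k(2) zero_less_one N(1)]
  note d2 = poly_zeta_deriv_0[OF a k(3) zero_less_numeral N(2)]
  have rem: "deriv (rem_sum a 1 q s (2 * N)) 0 + deriv (rem_sum a 1 q (- s) (2 * N)) 0 = deriv (rem_sum a 2 q (- s\<^sup>2) N) 0"
  proof (rule sums_unique2)
    show "(\<lambda>j. rem_term' a 1 q s (2 * N) j + rem_term' a 1 q (- s) (2 * N) j) sums
       (deriv (rem_sum a 1 q s (2 * N)) 0 + deriv (rem_sum a 1 q (- s) (2 * N)) 0)"
      by (intro sums_add poly_zeta_rem_sums[OF a] k N zero_less_one)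
    have "rem_term' a 1 q s (2 * N) j + rem_term' a 1 q (- s) (2 * N) j = rem_term' a 2 q (- s\<^sup>2) N j" for j
    proof -
      define x where "x = real j + a"
      define t where "t = s / x"
      have x: "x > 0" "\<bar>s\<bar> < x" using a s by (auto simp: x_def)
      have t: "\<bar>t\<bar> < 1" using x by (simp add: t_def abs_divide)
      have "(1 + t) * (1 - t) = 1 + - s\<^sup>2 / x\<^sup>2" using x by (simp add: t_def power2_eq_square field_simps)
      then have ln: "ln (1 + - s\<^sup>2 / x\<^sup>2) = ln (1 + t) + ln (1 - t)"
      proof -
        have "1 + t > 0" "1 - t > 0" using t by auto
        then show ?thesis unfolding \<open>(1 + t) * (1 - t) = 1 + - s\<^sup>2 / x\<^sup>2\<close>[symmetric] by (rule ln_mult_pos)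
      qed
      \<comment> \<open>Truncation after \<open>2 * N\<close> terms in \<open>t\<close> is
        truncation after \<open>N\<close> terms in \<open>t ^ 2\<close>.\<close>
      have sm: "(\<Sum>i=1..<2*N. (- t) ^ i / real i) + (\<Sum>i=1..<2*N. t ^ i / real i) = (\<Sum>i=1..<N. (t\<^sup>2) ^ i / real i)"
      proof -
        have e: "(\<Sum>i=Suc 0..<M. f i) = (\<Sum>i<M. f i)" if "f 0 = 0" for M and f :: "nat \<Rightarrow> real"
          using that by (intro sum.mono_neutral_left) (auto simp: not_le less_Suc_eq_le)
        have "(\<Sum>i<2*N. (- t) ^ i / real i) + (\<Sum>i<2*N. t ^ i / real i) = (\<Sum>i<2*N. ((- t) ^ i + t ^ i) / real i)"
          by (simp add: sum.distrib add_divide_distrib)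
        also have "\<dots> = (\<Sum>i<N. (t\<^sup>2) ^ i / real i)"
          unfolding sum_even_odd_split by (intro sum.cong) (auto simp: power_mult)
        finally show ?thesis by (simp add: e)
      qed
      have p: "s\<^sup>2 / x\<^sup>2 = t\<^sup>2" by (simp add: t_def power_divide)
      have "rem_term' a 1 q s (2 * N) j + rem_term' a 1 q (- s) (2 * N) j =
         of_real (x ^ q * (- (ln (1 + t) + ln (1 - t)) - ((\<Sum>i=1..<2*N. (- t) ^ i / real i) + (\<Sum>i=1..<2*N. t ^ i / real i))))"
        unfolding rem_term'_def x_def[symmetric] of_real_add[symmetric]
        by (simp add: t_def algebra_simps)
      also have "\<dots> = rem_term' a 2 q (- s\<^sup>2) N j"
        unfolding sm ln[symmetric] rem_term'_def x_def[symmetric] by (simp add: p)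
      finally show ?thesis .
    qed
    then show "(\<lambda>j. rem_term' a 1 q s (2 * N) j + rem_term' a 1 q (- s) (2 * N) j) sums deriv (rem_sum a 2 q (- s\<^sup>2) N) 0"
      using poly_zeta_rem_sums[OF a k(3) zero_less_numeral N(2)] by simp
  qed
  let ?b = "binomial_coeff_deriv a"
  have b: "?b 1 q s (2 * i) + ?b 1 q s (2 * i + 1) + (?b 1 q (- s) (2 * i) + ?b 1 q (- s) (2 * i + 1)) - ?b 2 q (- s\<^sup>2) i
     = (if 2 * i = q + 1 then of_real (s ^ (2 * i) * (harm (2 * i - 1) - harm (i - 1) / 2) / real i) else 0)" for i
  proof (cases "i = 0")
    case True
    then show ?thesis by (simp add: binomial_coeff_deriv_def)
  next
    case False
    have "?b 1 q s (2 * i + 1) + ?b 1 q (- s) (2 * i + 1) = 0"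
      by (simp add: binomial_coeff_deriv_def power_minus_odd)
    moreover have "?b 1 q s (2 * i) + ?b 1 q (- s) (2 * i) - ?b 2 q (- s\<^sup>2) i = (if 2 * i = q + 1 then of_real (s ^ (2 * i) * (harm (2 * i - 1) - harm (i - 1) / 2) / real i) else 0)"
    proof -
      define P where "P = complex_of_real (s ^ (2 * i))"
      have p: "complex_of_real ((- s) ^ (2 * i)) = P" "complex_of_real ((- (- s)) ^ (2 * i)) = P"
        "complex_of_real ((- (- s\<^sup>2)) ^ i) = P" by (simp_all add: P_def power_mult)
      have R: "of_real (s ^ (2 * i) * (harm (2 * i - 1) - harm (i - 1) / 2) / real i) =
          P * (harm (2 * i - 1) - harm (i - 1) / 2) / of_nat i"
        by (simp add: P_def of_real_harm)
      have e1: "P / (2 * k) * (h + d) + P / (2 * k) * (h + d) - P / k * (h' / 2 + d) = P * (h - h' / 2) / k"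
        if "k \<noteq> 0" for k h d h' :: complex using that by (simp add: field_simps)
      have e2: "P / (2 * k) * z + P / (2 * k) * z - P / k * z = 0" if "k \<noteq> 0" for k z :: complex
        using that by (simp add: field_simps)
      show ?thesis
      \<comment> \<open>At the pole the transcendental quantity, the derivative of
        \<open>hurwitz_entire\<close> at \<open>1\<close>, enters both sides with the same factor
        and drops out; this is why the difference is rational.\<close>
      proof (cases "2 * i = q + 1")
        case True
        then have "(of_nat (2 * i) :: complex) = of_nat (q + 1)" by (rule arg_cong)
        then have "1 + of_nat q = 2 * (of_nat i :: complex)" by simp
        with True \<open>i \<noteq> 0\<close> e1 show ?thesis unfolding binomial_coeff_deriv_def p R by simp
      next
        case nopole: False
        with \<open>i \<noteq> 0\<close> e2 show ?thesis unfolding binomial_coeff_deriv_def p R by simp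
      qed
    qed
    ultimately show ?thesis by (simp add: algebra_simps)
  qed
  have "deriv (poly_zeta a 1 q s) 0 + deriv (poly_zeta a 1 q (- s)) 0 - deriv (poly_zeta a 2 q (- s\<^sup>2)) 0
    = (\<Sum>i<2*N. ?b 1 q s i) + (\<Sum>i<2*N. ?b 1 q (- s) i) - (\<Sum>i<N. ?b 2 q (- s\<^sup>2) i)"
    unfolding d1 d2 using rem by (simp add: algebra_simps)
  also have "\<dots> = (\<Sum>i<N. ?b 1 q s (2 * i) + ?b 1 q s (2 * i + 1) + (?b 1 q (- s) (2 * i) + ?b 1 q (- s) (2 * i + 1)) - ?b 2 q (- s\<^sup>2) i)"
    unfolding sum_even_odd_split by (simp add: sum.distrib sum_subtractf)
  also have "\<dots> = (\<Sum>i<N. if 2 * i = q + 1 then of_real (s ^ (2 * i) * (harm (2 * i - 1) - harm (i - 1) / 2) / real i) else 0)"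
    by (simp only: b)
  also have "\<dots> = (if odd q then of_real (s ^ (q + 1) * (2 * harm q - harm (q div 2)) / real (q + 1)) else 0)"
  proof (cases "odd q")
    case True
    then obtain m where m: "q = 2 * m + 1" by (elim oddE)
    have "(\<Sum>i<N. if 2 * i = q + 1 then complex_of_real (s ^ (2 * i) * (harm (2 * i - 1) - harm (i - 1) / 2) / real i) else 0)
       = (\<Sum>i<N. if i = Suc m then complex_of_real (s ^ (2 * i) * (harm (2 * i - 1) - harm (i - 1) / 2) / real i) else 0)"
      by (intro sum.cong) (auto simp: m)
    also have "\<dots> = of_real (s ^ (2 * Suc m) * (harm (2 * Suc m - 1) - harm (Suc m - 1) / 2) / real (Suc m))"
      by (subst sum.delta) (auto simp: N_def m)
    also have "s ^ (2 * Suc m) * (harm (2 * Suc m - 1) - harm (Suc m - 1) / 2) / real (Suc m) = s ^ (q + 1) * (2 * harm q - harm (q div 2)) / real (q + 1)"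
    proof -
      have "x * (y - z / 2) / k = x * (2 * y - z) / (2 * k)" for x y z k :: real by (simp add: field_simps)
      then show ?thesis using m by simp
    qed
    finally show ?thesis using True by simp
  next
    case False
    then have "2 * i \<noteq> q + 1" for i by presburger
    then show ?thesis using False by simp
  qed
  finally show ?thesis .
qed

subsection \<open>Barnes zeta functions\<close>

definition poly_zeta_comb :: "real \<Rightarrow> nat \<Rightarrow> real \<Rightarrow> nat \<Rightarrow> (nat \<Rightarrow> real) \<Rightarrow> complex \<Rightarrow> complex" where
  "poly_zeta_comb a c \<kappa> d p w = (\<Sum>q<d. of_real (p q) * poly_zeta a c q \<kappa> w)"

lemma
  fixes a \<kappa> :: real and c d :: nat
  assumes a: "a > 0" and \<kappa>: "\<bar>\<kappa>\<bar> < a ^ c" and c: "c > 0"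
  shows poly_zeta_comb_meromorphic: "poly_zeta_comb a c \<kappa> d p meromorphic_on UNIV"
    and poly_zeta_comb_analytic: "poly_zeta_comb a c \<kappa> d p analytic_on {w. Re (of_nat c * w) > real d}"
    and poly_zeta_comb_analytic_0: "poly_zeta_comb a c \<kappa> d p analytic_on {0}"
    and poly_zeta_comb_deriv_0: "deriv (poly_zeta_comb a c \<kappa> d p) 0 = (\<Sum>q<d. of_real (p q) * deriv (poly_zeta a c q \<kappa>) 0)"
    and poly_zeta_comb_sums: "Re (of_nat c * w) > real d \<Longrightarrow>
      (\<lambda>j. of_real (\<Sum>q<d. p q * (real j + a) ^ q) * of_real ((real j + a) ^ c + \<kappa>) powr (- w)) sums
        poly_zeta_comb a c \<kappa> d p w"
    and poly_zeta_comb_abs_summable: "Re (of_nat c * w) > real d \<Longrightarrow>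
      summable (\<lambda>j. norm (of_real (\<Sum>q<d. p q * (real j + a) ^ q) * complex_of_real ((real j + a) ^ c + \<kappa>) powr (- w)))"
proof -
  note P = poly_zeta_nicely_meromorphic[OF a \<kappa> c] poly_zeta_sums[OF a \<kappa> c] poly_zeta_abs_summable[OF a \<kappa> c]
    poly_zeta_analytic[OF a \<kappa> c] poly_zeta_analytic_0[OF a \<kappa> c]
  show "poly_zeta_comb a c \<kappa> d p meromorphic_on UNIV"
    unfolding poly_zeta_comb_def[abs_def] using P(1)
    by (intro meromorphic_intros) (auto simp: nicely_meromorphic_on_def)
  show "poly_zeta_comb a c \<kappa> d p analytic_on {w. Re (of_nat c * w) > real d}"
    unfolding poly_zeta_comb_def[abs_def]
  proof (intro analytic_intros)
    fix q assume "q \<in> {..<d}"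
    then show "poly_zeta a c q \<kappa> analytic_on {w. real d < Re (of_nat c * w)}"
      by (intro analytic_on_subset[OF P(4)]) auto
  qed
  show "poly_zeta_comb a c \<kappa> d p analytic_on {0}"
    unfolding poly_zeta_comb_def[abs_def] by (intro analytic_intros P(5))
  have "(poly_zeta_comb a c \<kappa> d p has_field_derivative (\<Sum>q<d. of_real (p q) * deriv (poly_zeta a c q \<kappa>) 0)) (at 0)"
    unfolding poly_zeta_comb_def[abs_def] by (intro DERIV_sum DERIV_cmult analytic_derivI P(5))
  then show "deriv (poly_zeta_comb a c \<kappa> d p) 0 = (\<Sum>q<d. of_real (p q) * deriv (poly_zeta a c q \<kappa>) 0)"
    by (rule DERIV_imp_deriv)
  assume w: "Re (of_nat c * w) > real d"
  have wq: "Re (of_nat c * w) > real q + 1" if "q < d" for q using w that by linarith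
  have eq: "of_real (\<Sum>q<d. p q * (real j + a) ^ q) * complex_of_real ((real j + a) ^ c + \<kappa>) powr (- w)
     = (\<Sum>q<d. of_real (p q) * (of_real ((real j + a) ^ q) * complex_of_real ((real j + a) ^ c + \<kappa>) powr (- w)))" for j
    by (simp add: sum_distrib_right mult.assoc)
  show "(\<lambda>j. of_real (\<Sum>q<d. p q * (real j + a) ^ q) * of_real ((real j + a) ^ c + \<kappa>) powr (- w)) sums
        poly_zeta_comb a c \<kappa> d p w"
    unfolding poly_zeta_comb_def eq by (intro sums_sum sums_mult P(2) wq) auto
  have "summable (\<lambda>j. \<Sum>q<d. norm (of_real (p q) * (of_real ((real j + a) ^ q) * complex_of_real ((real j + a) ^ c + \<kappa>) powr (- w))))"
    unfolding norm_mult[of "of_real (p _)"] by (intro summable_sum summable_mult P(3) wq) auto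
  then show "summable (\<lambda>j. norm (of_real (\<Sum>q<d. p q * (real j + a) ^ q) * complex_of_real ((real j + a) ^ c + \<kappa>) powr (- w)))"
    unfolding eq by (rule summable_comparison_test'[of _ 0]) (auto intro: order.trans[OF norm_sum])
qed

text \<open>Difference quotients along a real sequence are real, and the reals are closed.\<close>

lemma deriv_real_of_cnj:
  assumes "f analytic_on {of_real x}" "\<And>w. f (cnj w) = cnj (f w)"
  shows "deriv f (of_real x) \<in> \<real>"
proof -
  have "(f has_field_derivative deriv f (of_real x)) (at (of_real x))" by (rule analytic_derivI[OF assms(1)])
  then have lim: "((\<lambda>y. (f y - f (of_real x)) / (y - of_real x)) \<longlongrightarrow> deriv f (of_real x)) (at (of_real x))"
    by (simp add: has_field_derivative_iff)
  let ?y = "\<lambda>n. complex_of_real (x + 1 / real (Suc n))"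
  have "(\<lambda>n. x + 1 / real (Suc n)) \<longlonglongrightarrow> x + 0"
    by (intro tendsto_add tendsto_const LIMSEQ_Suc[OF lim_1_over_n])
  then have "?y \<longlonglongrightarrow> of_real x" by (metis tendsto_of_real add_0_right)
  then have "filterlim ?y (at (of_real x)) sequentially"
    by (simp add: filterlim_at del: of_real_add of_real_divide)
  from filterlim_compose[OF lim this]
  have l: "(\<lambda>n. (f (?y n) - f (of_real x)) / (?y n - of_real x)) \<longlonglongrightarrow> deriv f (of_real x)" .
  have r: "f (of_real t) \<in> \<real>" for t
    using assms(2)[of "of_real t"] by (simp add: Reals_cnj_iff)
  have "(f (?y n) - f (of_real x)) / (?y n - of_real x) \<in> \<real>" for n
    by (intro Reals_divide Reals_diff r Reals_of_real)
  then show ?thesis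
    by (intro Lim_in_closed_set[OF closed_complex_Reals _ _ l] always_eventually allI) auto
qed

text \<open>For \<open>\<kappa> = 0\<close> only the term \<open>i = 0\<close> of the expansion is
  nonzero, which leaves the derivative of the Hurwitz zeta function at a real point.\<close>

lemma poly_zeta_0_deriv_real:
  assumes a: "a > 0"
  shows "deriv (poly_zeta a 1 q 0) 0 \<in> \<real>"
proof -
  have k: "\<bar>0::real\<bar> < a ^ 1" using a by simp
  have N: "1 * (q + 2) > q + 1" by simp
  have "rem_term' a 1 q 0 (q + 2) j = 0" for j
  proof -
    have "(\<Sum>i=1..<q + 2. (- 0 / (real j + a) ^ 1) ^ i / real i) = 0"
      by (intro sum.neutral) (auto simp: power_0_left)
    then show ?thesis by (simp only: rem_term'_def) simp
  qed
  then have "deriv (rem_sum a 1 q 0 (q + 2)) 0 = 0"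
    using poly_zeta_rem_sums[OF a k zero_less_one N] sums_unique2[OF _ sums_zero] by (metis (no_types, lifting) ext)
  moreover have "(\<Sum>i<q + 2. binomial_coeff_deriv a 1 q 0 i) = deriv (hurwitz_zeta a) (- of_nat q)"
  proof -
    have "binomial_coeff_deriv a 1 q 0 i = (if i = 0 then deriv (hurwitz_zeta a) (- of_nat q) else 0)" for i
      by (auto simp: binomial_coeff_deriv_def)
    then show ?thesis by (simp add: sum.delta)
  qed
  ultimately have "deriv (poly_zeta a 1 q 0) 0 = deriv (hurwitz_zeta a) (- of_nat q)"
    using poly_zeta_deriv_0[OF a k zero_less_one N] by simp
  also have "\<dots> = deriv (hurwitz_zeta a) (of_real (- real q))" by simp
  also have "\<dots> \<in> \<real>"
  proof (rule deriv_real_of_cnj)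
    have ne: "of_real (- real q) - (1::complex) \<noteq> 0"
      by (simp add: complex_eq_iff)
    show "hurwitz_zeta a analytic_on {of_real (- real q)}"
      unfolding hurwitz_zeta_def[abs_def] using a ne
      by (intro analytic_intros) auto
    show "hurwitz_zeta a (cnj w) = cnj (hurwitz_zeta a w)" for w
      by (simp add: hurwitz_zeta_def hurwitz_entire_cnj[OF a])
  qed
  finally show ?thesis .
qed

text \<open>This turns a Barnes sum into Hurwitz sums with a polynomial weight in the shifted
  variable, for any shift \<open>\<xi>\<close>.\<close>

lemma binomial_as_poly:
  "\<exists>p :: real poly. degree p \<le> l \<and> (\<forall>j. real ((j + l) choose l) = poly p (real j + \<xi>))"
proof -
  let ?p = "smult (1 / fact l) (\<Prod>i=0..<l. [:real i + 1 - \<xi>, 1:])"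
  have "degree (\<Prod>i=0..<l. [:real i + 1 - \<xi>, 1:]) \<le> sum (degree \<circ> (\<lambda>i. [:real i + 1 - \<xi>, 1:])) {0..<l}"
    by (rule degree_prod_sum_le) auto
  then have "degree ?p \<le> l" by (auto simp: degree_smult_eq)
  moreover have "real ((j + l) choose l) = poly ?p (real j + \<xi>)" for j
  proof -
    have "real ((j + l) choose l) = pochhammer (real j + 1) l / fact l"
      using gbinomial_pochhammer'[of "real (j + l)" l] by (simp add: binomial_gbinomial)
    then show ?thesis by (simp add: pochhammer_prod poly_prod add_ac)
  qed
  ultimately show ?thesis by blast
qed

text \<open>Lists are grouped by their sum; stars and bars counts those of length
  \<open>l + 1\<close> with sum \<open>j\<close>. Absolute convergence justifies the
  regrouping.\<close>

lemma has_sum_lists_of_length: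
  fixes f :: "nat \<Rightarrow> complex"
  assumes "summable (\<lambda>j. norm (of_nat ((j + l) choose l) * f j))"
    and "(\<lambda>j. of_nat ((j + l) choose l) * f j) sums S"
  shows "((\<lambda>m. f (sum_list m)) has_sum S) {m :: nat list. length m = Suc l}"
proof -
  define B where "B j = {m :: nat list. length m = Suc l \<and> sum_list m = j}" for j
  have cB: "card (B j) = (j + l) choose l" for j
    unfolding B_def card_length_sum_list[of "Suc l" j] using binomial_symmetric[of j "j + l"] by simp
  have fB: "finite (B j)" for j
  proof (rule card_ge_0_finite)
    show "card (B j) > 0" unfolding cB by (simp add: zero_less_binomial_iff)
  qed
  have "((\<lambda>(j, m). f j) has_sum S) (Sigma UNIV B)"
  proof (rule has_sum_SigmaI)
    show "((\<lambda>m. case (j, m) of (j, m) \<Rightarrow> f j) has_sum of_nat ((j + l) choose l) * f j) (B j)" for j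
      using fB[of j] cB[of j] by (simp add: has_sum_finite_iff)
    show "((\<lambda>j. of_nat ((j + l) choose l) * f j) has_sum S) UNIV"
      by (rule norm_summable_imp_has_sum[OF assms])
    have "(\<lambda>x. norm ((\<lambda>(j, m). f j) x)) summable_on Sigma UNIV B"
    proof (subst Infinite_Sum.abs_summable_on_Sigma_iff, intro conjI ballI)
      show "(\<lambda>m. norm (case (j, m) of (j, m) \<Rightarrow> f j)) summable_on B j" for j
        using fB[of j] by (intro summable_on_finite)
      have e: "norm (\<Sum>\<^sub>\<infinity>m\<in>B j. norm (case (j, m) of (j, m) \<Rightarrow> f j)) = norm (of_nat ((j + l) choose l) * f j)" for j
        using fB[of j] cB[of j] by (simp add: norm_mult)
      show "(\<lambda>j. norm (\<Sum>\<^sub>\<infinity>m\<in>B j. norm (case (j, m) of (j, m) \<Rightarrow> f j))) summable_on UNIV"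
        unfolding e using assms(1) by (subst summable_on_UNIV_nonneg_real_iff) auto
    qed
    then show "(\<lambda>(j, m). f j) summable_on Sigma UNIV B" by (rule abs_summable_summable)
  qed
  also have "?this \<longleftrightarrow> ?thesis"
    by (rule has_sum_reindex_bij_witness[where i = "\<lambda>m. (sum_list m, m)" and j = snd]) (auto simp: B_def)
  finally show ?thesis .
qed

text \<open>The expansion is made around \<open>\<xi>\<close> itself, that is with
  \<open>\<kappa> = 0\<close>, which also gives reality of the derivative at \<open>0\<close>. The
  binomial weight has degree \<open>l - 1\<close>, whence convergence for
  \<open>Re w > l\<close>.\<close>

lemma barnes_zeta_continuation:
  fixes \<xi> :: real
  assumes \<xi>: "\<xi> > 0" and l: "l \<ge> 1"
  shows barnes_zeta_nicely_meromorphic: "barnes_zeta l (of_real \<xi>) nicely_meromorphic_on UNIV"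
    and barnes_zeta_sums: "Re w > real l \<Longrightarrow>
      (\<lambda>j. of_nat ((j + l - 1) choose (l - 1)) * of_real (real j + \<xi>) powr (- w)) sums barnes_zeta l (of_real \<xi>) w"
    and barnes_zeta_analytic_0: "barnes_zeta l (of_real \<xi>) analytic_on {0}"
    and barnes_zeta_deriv_real: "deriv (barnes_zeta l (of_real \<xi>)) 0 \<in> \<real>"
proof -
  obtain m where m: "l = Suc m" using l by (cases l) auto
  have k: "\<bar>0::real\<bar> < \<xi> ^ 1" using \<xi> by simp
  obtain p :: "real poly" where p: "degree p \<le> m" "\<And>j. real ((j + m) choose m) = poly p (real j + \<xi>)"
    using binomial_as_poly by blast
  let ?P = "poly_zeta_comb \<xi> 1 0 l (coeff p)"
  note P = poly_zeta_comb_meromorphic[OF \<xi> k zero_less_one] poly_zeta_comb_analytic[OF \<xi> k zero_less_one]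
    poly_zeta_comb_analytic_0[OF \<xi> k zero_less_one] poly_zeta_comb_deriv_0[OF \<xi> k zero_less_one]
    poly_zeta_comb_sums[OF \<xi> k zero_less_one] poly_zeta_comb_abs_summable[OF \<xi> k zero_less_one]
  have pe: "(\<Sum>q<l. coeff p q * (real j + \<xi>) ^ q) = real ((j + m) choose m)" for j
    unfolding p(2) poly_altdef by (rule sum.mono_neutral_right) (use p(1) m in \<open>auto simp: coeff_eq_0\<close>)
  have s: "(\<lambda>j. of_nat ((j + m) choose m) * of_real (real j + \<xi>) powr (- w)) sums remove_sings ?P w"
    and as: "summable (\<lambda>j. norm (of_nat ((j + m) choose m) * complex_of_real (real j + \<xi>) powr (- w)))"
    if "Re w > real l" for w
  proof -
    have "?P analytic_on {w}" by (rule analytic_on_subset[OF P(2)[of l]]) (use that in auto)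
    then have e: "remove_sings ?P w = ?P w" by (rule remove_sings_at_analytic)
    show "(\<lambda>j. of_nat ((j + m) choose m) * of_real (real j + \<xi>) powr (- w)) sums remove_sings ?P w"
      using P(5)[of l w "coeff p"] that unfolding e pe by simp
    show "summable (\<lambda>j. norm (of_nat ((j + m) choose m) * complex_of_real (real j + \<xi>) powr (- w)))"
      using P(6)[of l w "coeff p"] that unfolding pe by simp
  qed
  have eq: "barnes_zeta l (of_real \<xi>) = remove_sings ?P"
    unfolding barnes_zeta_def
  proof (rule series_continuation_eqI)
    show "remove_sings ?P nicely_meromorphic_on UNIV" by (rule remove_sings_nicely_meromorphic[OF P(1)])
    fix w assume w: "Re w > real l"
    show "((\<lambda>m. (of_nat (sum_list m) + complex_of_real \<xi>) powr - w) has_sum remove_sings ?P w) {m. length m = l}"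
      unfolding m using has_sum_lists_of_length[OF as[OF w] s[OF w]] by (simp add: m)
  qed
  show "barnes_zeta l (of_real \<xi>) nicely_meromorphic_on UNIV"
    unfolding eq by (rule remove_sings_nicely_meromorphic[OF P(1)])
  show "(\<lambda>j. of_nat ((j + l - 1) choose (l - 1)) * of_real (real j + \<xi>) powr (- w)) sums barnes_zeta l (of_real \<xi>) w"
    if "Re w > real l" using s[OF that] unfolding eq by (simp add: m)
  have ev: "eventually (\<lambda>w. remove_sings ?P w = ?P w) (nhds 0)"
    by (rule eventually_remove_sings_eq_nhds[OF P(3)])
  show "barnes_zeta l (of_real \<xi>) analytic_on {0}"
    unfolding eq using analytic_at_cong[OF ev refl] P(3) by blast
  have "deriv (barnes_zeta l (of_real \<xi>)) 0 = deriv ?P 0"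
    unfolding eq by (rule deriv_cong_ev[OF ev refl])
  then show "deriv (barnes_zeta l (of_real \<xi>)) 0 \<in> \<real>"
    unfolding P(4) using poly_zeta_0_deriv_real[OF \<xi>] by (simp add: sum_in_Reals Reals_mult)
qed

text \<open>The left side expands around \<open>a\<close> with \<open>\<kappa> = s\<close>, the
  Barnes functions around \<open>a + s\<close>. Both continue the same series, so the identity
  theorem carries the equality to a neighbourhood of \<open>0\<close>.\<close>

lemma poly_zeta_comb_eq_barnes:
  fixes a s :: real
  assumes a: "a > 0" and s: "\<bar>s\<bar> < a"
    and b: "\<And>j. (\<Sum>q<d. p q * (real j + a) ^ q) = (\<Sum>l=1..d. b l * real ((j + l - 1) choose (l - 1)))"
  shows "(\<Sum>q<d. of_real (p q) * deriv (poly_zeta a 1 q s) 0)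
    = (\<Sum>l=1..d. of_real (b l) * deriv (barnes_zeta l (of_real (a + s))) 0)"
proof -
  have k: "\<bar>s\<bar> < a ^ 1" and \<xi>: "a + s > 0" using s by auto
  let ?P = "poly_zeta_comb a 1 s d p"
  let ?Q = "\<lambda>w. \<Sum>l=1..d. of_real (b l) * barnes_zeta l (of_real (a + s)) w"
  note P = poly_zeta_comb_meromorphic[OF a k zero_less_one]
    poly_zeta_comb_analytic_0[OF a k zero_less_one] poly_zeta_comb_deriv_0[OF a k zero_less_one]
    poly_zeta_comb_sums[OF a k zero_less_one]
  have Qm: "?Q meromorphic_on UNIV"
    using barnes_zeta_nicely_meromorphic[OF \<xi>] by (intro meromorphic_intros) (auto simp: nicely_meromorphic_on_def)
  have Qa: "?Q analytic_on {0}" using barnes_zeta_analytic_0[OF \<xi>] by (intro analytic_intros) auto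
  have Qd: "(?Q has_field_derivative (\<Sum>l=1..d. of_real (b l) * deriv (barnes_zeta l (of_real (a + s))) 0)) (at 0)"
    using barnes_zeta_analytic_0[OF \<xi>] by (intro DERIV_sum DERIV_cmult analytic_derivI) auto
  have PQ: "?P w = ?Q w" if "Re w > real d" for w
  proof (rule sums_unique2)
    show "(\<lambda>j. of_real (\<Sum>q<d. p q * (real j + a) ^ q) * of_real ((real j + a) ^ 1 + s) powr (- w)) sums ?P w"
      using that by (intro P) simp
    have "(\<lambda>j. \<Sum>l=1..d. of_real (b l) * (of_nat ((j + l - 1) choose (l - 1)) * of_real (real j + (a + s)) powr (- w))) sums ?Q w"
      using that by (intro sums_sum sums_mult barnes_zeta_sums[OF \<xi>]) auto
    moreover have "(\<Sum>l=1..d. of_real (b l) * (of_nat ((j + l - 1) choose (l - 1)) * complex_of_real (real j + (a + s)) powr (- w)))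
       = of_real (\<Sum>q<d. p q * (real j + a) ^ q) * of_real ((real j + a) ^ 1 + s) powr (- w)" for j
      unfolding b of_real_sum sum_distrib_right by (intro sum.cong) (simp_all add: add_ac mult_ac)
    ultimately show "(\<lambda>j. of_real (\<Sum>q<d. p q * (real j + a) ^ q) * of_real ((real j + a) ^ 1 + s) powr (- w)) sums ?Q w"
      by simp
  qed
  have "of_real (real d + 1) \<in> {w. Re w > real d}" by simp
  then have ne: "{w. Re w > real d} \<noteq> {}" by blast
  have "eventually (\<lambda>w. ?P w = ?Q w) (at 0)"
    by (rule meromorphic_eventually_eq[OF P(1) Qm open_UNIV connected_UNIV open_halfspace_Re_gt ne])
      (use PQ in auto)
  moreover have "?P nicely_meromorphic_on {0}" by (rule analytic_on_imp_nicely_meromorphic_on[OF P(2)])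
  ultimately have "deriv ?P 0 = deriv ?Q 0" using nicely_meromorphic_eq_analytic(2)[OF _ Qa] by blast
  then show ?thesis unfolding P(3) DERIV_imp_deriv[OF Qd] .
qed

text \<open>The Barnes identity holds for \<open>s\<close> and \<open>- s\<close> with the same
  coefficients \<open>b\<close>, as these depend only on the weight as a function of
  \<open>j\<close>.\<close>

lemma spectral_comb_deriv:
  fixes a s :: real
  assumes a: "a > 0" and s: "\<bar>s\<bar> < a"
    and b: "\<And>j. (\<Sum>q<d. p q * (real j + a) ^ q) = (\<Sum>l=1..d. b l * real ((j + l - 1) choose (l - 1)))"
  shows "deriv (poly_zeta_comb a 2 (- s\<^sup>2) d p) 0 =
     (\<Sum>l=1..d. of_real (b l) * (deriv (barnes_zeta l (of_real (a + s))) 0 + deriv (barnes_zeta l (of_real (a - s))) 0))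
     - of_real (\<Sum>q<d. if odd q then p q * (s ^ (q + 1) * (2 * harm q - harm (q div 2)) / real (q + 1)) else 0)"
proof -
  have s2: "\<bar>- s\<^sup>2\<bar> < a ^ 2" using a s by (simp add: power2_strict_mono)
  have s': "\<bar>- s\<bar> < a" using s by simp
  let ?A = "\<lambda>q. if odd q then s ^ (q + 1) * (2 * harm q - harm (q div 2)) / real (q + 1) else 0"
  have h: "deriv (poly_zeta a 2 q (- s\<^sup>2)) 0 = deriv (poly_zeta a 1 q s) 0 + deriv (poly_zeta a 1 q (- s)) 0 - of_real (?A q)" for q
    using poly_zeta_deriv_anomaly[OF a s, of q] by (auto simp: algebra_simps split: if_splits)
  have "deriv (poly_zeta_comb a 2 (- s\<^sup>2) d p) 0 =
      (\<Sum>q<d. of_real (p q) * deriv (poly_zeta a 1 q s) 0) + (\<Sum>q<d. of_real (p q) * deriv (poly_zeta a 1 q (- s)) 0)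
      - (\<Sum>q<d. of_real (p q * ?A q))"
    unfolding poly_zeta_comb_deriv_0[OF a s2 zero_less_numeral] h
    by (simp add: algebra_simps sum.distrib sum_subtractf)
  also have "(\<Sum>q<d. complex_of_real (p q * ?A q)) = of_real (\<Sum>q<d. if odd q then p q * (s ^ (q + 1) * (2 * harm q - harm (q div 2)) / real (q + 1)) else 0)"
    unfolding of_real_sum by (intro sum.cong) auto
  finally show ?thesis
    unfolding poly_zeta_comb_eq_barnes[OF a s b] poly_zeta_comb_eq_barnes[OF a s' b]
    by (simp add: algebra_simps sum.distrib)
qed

subsection \<open>The Laplacian is symmetric\<close>

lemma open_minus_zero: "open (- {0 :: 'a :: euclidean_space})"
  by (simp add: open_Compl)

lemma Ck_on_continuous: "Ck_on S k F \<Longrightarrow> continuous_on S F"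
  by (cases k) auto

lemma Ck_on_partial: "Ck_on S (Suc k) F \<Longrightarrow> b \<in> Basis \<Longrightarrow> Ck_on S k (partial_deriv b F)"
  by auto

lemma Ck_on_has_partial:
  assumes "Ck_on S (Suc k) F" "b \<in> Basis" "x \<in> S"
  shows "((\<lambda>t. F (x + t *\<^sub>R b)) has_real_derivative partial_deriv b F x) (at 0)"
  unfolding partial_deriv_def DERIV_deriv_iff_real_differentiable using assms by simp

lemma has_line_derivative_shift:
  fixes x b :: "'a :: real_vector"
  assumes "((\<lambda>t. F ((x + t0 *\<^sub>R b) + t *\<^sub>R b)) has_real_derivative D) (at 0)"
  shows "((\<lambda>t. F (x + t *\<^sub>R b)) has_real_derivative D) (at t0)"
proof -
  have "((\<lambda>t. F (x + (t0 + t) *\<^sub>R b)) has_real_derivative D) (at 0)"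
  proof -
    have "x + (t0 + t) *\<^sub>R b = (x + t0 *\<^sub>R b) + t *\<^sub>R b" for t by (simp add: scaleR_add_left)
    then show ?thesis using assms by (simp only:)
  qed
  then show ?thesis using DERIV_at_within_shift[of "\<lambda>t. F (x + t *\<^sub>R b)" D t0 0 UNIV] by simp
qed

text \<open>Total differentiability from continuous partial derivatives: coordinates are moved one
  at a time, and the mean value inequality bounds each move by the oscillation of one partial
  derivative.\<close>

lemma partial_sum_approx:
  fixes F :: "'a::euclidean_space \<Rightarrow> real"
  assumes C: "Ck_on S (Suc 0) F" and S: "open S" "x \<in> S" and e: "e > 0"
  obtains \<delta> where "\<delta> > 0" "\<And>h. norm h < \<delta> \<Longrightarrow>
    \<bar>F (x + h) - F x - (\<Sum>b\<in>Basis. (h \<bullet> b) * partial_deriv b F x)\<bar> \<le> e * (\<Sum>b\<in>Basis. \<bar>h \<bullet> b\<bar>)"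
proof -
  have "\<exists>d>0. \<forall>y. dist y x < d \<longrightarrow> y \<in> S \<and> (\<forall>b\<in>Basis. \<bar>partial_deriv b F y - partial_deriv b F x\<bar> \<le> e)"
  proof -
    have "eventually (\<lambda>y. \<bar>partial_deriv b F y - partial_deriv b F x\<bar> \<le> e) (nhds x)" if b: "b \<in> Basis" for b
    proof -
      have "continuous_on S (partial_deriv b F)" using C b by simp
      then have "isCont (partial_deriv b F) x" using S continuous_on_eq_continuous_at by blast
      then have "(partial_deriv b F \<longlongrightarrow> partial_deriv b F x) (nhds x)"
        by (simp add: continuous_at tendsto_nhds_iff)
      from tendstoD[OF this e] show ?thesis
        by (rule eventually_mono) (simp add: dist_real_def)
    qed
    then have "eventually (\<lambda>y. \<forall>b\<in>Basis. \<bar>partial_deriv b F y - partial_deriv b F x\<bar> \<le> e) (nhds x)"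
      by (intro eventually_ball_finite) auto
    moreover have "eventually (\<lambda>y. y \<in> S) (nhds x)" using S by (intro eventually_nhds_in_open)
    ultimately have "eventually (\<lambda>y. y \<in> S \<and> (\<forall>b\<in>Basis. \<bar>partial_deriv b F y - partial_deriv b F x\<bar> \<le> e)) (nhds x)"
      by eventually_elim auto
    then show ?thesis unfolding eventually_nhds_metric by blast
  qed
  then obtain d where d: "d > 0" "\<And>y. dist y x < d \<Longrightarrow> y \<in> S"
    "\<And>y b. dist y x < d \<Longrightarrow> b \<in> Basis \<Longrightarrow> \<bar>partial_deriv b F y - partial_deriv b F x\<bar> \<le> e" by blast
  have main: "\<bar>F (x + (\<Sum>b\<in>A. (h \<bullet> b) *\<^sub>R b)) - F x - (\<Sum>b\<in>A. (h \<bullet> b) * partial_deriv b F x)\<bar> \<le> e * (\<Sum>b\<in>A. \<bar>h \<bullet> b\<bar>)"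
    if h: "norm h < d" and A: "finite A" "A \<subseteq> Basis" for h A
    using A
  proof (induction A rule: finite_induct)
    case empty
    then show ?case by simp
  next
    case (insert b A)
    define P where "P = (\<Sum>c\<in>A. (h \<bullet> c) *\<^sub>R c)"
    have b: "b \<in> Basis" using insert by simp
    have Pc: "P \<bullet> c = (if c \<in> A then h \<bullet> c else 0)" if "c \<in> Basis" for c
    proof -
      have "P \<bullet> c = (\<Sum>i\<in>A. (h \<bullet> i) * (i \<bullet> c))" by (simp add: P_def inner_sum_left)
      also have "\<dots> = (\<Sum>i\<in>A. if i = c then h \<bullet> c else 0)"
        using insert.prems that by (intro sum.cong) (auto simp: inner_Basis)
      finally show ?thesis using insert.hyps by simp
    qed
    \<comment> \<open>A partial sum of components of \<open>h\<close>, with \<open>t\<close> no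
      larger than the next one, is componentwise at most \<open>h\<close>, so the path stays in the
      ball.\<close>
    have near: "dist (x + P + t *\<^sub>R b) x < d" if "\<bar>t\<bar> \<le> \<bar>h \<bullet> b\<bar>" for t
    proof -
      have "norm (P + t *\<^sub>R b) \<le> norm h"
      proof (rule norm_le_componentwise)
        fix c :: 'a assume c: "c \<in> Basis"
        then show "\<bar>(P + t *\<^sub>R b) \<bullet> c\<bar> \<le> \<bar>h \<bullet> c\<bar>"
          using that insert.hyps b by (auto simp: inner_add_left Pc inner_Basis)
      qed
      then show ?thesis using h by (simp add: dist_norm add.assoc)
    qed
    let ?seg = "closed_segment 0 (h \<bullet> b)"
    let ?f = "\<lambda>t. F (x + P + t *\<^sub>R b) - t * partial_deriv b F x"
    have seg: "\<bar>t\<bar> \<le> \<bar>h \<bullet> b\<bar>" if "t \<in> ?seg" for t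
      using that by (auto simp: closed_segment_eq_real_ivl split: if_splits)
    have "norm (?f (h \<bullet> b) - ?f 0) \<le> e * norm (h \<bullet> b - 0)"
    proof (rule field_differentiable_bound)
      show "convex ?seg" by simp
      fix t assume t: "t \<in> ?seg"
      note nt = near[OF seg[OF t]]
      have d1: "((\<lambda>t. F (x + P + t *\<^sub>R b)) has_real_derivative partial_deriv b F (x + P + t *\<^sub>R b)) (at t)"
        by (rule has_line_derivative_shift[OF Ck_on_has_partial[OF C b d(2)[OF nt]]])
      have "((\<lambda>t. t * partial_deriv b F x) has_real_derivative partial_deriv b F x) (at t)"
        by (auto intro!: derivative_eq_intros)
      from DERIV_diff[OF d1 this]
      show "(?f has_field_derivative partial_deriv b F (x + P + t *\<^sub>R b) - partial_deriv b F x) (at t within ?seg)"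
        by (rule has_field_derivative_at_within)
      show "norm (partial_deriv b F (x + P + t *\<^sub>R b) - partial_deriv b F x) \<le> e"
        using d(3)[OF nt b] by simp
    qed auto
    then have 1: "\<bar>F (x + P + (h \<bullet> b) *\<^sub>R b) - F (x + P) - (h \<bullet> b) * partial_deriv b F x\<bar> \<le> e * \<bar>h \<bullet> b\<bar>"
      by (simp add: algebra_simps)
    have 2: "\<bar>F (x + P) - F x - (\<Sum>b\<in>A. (h \<bullet> b) * partial_deriv b F x)\<bar> \<le> e * (\<Sum>b\<in>A. \<bar>h \<bullet> b\<bar>)"
      unfolding P_def using insert by simp
    have eq: "x + (\<Sum>b\<in>insert b A. (h \<bullet> b) *\<^sub>R b) = x + P + (h \<bullet> b) *\<^sub>R b"
      using insert.hyps by (simp add: P_def add_ac)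
    show ?case unfolding eq unfolding sum.insert[OF insert.hyps] distrib_left using 1 2 by linarith
  qed
  show ?thesis
  proof (rule that[OF d(1)])
    fix h :: 'a assume "norm h < d"
    from main[OF this finite_Basis order_refl]
    show "\<bar>F (x + h) - F x - (\<Sum>b\<in>Basis. (h \<bullet> b) * partial_deriv b F x)\<bar> \<le> e * (\<Sum>b\<in>Basis. \<bar>h \<bullet> b\<bar>)"
      by (simp add: euclidean_representation)
  qed
qed

section \<open>Radial extensions and homogeneity\<close>

lemma radial_extension_scale:
  assumes "c > 0"
  shows "radial_extension u (c *\<^sub>R x) = radial_extension u x"
proof -
  have "inverse c * inverse (norm x) * c = inverse (norm x)" using assms by (simp add: field_simps)
  then have "(c *\<^sub>R x) /\<^sub>R norm (c *\<^sub>R x) = x /\<^sub>R norm x" using assms by (simp only: norm_scaleR scaleR_scaleR inverse_mult_distrib) simp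
  then show ?thesis by (simp only: radial_extension_def)
qed

lemma radial_extension_sphere: "norm x = 1 \<Longrightarrow> radial_extension u x = u x"
  by (simp add: radial_extension_def)

lemma smooth_on_sphere_Ck: "u \<in> smooth_on_sphere \<Longrightarrow> Ck_on (- {0}) k (radial_extension u)"
  by (simp add: smooth_on_sphere_def)

text \<open>The extension is constant along the ray through \<open>x\<close>. Partial derivatives by
  themselves do not see that direction, so the total approximation is applied to small multiples of
  \<open>x\<close>.\<close>

lemma euler_radial:
  fixes u :: "'a::euclidean_space \<Rightarrow> real"
  assumes C: "Ck_on (- {0}) (Suc 0) (radial_extension u)" and x: "x \<noteq> 0"
  shows "(\<Sum>b\<in>Basis. (x \<bullet> b) * partial_deriv b (radial_extension u) x) = 0"
proof -
  define U where "U = radial_extension u"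
  define E where "E = (\<Sum>b\<in>Basis. (x \<bullet> b) * partial_deriv b U x)"
  define N where "N = (\<Sum>b\<in>Basis. \<bar>x \<bullet> b\<bar>)"
  have le: "\<bar>E\<bar> \<le> e * N" if e: "e > 0" for e
  proof -
    obtain \<delta> where d: "\<delta> > 0" "\<And>h. norm h < \<delta> \<Longrightarrow>
      \<bar>U (x + h) - U x - (\<Sum>b\<in>Basis. (h \<bullet> b) * partial_deriv b U x)\<bar> \<le> e * (\<Sum>b\<in>Basis. \<bar>h \<bullet> b\<bar>)"
      using partial_sum_approx[OF C[folded U_def] open_minus_zero _ e, of x] x by auto
    define t where "t = \<delta> / (2 * norm x)"
    have t: "t > 0" "norm (t *\<^sub>R x) < \<delta>" using d x by (auto simp: t_def)
    have "U (x + t *\<^sub>R x) = U ((1 + t) *\<^sub>R x)" by (simp add: algebra_simps)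
    also have "\<dots> = U x" unfolding U_def by (rule radial_extension_scale) (use t in simp)
    finally have "\<bar>(\<Sum>b\<in>Basis. ((t *\<^sub>R x) \<bullet> b) * partial_deriv b U x)\<bar> \<le> e * (\<Sum>b\<in>Basis. \<bar>(t *\<^sub>R x) \<bullet> b\<bar>)"
      using d(2)[OF t(2)] by simp
    moreover have "(\<Sum>b\<in>Basis. ((t *\<^sub>R x) \<bullet> b) * partial_deriv b U x) = t * E"
      by (simp add: E_def sum_distrib_left mult.assoc)
    moreover have "(\<Sum>b\<in>Basis. \<bar>(t *\<^sub>R x) \<bullet> b\<bar>) = t * N"
      using t by (simp add: N_def sum_distrib_left abs_mult)
    ultimately show ?thesis using t by (simp add: abs_mult)
  qed
  have "N \<ge> 0" by (simp add: N_def sum_nonneg)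
  have le': "\<bar>E\<bar> \<le> e" if "e > 0" for e
  proof -
    have "\<bar>E\<bar> \<le> (e / (N + 1)) * N" using \<open>N \<ge> 0\<close> that by (intro le) simp
    also have "\<dots> \<le> e" using \<open>N \<ge> 0\<close> that by (simp add: field_simps)
    finally show ?thesis .
  qed
  have "\<bar>E\<bar> \<le> 0"
  proof (rule field_le_epsilon)
    fix e :: real assume "0 < e"
    from le'[OF this] show "\<bar>E\<bar> \<le> 0 + e" by simp
  qed
  then show ?thesis by (simp add: E_def U_def)
qed

text \<open>A partial derivative lowers the degree of homogeneity by one: if \<open>a\<close> is the
  \<open>k\<close>-th power of \<open>c\<close>, then \<open>a / c\<close> is the power with
  exponent \<open>k - 1\<close>.\<close>

lemma partial_deriv_homogeneous:
  fixes F :: "'a::euclidean_space \<Rightarrow> real"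
  assumes F: "\<And>y. y \<noteq> 0 \<Longrightarrow> F (c *\<^sub>R y) = a * F y" and c: "c > 0" and x: "x \<noteq> 0"
    and D: "((\<lambda>t. F (x + t *\<^sub>R b)) has_real_derivative partial_deriv b F x) (at 0)"
  shows "partial_deriv b F (c *\<^sub>R x) = (a / c) * partial_deriv b F x"
proof -
  have "((\<lambda>t. x + (t / c) *\<^sub>R b) \<longlongrightarrow> x + (0 / c) *\<^sub>R b) (nhds 0)"
    using c by (intro tendsto_intros filterlim_ident) auto
  then have "eventually (\<lambda>t. x + (t / c) *\<^sub>R b \<in> - {0}) (nhds 0)"
    by (rule topological_tendstoD[OF _ open_minus_zero]) (use x in simp)
  then have ev: "eventually (\<lambda>t. F (c *\<^sub>R x + t *\<^sub>R b) = a * F (x + (t / c) *\<^sub>R b)) (nhds 0)"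
  proof eventually_elim
    case (elim t)
    have "c *\<^sub>R x + t *\<^sub>R b = c *\<^sub>R (x + (t / c) *\<^sub>R b)" using c by (simp add: algebra_simps)
    then show ?case using F elim by simp
  qed
  have "((\<lambda>t. F (x + (t / c) *\<^sub>R b)) has_real_derivative partial_deriv b F x * (1 / c)) (at 0)"
    by (rule DERIV_chain2[where f = "\<lambda>t. F (x + t *\<^sub>R b)"]) (use D c in \<open>auto intro!: derivative_eq_intros\<close>)
  then have "((\<lambda>t. a * F (x + (t / c) *\<^sub>R b)) has_real_derivative a * (partial_deriv b F x * (1 / c))) (at 0)"
    by (rule DERIV_cmult)
  then have "((\<lambda>t. F (c *\<^sub>R x + t *\<^sub>R b)) has_real_derivative a * (partial_deriv b F x * (1 / c))) (at 0)"
    using DERIV_cong_ev[OF refl ev refl] by blast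
  then show ?thesis unfolding partial_deriv_def[of b F "c *\<^sub>R x"] by (simp add: DERIV_imp_deriv)
qed

text \<open>Second partial derivatives of a function of degree \<open>0\<close> have degree
  \<open>- 2\<close>, and the factor \<open>x \<bullet> x\<close> restores degree \<open>0\<close>.
  Thus the operator on the sphere becomes a differential expression on the whole punctured
  space.\<close>

lemma radial_extension_laplacian:
  fixes u :: "'a::euclidean_space \<Rightarrow> real"
  assumes u: "u \<in> smooth_on_sphere" and x: "x \<noteq> 0"
  shows "radial_extension (sphere_laplacian u) x =
    - (x \<bullet> x) * (\<Sum>b\<in>Basis. partial_deriv b (partial_deriv b (radial_extension u)) x)"
proof -
  define U where "U = radial_extension u"
  note C = smooth_on_sphere_Ck[OF u, folded U_def]
  define r y where "r = norm x" and "y = x /\<^sub>R norm x"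
  have r: "r > 0" and y: "norm y = 1" "y \<noteq> 0" and xr: "x = r *\<^sub>R y" using x by (auto simp: r_def y_def)
  have 1: "partial_deriv b U (r *\<^sub>R z) = (1 / r) * partial_deriv b U z" if "b \<in> Basis" "z \<noteq> 0" for b z
    by (rule partial_deriv_homogeneous[OF _ r that(2) Ck_on_has_partial[OF C that(1)]])
      (use r that in \<open>auto simp: U_def radial_extension_scale\<close>)
  have 2: "partial_deriv b (partial_deriv b U) x = (1 / r) / r * partial_deriv b (partial_deriv b U) y" if "b \<in> Basis" for b
    unfolding xr
    by (rule partial_deriv_homogeneous[OF 1[OF that] r y(2) Ck_on_has_partial[OF Ck_on_partial[OF C that] that]])
      (use y in auto)
  have "radial_extension (sphere_laplacian u) x = - (\<Sum>b\<in>Basis. partial_deriv b (partial_deriv b U) y)"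
    using y by (simp add: radial_extension_def sphere_laplacian_def U_def y_def)
  moreover have "partial_deriv b (partial_deriv b U) y = (x \<bullet> x) * partial_deriv b (partial_deriv b U) x" if "b \<in> Basis" for b
    using 2[OF that] r by (simp add: dot_square_norm r_def[symmetric] power2_eq_square)
  ultimately show ?thesis by (simp add: U_def sum_distrib_left)
qed

section \<open>Integration by parts in the ambient space\<close>

lemma integrable_compact_support:
  fixes f :: "'a::euclidean_space \<Rightarrow> real"
  assumes "continuous_on UNIV f" "\<And>x. norm x > R \<Longrightarrow> f x = 0"
  shows "integrable lborel f"
proof -
  have "integrable lborel (\<lambda>x. indicator (cball 0 R) x *\<^sub>R f x)"
    by (rule borel_integrable_compact) (use continuous_on_subset[OF assms(1)] in auto)
  also have "(\<lambda>x. indicator (cball 0 R) x *\<^sub>R f x) = f"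
    using assms(2) by (auto simp: fun_eq_iff indicator_def not_le)
  finally show ?thesis .
qed

text \<open>By translation invariance of Lebesgue measure every difference quotient has integral
  zero; dominated convergence passes to the derivative. This takes the place of the divergence
  theorem.\<close>

lemma integral_line_derivative_eq_0:
  fixes W W' :: "'a::euclidean_space \<Rightarrow> real"
  assumes D: "\<And>x. ((\<lambda>t. W (x + t *\<^sub>R b)) has_real_derivative W' x) (at 0)"
    and cW: "continuous_on UNIV W" and cW': "continuous_on UNIV W'"
    and sW: "\<And>x. norm x > R \<Longrightarrow> W x = 0" and sW': "\<And>x. norm x > R \<Longrightarrow> W' x = 0"
  shows "(\<integral>x. W' x \<partial>lborel) = 0"
proof -
  define s where "s n = 1 / real (Suc n)" for n
  have s: "s n > 0" "s n \<le> 1" for n by (auto simp: s_def)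
  have sl: "s \<longlonglongrightarrow> 0" unfolding s_def by (rule LIMSEQ_Suc[OF lim_1_over_n])
  define Q where "Q n x = (W (x + s n *\<^sub>R b) - W x) / s n" for n x
  have iW: "integrable lborel W" by (rule integrable_compact_support[OF cW sW])
  have tr: "integrable lborel (\<lambda>x. W (x + c))" "(\<integral>x. W (x + c) \<partial>lborel) = (\<integral>x. W x \<partial>lborel)" for c
  proof -
    have mW: "W \<in> borel_measurable borel" using cW by (rule borel_measurable_continuous_onI)
    have "integrable (distr lborel borel ((+) c)) W" unfolding lborel_distr_plus by (rule iW)
    then show "integrable lborel (\<lambda>x. W (x + c))"
      using mW by (subst (asm) integrable_distr_eq) (auto simp: add.commute)
    have "(\<integral>x. W x \<partial>lborel) = (\<integral>x. W x \<partial>(distr lborel borel ((+) c)))" unfolding lborel_distr_plus ..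
    also have "\<dots> = (\<integral>x. W (x + c) \<partial>lborel)"
      using mW by (subst integral_distr) (auto simp: add.commute)
    finally show "(\<integral>x. W (x + c) \<partial>lborel) = (\<integral>x. W x \<partial>lborel)" ..
  qed
  have Q0: "(\<integral>x. Q n x \<partial>lborel) = 0" for n
    unfolding Q_def using tr[of "s n *\<^sub>R b"] iW by simp
  obtain M where M: "\<And>x. \<bar>W' x\<bar> \<le> M" "M \<ge> 0"
  proof -
    have "compact (W' ` cball 0 R)" by (rule compact_continuous_image) (use cW' continuous_on_subset in auto)
    then obtain M where "\<forall>y\<in>W' ` cball 0 R. norm y \<le> M" using compact_imp_bounded bounded_iff by metis
    then have "\<bar>W' x\<bar> \<le> max M 0" for x
      using sW'[of x] by (cases "norm x \<le> R") (auto intro: max.coboundedI1)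
    then show thesis using that[of "max M 0"] by auto
  qed
  \<comment> \<open>The mean value inequality turns the bound on \<open>W'\<close> into a common
    bound on all difference quotients.\<close>
  have lip: "\<bar>Q n x\<bar> \<le> M" for n x
  proof -
    have "norm (W (x + s n *\<^sub>R b) - W (x + 0 *\<^sub>R b)) \<le> M * norm (s n - 0)"
    proof (rule field_differentiable_bound[where S = UNIV])
      show "((\<lambda>t. W (x + t *\<^sub>R b)) has_field_derivative W' (x + t *\<^sub>R b)) (at t within UNIV)" for t
        using has_line_derivative_shift[OF D] by simp
      show "norm (W' (x + t *\<^sub>R b)) \<le> M" for t using M by simp
    qed auto
    then show ?thesis using s[of n] by (simp add: Q_def abs_divide divide_le_eq)
  qed
  \<comment> \<open>Steps \<open>s n \<le> 1\<close> enlarge the support by at most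
    \<open>norm b\<close>.\<close>
  have Qs: "Q n x = 0" if "norm x > R + norm b" for n x
  proof -
    have "norm (s n *\<^sub>R b) \<le> norm b" using s[of n] by (simp add: mult_left_le_one_le)
    then have "norm (x + s n *\<^sub>R b) > R" using that norm_diff_ineq[of x "s n *\<^sub>R b"] by linarith
    moreover have "norm x > R" using that norm_ge_zero[of b] by linarith
    ultimately show ?thesis by (simp add: Q_def sW)
  qed
  have "(\<lambda>n. \<integral>x. Q n x \<partial>lborel) \<longlonglongrightarrow> (\<integral>x. W' x \<partial>lborel)"
  proof (rule integral_dominated_convergence)
    show "integrable lborel (\<lambda>x. indicator (cball 0 (R + norm b)) x *\<^sub>R M)"
      by (rule borel_integrable_compact) auto
    show "AE x in lborel. norm (Q n x) \<le> indicator (cball 0 (R + norm b)) x *\<^sub>R M" for n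
      using lip[of n] Qs[of _ n] by (auto simp: indicator_def not_le)
    show "AE x in lborel. (\<lambda>n. Q n x) \<longlonglongrightarrow> W' x"
    proof (rule AE_I2)
      fix x
      have "((\<lambda>t. (W (x + t *\<^sub>R b) - W x) / t) \<longlongrightarrow> W' x) (at 0)"
        using D[of x] by (simp add: has_field_derivative_iff)
      moreover have "filterlim s (at 0) sequentially"
        using sl s by (auto simp: filterlim_at less_imp_neq[symmetric])
      ultimately show "(\<lambda>n. Q n x) \<longlonglongrightarrow> W' x" unfolding Q_def by (rule filterlim_compose)
    qed
    show "W' \<in> borel_measurable lborel" using borel_measurable_continuous_onI[OF cW'] by simp
    show "Q n \<in> borel_measurable lborel" for n
      unfolding Q_def using tr(1)[of "s n *\<^sub>R b"] iW by (intro borel_measurable_integrable) simp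
  qed
  then show ?thesis unfolding Q0 using LIMSEQ_unique tendsto_const by blast
qed

text \<open>The argument will be a squared norm, so the support is the shell with radii
  \<open>1/2\<close> and \<open>2\<close>, which contains the unit sphere and avoids
  \<open>0\<close>. Squaring the positive part makes the function continuously differentiable,
  enough for one integration by parts.\<close>

definition cutoff :: "real \<Rightarrow> real" where
  "cutoff t = (max 0 ((t - 1/4) * (4 - t)))\<^sup>2"

definition cutoff' :: "real \<Rightarrow> real" where
  "cutoff' t = 2 * max 0 ((t - 1/4) * (4 - t)) * ((4 - t) - (t - 1/4))"

lemma DERIV_max_0_squared: "((\<lambda>y::real. (max 0 y)\<^sup>2) has_real_derivative 2 * max 0 y) (at y)"
proof (cases y "0 :: real" rule: linorder_cases)
  case less
  have "((\<lambda>y::real. 0) has_real_derivative 2 * max 0 y) (at y)" using less by simp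
  then show ?thesis
    by (rule has_field_derivative_transform_within_open[of _ _ _ "{..<0}"]) (use less in auto)
next
  case greater
  have "((\<lambda>y::real. y\<^sup>2) has_real_derivative 2 * max 0 y) (at y)"
    using greater by (auto intro!: derivative_eq_intros)
  then show ?thesis
    by (rule has_field_derivative_transform_within_open[of _ _ _ "{0<..}"]) (use greater in auto)
next
  case equal
  have "((\<lambda>h::real. (max 0 h)\<^sup>2 / h) \<longlongrightarrow> 0) (at 0)"
  proof (rule Lim_null_comparison)
    show "\<forall>\<^sub>F h in at (0::real). norm ((max 0 h)\<^sup>2 / h) \<le> \<bar>h\<bar>"
      by (rule always_eventually) (auto simp: max_def power2_eq_square)
    show "((\<lambda>h::real. \<bar>h\<bar>) \<longlongrightarrow> 0) (at 0)" by (rule tendsto_eq_intros refl | simp)+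
  qed
  then show ?thesis using equal by (simp add: has_field_derivative_iff)
qed

lemma DERIV_cutoff: "(cutoff has_real_derivative cutoff' t) (at t)"
  unfolding cutoff_def[abs_def] cutoff'_def
  by (rule DERIV_chain2[OF DERIV_max_0_squared]) (auto intro!: derivative_eq_intros)

lemma cutoff_eq_0:
  assumes "t \<le> 1/4 \<or> t \<ge> 4"
  shows "cutoff t = 0" "cutoff' t = 0"
proof -
  have "(t - 1/4) * (4 - t) \<le> 0" using assms by (auto simp: mult_le_0_iff)
  then show "cutoff t = 0" "cutoff' t = 0" by (auto simp: cutoff_def cutoff'_def max_def)
qed

lemma continuous_cutoff: "continuous_on UNIV cutoff" "continuous_on UNIV cutoff'"
  unfolding cutoff_def[abs_def] cutoff'_def[abs_def] by (intro continuous_intros)+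

lemma inner_self_le_quarter: "norm (x::'a::euclidean_space) < 1/2 \<Longrightarrow> x \<bullet> x \<le> 1/4"
  unfolding dot_square_norm using power_mono[of "norm x" "1/2" 2] by (simp add: power2_eq_square)

lemma inner_self_ge_4: "norm (x::'a::euclidean_space) > 2 \<Longrightarrow> x \<bullet> x \<ge> 4"
  unfolding dot_square_norm using power_mono[of 2 "norm x" 2] by simp

text \<open>Radial extensions have in general no continuous value at \<open>0\<close>; a cutoff that
  vanishes in a ball around \<open>0\<close> makes the product continuous everywhere.\<close>

lemma cutoff_mult:
  fixes F :: "'a::euclidean_space \<Rightarrow> real"
  assumes h: "continuous_on UNIV h" "\<And>t. t \<le> 1/4 \<or> t \<ge> 4 \<Longrightarrow> h t = (0::real)" and F: "continuous_on (- {0}) F"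
  shows "continuous_on UNIV (\<lambda>x. h (x \<bullet> x) * F x)" "norm x > 2 \<Longrightarrow> h (x \<bullet> x) * F x = 0"
    and "integrable lborel (\<lambda>x. h (x \<bullet> x) * F x)"
proof -
  let ?f = "\<lambda>x. h (x \<bullet> x) * F x"
  have "continuous_on (ball 0 (1/2)) (\<lambda>x::'a. 0::real)" by (rule continuous_on_const)
  then have 1: "continuous_on (ball 0 (1/2)) ?f"
  proof (rule continuous_on_eq)
    fix x :: 'a assume "x \<in> ball 0 (1/2)"
    then have "x \<bullet> x \<le> 1/4" by (intro inner_self_le_quarter) simp
    then show "0 = h (x \<bullet> x) * F x" by (simp add: h(2))
  qed
  have "continuous_on (- {0}) (\<lambda>x::'a. h (x \<bullet> x))"
    by (rule continuous_on_compose2[OF h(1)]) (auto intro!: continuous_intros)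
  then have 2: "continuous_on (- {0}) ?f" using F by (intro continuous_on_mult)
  have "ball 0 (1/2) \<union> - {0 :: 'a} = UNIV" by auto
  with continuous_on_open_Un[OF open_ball open_minus_zero 1 2]
  show c: "continuous_on UNIV ?f" by simp
  show z: "h (x \<bullet> x) * F x = 0" if "norm x > 2" for x using inner_self_ge_4[OF that] by (simp add: h(2))
  show "integrable lborel ?f" by (rule integrable_compact_support[OF c z])
qed

text \<open>
  Radial extensions are constant along rays, so up to a positive factor this integral over a shell in
  the ambient space is the inner product of \<open>L\<^sup>2\<close> on the sphere.
\<close>
definition sphere_ip :: "('a::euclidean_space \<Rightarrow> real) \<Rightarrow> ('a \<Rightarrow> real) \<Rightarrow> real" where
  "sphere_ip u v = (\<integral>x. cutoff (x \<bullet> x) * (radial_extension u x * radial_extension v x / (x \<bullet> x)) \<partial>lborel)"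

abbreviation continuous_on_sphere :: "('a::euclidean_space \<Rightarrow> real) \<Rightarrow> bool" where
  "continuous_on_sphere u \<equiv> continuous_on (- {0}) (radial_extension u)"

lemma continuous_ip_integrand:
  fixes u v :: "'a::euclidean_space \<Rightarrow> real"
  assumes "continuous_on_sphere u" "continuous_on_sphere v"
  shows "continuous_on (- {0}) (\<lambda>x. radial_extension u x * radial_extension v x / (x \<bullet> x))"
  using assms by (intro continuous_intros) auto

lemmas ip_integrand = cutoff_mult[OF continuous_cutoff(1) cutoff_eq_0(1) continuous_ip_integrand]

lemma sphere_ip_commute: "sphere_ip u v = sphere_ip v u"
  by (simp add: sphere_ip_def mult_ac)

lemma sphere_ip_add_left:
  assumes "continuous_on_sphere u" "continuous_on_sphere v" "continuous_on_sphere w"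
  shows "sphere_ip (u + v) w = sphere_ip u w + sphere_ip v w"
proof -
  have e: "cutoff (x \<bullet> x) * (radial_extension (u + v) x * radial_extension w x / (x \<bullet> x)) =
     cutoff (x \<bullet> x) * (radial_extension u x * radial_extension w x / (x \<bullet> x)) +
     cutoff (x \<bullet> x) * (radial_extension v x * radial_extension w x / (x \<bullet> x))" for x
    by (simp add: radial_extension_def algebra_simps add_divide_distrib)
  show ?thesis unfolding sphere_ip_def e
    by (intro Bochner_Integration.integral_add ip_integrand(3) assms) auto
qed

lemma sphere_ip_scale_left: "sphere_ip (\<lambda>x. c * u x) w = c * sphere_ip u w"
proof -
  have e: "cutoff (x \<bullet> x) * (radial_extension (\<lambda>x. c * u x) x * radial_extension w x / (x \<bullet> x)) =
     c * (cutoff (x \<bullet> x) * (radial_extension u x * radial_extension w x / (x \<bullet> x)))" for x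
    by (simp add: radial_extension_def)
  show ?thesis unfolding sphere_ip_def e by (rule Bochner_Integration.integral_mult_right_zero)
qed

text \<open>The integrand is continuous and nonnegative, so it vanishes off a null set; the open set
  where it does not vanish would be a null set containing \<open>x\<close>.\<close>

lemma sphere_ip_definite:
  fixes u :: "'a::euclidean_space \<Rightarrow> real"
  assumes u: "continuous_on_sphere u" and z: "sphere_ip u u = 0" and x: "norm x = 1"
  shows "u x = 0"
proof (rule ccontr)
  assume nz: "u x \<noteq> 0"
  let ?f = "\<lambda>x. cutoff (x \<bullet> x) * (radial_extension u x * radial_extension u x / (x \<bullet> x))"
  have c: "continuous_on UNIV ?f" by (rule ip_integrand(1)[OF _ u u])
  have "?f x > 0" using nz x not_real_square_gt_zero[of "u x"]
    by (simp add: radial_extension_sphere dot_square_norm cutoff_def zero_less_mult_iff)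
  have "integrable lborel ?f" by (rule ip_integrand(3)[OF _ u u])
  moreover have "AE y in lborel. ?f y \<ge> 0" by (rule AE_I2) (simp add: cutoff_def)
  ultimately have "AE y in lborel. ?f y = 0"
    using z integral_nonneg_eq_0_iff_AE unfolding sphere_ip_def by blast
  moreover have op: "open {y. ?f y \<noteq> 0}" by (intro open_Collect_neq c continuous_on_const)
  ultimately have "{y. ?f y \<noteq> 0} \<in> null_sets lborel"
    using AE_iff_null_sets[of "{y. ?f y \<noteq> 0}" lborel] borel_open[OF op] by simp
  then have "negligible {y. ?f y \<noteq> 0}"
    unfolding negligible_iff_null_sets by (rule null_sets_completionI)
  moreover have "x \<in> {y. ?f y \<noteq> 0}" unfolding mem_Collect_eq using \<open>?f x > 0\<close> by linarith
  ultimately show False using open_not_negligible[OF op] by blast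
qed

text \<open>The integrand is the derivative along \<open>b\<close> of the cutoff times
  \<open>K\<close>; the products of first derivatives of \<open>U\<close> and \<open>V\<close>
  cancel in it.\<close>

lemma partial_green_term:
  fixes U V :: "'a::euclidean_space \<Rightarrow> real"
  assumes U: "Ck_on (- {0}) (Suc (Suc 0)) U" and V: "Ck_on (- {0}) (Suc (Suc 0)) V" and b: "b \<in> Basis"
  defines "P \<equiv> partial_deriv b"
  defines "K \<equiv> \<lambda>x. U x * P V x - V x * P U x"
  shows "(\<integral>x. (cutoff' (x \<bullet> x) * (2 * (x \<bullet> b) * K x) + cutoff (x \<bullet> x) * (U x * P (P V) x - V x * P (P U) x)) \<partial>lborel) = 0"
proof (rule integral_line_derivative_eq_0)
  let ?W = "\<lambda>x. cutoff (x \<bullet> x) * K x"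
  let ?W' = "\<lambda>x. cutoff' (x \<bullet> x) * (2 * (x \<bullet> b) * K x) + cutoff (x \<bullet> x) * (U x * P (P V) x - V x * P (P U) x)"
  have cont: "continuous_on (- {0}) U" "continuous_on (- {0}) V" "continuous_on (- {0}) (P U)" "continuous_on (- {0}) (P V)"
     "continuous_on (- {0}) (P (P U))" "continuous_on (- {0}) (P (P V))"
    using U V b by (auto simp: P_def)
  have cK: "continuous_on (- {0}) K" unfolding K_def by (intro continuous_intros cont)
  have c1: "continuous_on (- {0}) (\<lambda>x. 2 * (x \<bullet> b) * K x)" by (intro continuous_intros cK)
  have c2: "continuous_on (- {0}) (\<lambda>x. U x * P (P V) x - V x * P (P U) x)" by (intro continuous_intros cont)
  note W = cutoff_mult[OF continuous_cutoff(1) cutoff_eq_0(1) cK]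
  note W1 = cutoff_mult[OF continuous_cutoff(2) cutoff_eq_0(2) c1]
  note W2 = cutoff_mult[OF continuous_cutoff(1) cutoff_eq_0(1) c2]
  show "continuous_on UNIV ?W" "\<And>x. norm x > 2 \<Longrightarrow> ?W x = 0" using W(1,2) by auto
  show "continuous_on UNIV ?W'" by (intro continuous_on_add W1 W2)
  show "\<And>x. norm x > 2 \<Longrightarrow> ?W' x = 0" using W1(2) W2(2) by fastforce
  show "((\<lambda>t. ?W (x + t *\<^sub>R b)) has_real_derivative ?W' x) (at 0)" for x
  \<comment> \<open>At \<open>0\<close> the derivative comes from the vanishing of the cutoff
    nearby, as \<open>U\<close> and \<open>V\<close> may be singular there.\<close>
  proof (cases "x = 0")
    case True
    have "((\<lambda>t. 0) has_real_derivative 0) (at (0::real))" by simp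
    then have "((\<lambda>t. ?W (x + t *\<^sub>R b)) has_real_derivative 0) (at 0)"
    proof (rule has_field_derivative_transform_within_open[of _ _ _ "ball 0 (1/2)"])
      fix t :: real assume "t \<in> ball 0 (1/2)"
      then have "norm (x + t *\<^sub>R b) < 1/2" using b True by (simp add: dist_norm)
      then show "0 = ?W (x + t *\<^sub>R b)" by (simp only: cutoff_eq_0 inner_self_le_quarter simp_thms mult_zero_left)
    qed auto
    then show ?thesis using True by (simp add: cutoff_eq_0)
  next
    case False
    then have x: "x \<in> - {0}" by simp
    note dU = Ck_on_has_partial[OF U b x] and dV = Ck_on_has_partial[OF V b x]
    note dPU = Ck_on_has_partial[OF Ck_on_partial[OF U b] b x]
    note dPV = Ck_on_has_partial[OF Ck_on_partial[OF V b] b x]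
    have "((\<lambda>t. (x + t *\<^sub>R b) \<bullet> (x + t *\<^sub>R b)) has_real_derivative 2 * (x \<bullet> b)) (at 0)"
      by (auto simp: inner_add_left inner_add_right inner_commute intro!: derivative_eq_intros)
    from DERIV_chain2[OF DERIV_cutoff this]
    have dc: "((\<lambda>t. cutoff ((x + t *\<^sub>R b) \<bullet> (x + t *\<^sub>R b))) has_real_derivative cutoff' (x \<bullet> x) * (2 * (x \<bullet> b))) (at 0)"
      by simp
    show ?thesis unfolding K_def P_def
      by (rule derivative_eq_intros refl dc dU dV dPU dPV)+ (simp add: algebra_simps)
  qed
qed

text \<open>Green's identity summed over the basis. The cutoff depends only on the norm, so its
  derivative multiplies the Euler sums of \<open>U\<close> and \<open>V\<close>, which vanish. The
  weight \<open>1 / (x \<bullet> x)\<close> in \<open>sphere_ip\<close> cancels the factor from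
  \<open>radial_extension_laplacian\<close>.\<close>

lemma sphere_laplacian_symmetric:
  fixes u v :: "'a::euclidean_space \<Rightarrow> real"
  assumes u: "u \<in> smooth_on_sphere" and v: "v \<in> smooth_on_sphere"
  shows "sphere_ip (sphere_laplacian u) v = sphere_ip u (sphere_laplacian v)"
proof -
  define U V where "U = radial_extension u" and "V = radial_extension v"
  have CU: "Ck_on (- {0}) k U" and CV: "Ck_on (- {0}) k V" for k
    using smooth_on_sphere_Ck u v by (auto simp: U_def V_def)
  let ?D = "\<lambda>b F x. partial_deriv b (partial_deriv b F) x"
  let ?L = "\<lambda>F x. \<Sum>b\<in>Basis. ?D b F x"
  let ?K = "\<lambda>b x. U x * partial_deriv b V x - V x * partial_deriv b U x"
  have c: "continuous_on (- {0}) U" "continuous_on (- {0}) V" using Ck_on_continuous CU CV by blast+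
  have cD: "continuous_on (- {0}) (?D b U)" "continuous_on (- {0}) (?D b V)" 
      "continuous_on (- {0}) (partial_deriv b U)" "continuous_on (- {0}) (partial_deriv b V)" if "b \<in> Basis" for b
    using CU[of "Suc (Suc 0)"] CV[of "Suc (Suc 0)"] that by auto
  have cL: "continuous_on (- {0}) (?L U)" "continuous_on (- {0}) (?L V)"
    by (intro continuous_on_sum cD; assumption)+
  have i1: "integrable lborel (\<lambda>x. cutoff' (x \<bullet> x) * (2 * (x \<bullet> b) * ?K b x))" if "b \<in> Basis" for b
    by (rule cutoff_mult(3)[OF continuous_cutoff(2) cutoff_eq_0(2)]) (use that c cD in \<open>auto intro!: continuous_intros\<close>)
  have i2: "integrable lborel (\<lambda>x. cutoff (x \<bullet> x) * (U x * ?D b V x - V x * ?D b U x))" if "b \<in> Basis" for b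
    by (rule cutoff_mult(3)[OF continuous_cutoff(1) cutoff_eq_0(1)]) (use that c cD in \<open>auto intro!: continuous_intros\<close>)
  have "0 = (\<Sum>b\<in>Basis. \<integral>x. (cutoff' (x \<bullet> x) * (2 * (x \<bullet> b) * ?K b x) + cutoff (x \<bullet> x) * (U x * ?D b V x - V x * ?D b U x)) \<partial>lborel)"
    using partial_green_term[OF CU CV] by simp
  also have "\<dots> = (\<integral>x. (\<Sum>b\<in>Basis. cutoff' (x \<bullet> x) * (2 * (x \<bullet> b) * ?K b x) + cutoff (x \<bullet> x) * (U x * ?D b V x - V x * ?D b U x)) \<partial>lborel)"
    by (rule Bochner_Integration.integral_sum[symmetric]) (intro Bochner_Integration.integrable_add i1 i2)
  also have "\<dots> = (\<integral>x. cutoff (x \<bullet> x) * (U x * ?L V x - V x * ?L U x) \<partial>lborel)"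
  proof (rule Bochner_Integration.integral_cong[OF refl])
    fix x
    show "(\<Sum>b\<in>Basis. cutoff' (x \<bullet> x) * (2 * (x \<bullet> b) * ?K b x) + cutoff (x \<bullet> x) * (U x * ?D b V x - V x * ?D b U x))
      = cutoff (x \<bullet> x) * (U x * ?L V x - V x * ?L U x)"
    proof (cases "x = 0")
      case True
      then show ?thesis by (simp add: cutoff_eq_0)
    next
      case False
      have "(\<Sum>b\<in>Basis. cutoff' (x \<bullet> x) * (2 * (x \<bullet> b) * ?K b x)) =
        2 * cutoff' (x \<bullet> x) * (U x * (\<Sum>b\<in>Basis. (x \<bullet> b) * partial_deriv b V x) - V x * (\<Sum>b\<in>Basis. (x \<bullet> b) * partial_deriv b U x))"
        by (simp add: sum_distrib_left sum_subtractf[symmetric] algebra_simps)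
      also have "\<dots> = 0"
        using euler_radial[OF CU[unfolded U_def] False] euler_radial[OF CV[unfolded V_def] False] by (simp add: U_def V_def)
      finally show ?thesis
        by (simp add: sum.distrib sum_distrib_left sum_subtractf algebra_simps)
    qed
  qed
  also have "\<dots> = (\<integral>x. cutoff (x \<bullet> x) * (U x * ?L V x) \<partial>lborel) - (\<integral>x. cutoff (x \<bullet> x) * (V x * ?L U x) \<partial>lborel)"
    unfolding right_diff_distrib
    by (rule Bochner_Integration.integral_diff)
      (rule cutoff_mult(3)[OF continuous_cutoff(1) cutoff_eq_0(1)]; use c cL in \<open>auto intro!: continuous_on_mult\<close>)+
  also have "(\<integral>x. cutoff (x \<bullet> x) * (U x * ?L V x) \<partial>lborel) = - sphere_ip u (sphere_laplacian v)"
    unfolding sphere_ip_def Bochner_Integration.integral_minus[symmetric]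
  proof (rule Bochner_Integration.integral_cong[OF refl])
    fix x show "cutoff (x \<bullet> x) * (U x * ?L V x) = - (cutoff (x \<bullet> x) * (radial_extension u x * radial_extension (sphere_laplacian v) x / (x \<bullet> x)))"
      using radial_extension_laplacian[OF v, of x] by (cases "x = 0") (auto simp: cutoff_eq_0 U_def V_def)
  qed
  also have "(\<integral>x. cutoff (x \<bullet> x) * (V x * ?L U x) \<partial>lborel) = - sphere_ip (sphere_laplacian u) v"
    unfolding sphere_ip_def Bochner_Integration.integral_minus[symmetric]
  proof (rule Bochner_Integration.integral_cong[OF refl])
    fix x show "cutoff (x \<bullet> x) * (V x * ?L U x) = - (cutoff (x \<bullet> x) * (radial_extension (sphere_laplacian u) x * radial_extension v x / (x \<bullet> x)))"
      using radial_extension_laplacian[OF u, of x] by (cases "x = 0") (auto simp: cutoff_eq_0 U_def V_def)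
  qed
  finally show ?thesis by simp
qed

subsection \<open>Homogeneous polynomials on the sphere\<close>

lemma has_partial_cong:
  fixes F G :: "'a::euclidean_space \<Rightarrow> real"
  assumes "open S" "x \<in> S" "\<And>y. y \<in> S \<Longrightarrow> F y = G y"
    and "((\<lambda>t. G (x + t *\<^sub>R b)) has_real_derivative D) (at 0)"
  shows "((\<lambda>t. F (x + t *\<^sub>R b)) has_real_derivative D) (at 0)"
proof -
  have "((\<lambda>t. x + t *\<^sub>R b) \<longlongrightarrow> x + 0 *\<^sub>R b) (nhds 0)"
    by (intro tendsto_intros filterlim_ident)
  then have "eventually (\<lambda>t. x + t *\<^sub>R b \<in> S) (nhds 0)"
    by (rule topological_tendstoD) (use assms in auto)
  then have ev: "eventually (\<lambda>t. F (x + t *\<^sub>R b) = G (x + t *\<^sub>R b)) (nhds 0)"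
    by (rule eventually_mono) (use assms(3) in blast)
  show ?thesis using assms(4) unfolding DERIV_cong_ev[OF refl ev refl] .
qed

lemma partial_deriv_eqI:
  "((\<lambda>t. F (x + t *\<^sub>R b)) has_real_derivative D) (at 0) \<Longrightarrow> partial_deriv b F x = D"
  unfolding partial_deriv_def by (rule DERIV_imp_deriv)

lemma Ck_on_cong:
  assumes S: "open S" and "\<And>y. y \<in> S \<Longrightarrow> F y = G y" "Ck_on S k F"
  shows "Ck_on S k G"
  using assms(2,3)
proof (induction k arbitrary: F G)
  case 0
  then show ?case using continuous_on_eq[of S F G] by simp
next
  case (Suc k)
  have h: "((\<lambda>t. G (x + t *\<^sub>R b)) has_real_derivative partial_deriv b F x) (at 0)" if "b \<in> Basis" "x \<in> S" for b x
    by (rule has_partial_cong[OF S that(2) _ Ck_on_has_partial[OF Suc.prems(2) that]]) (use Suc.prems(1) in auto)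
  have "continuous_on S G" using Suc.prems continuous_on_eq[of S F G] by simp
  moreover have "(\<lambda>t. G (x + t *\<^sub>R b)) differentiable (at 0)" if "b \<in> Basis" "x \<in> S" for b x
    using h[OF that] real_differentiable_def by blast
  moreover have "Ck_on S k (partial_deriv b G)" if "b \<in> Basis" for b
    by (rule Suc.IH[OF _ Ck_on_partial[OF Suc.prems(2) that]]) (use h[OF that] partial_deriv_eqI in metis)
  ultimately show ?case by simp
qed

lemma Ck_on_add:
  assumes S: "open S" and "Ck_on S k F" "Ck_on S k G"
  shows "Ck_on S k (\<lambda>x. F x + G x)"
  using assms(2,3)
proof (induction k arbitrary: F G)
  case 0
  then show ?case by (auto intro: continuous_on_add)
next
  case (Suc k)
  have h: "((\<lambda>t. F (x + t *\<^sub>R b) + G (x + t *\<^sub>R b)) has_real_derivative partial_deriv b F x + partial_deriv b G x) (at 0)"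
    if "b \<in> Basis" "x \<in> S" for b x
    by (intro DERIV_add Ck_on_has_partial[OF Suc.prems(1) that] Ck_on_has_partial[OF Suc.prems(2) that])
  have "Ck_on S k (\<lambda>x. partial_deriv b F x + partial_deriv b G x)" if "b \<in> Basis" for b
    by (rule Suc.IH) (use Suc.prems that in auto)
  then have "Ck_on S k (partial_deriv b (\<lambda>x. F x + G x))" if "b \<in> Basis" for b
    using Ck_on_cong[OF S, of "\<lambda>x. partial_deriv b F x + partial_deriv b G x"] partial_deriv_eqI[OF h] that by metis
  moreover have "(\<lambda>t. F (x + t *\<^sub>R b) + G (x + t *\<^sub>R b)) differentiable (at 0)" if "b \<in> Basis" "x \<in> S" for b x
    using h[OF that] real_differentiable_def by blast
  ultimately show ?case using Suc.prems by (simp add: continuous_on_add)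
qed

lemma Ck_on_scale:
  assumes S: "open S" and "Ck_on S k F"
  shows "Ck_on S k (\<lambda>x. c * F x)"
  using assms(2)
proof (induction k arbitrary: F)
  case 0
  then show ?case by (auto intro: continuous_on_mult_left)
next
  case (Suc k)
  have h: "((\<lambda>t. c * F (x + t *\<^sub>R b)) has_real_derivative c * partial_deriv b F x) (at 0)"
    if "b \<in> Basis" "x \<in> S" for b x
    by (intro DERIV_cmult Ck_on_has_partial[OF Suc.prems that])
  have "Ck_on S k (\<lambda>x. c * partial_deriv b F x)" if "b \<in> Basis" for b
    by (rule Suc.IH) (use Suc.prems that in auto)
  then have "Ck_on S k (partial_deriv b (\<lambda>x. c * F x))" if "b \<in> Basis" for b
    using Ck_on_cong[OF S, of "\<lambda>x. c * partial_deriv b F x"] partial_deriv_eqI[OF h] that by metis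
  moreover have "(\<lambda>t. c * F (x + t *\<^sub>R b)) differentiable (at 0)" if "b \<in> Basis" "x \<in> S" for b x
    using h[OF that] real_differentiable_def by blast
  ultimately show ?case using Suc.prems by (simp add: continuous_on_mult_left)
qed

lemma smooth_on_sphere_subspace: "real_fun.subspace (smooth_on_sphere :: ('a::euclidean_space \<Rightarrow> real) set)"
proof (rule real_fun.subspaceI)
  have "radial_extension 0 = (\<lambda>x::'a. 0)" by (simp add: fun_eq_iff radial_extension_def)
  moreover have "Ck_on (- {0}) k (\<lambda>x::'a. 0)" for k
  proof (induction k)
    case (Suc k)
    moreover have "partial_deriv b (\<lambda>x::'a. 0) = (\<lambda>x. 0)" for b by (simp add: fun_eq_iff partial_deriv_def)
    ultimately show ?case by simp
  qed simp
  ultimately show "0 \<in> (smooth_on_sphere :: ('a \<Rightarrow> real) set)" by (simp add: smooth_on_sphere_def)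
next
  fix u v :: "'a \<Rightarrow> real" assume "u \<in> smooth_on_sphere" "v \<in> smooth_on_sphere"
  then show "u + v \<in> smooth_on_sphere"
    using Ck_on_add[OF open_minus_zero, of _ "radial_extension u" "radial_extension v"]
    by (auto simp: smooth_on_sphere_def radial_extension_def[abs_def])
next
  fix c and u :: "'a \<Rightarrow> real" assume "u \<in> smooth_on_sphere"
  then show "(\<lambda>x. c * u x) \<in> smooth_on_sphere"
    using Ck_on_scale[OF open_minus_zero, of _ "radial_extension u"]
    by (auto simp: smooth_on_sphere_def radial_extension_def[abs_def])
qed

lemma partial_partial_add:
  fixes F G :: "'a::euclidean_space \<Rightarrow> real"
  assumes S: "open S" "x \<in> S" and F: "Ck_on S (Suc (Suc 0)) F" and G: "Ck_on S (Suc (Suc 0)) G" and b: "b \<in> Basis"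
  shows "partial_deriv b (partial_deriv b (\<lambda>x. F x + G x)) x = partial_deriv b (partial_deriv b F) x + partial_deriv b (partial_deriv b G) x"
proof (rule partial_deriv_eqI, rule has_partial_cong[OF S])
  show "partial_deriv b (\<lambda>x. F x + G x) y = partial_deriv b F y + partial_deriv b G y" if "y \<in> S" for y
    by (rule partial_deriv_eqI) (intro DERIV_add Ck_on_has_partial[OF F b that] Ck_on_has_partial[OF G b that])
  show "((\<lambda>t. partial_deriv b F (x + t *\<^sub>R b) + partial_deriv b G (x + t *\<^sub>R b)) has_real_derivative
      partial_deriv b (partial_deriv b F) x + partial_deriv b (partial_deriv b G) x) (at 0)"
    by (intro DERIV_add Ck_on_has_partial[OF Ck_on_partial[OF F b] b S(2)] Ck_on_has_partial[OF Ck_on_partial[OF G b] b S(2)])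
qed

lemma partial_partial_scale:
  fixes F :: "'a::euclidean_space \<Rightarrow> real"
  assumes S: "open S" "x \<in> S" and F: "Ck_on S (Suc (Suc 0)) F" and b: "b \<in> Basis"
  shows "partial_deriv b (partial_deriv b (\<lambda>x. c * F x)) x = c * partial_deriv b (partial_deriv b F) x"
proof (rule partial_deriv_eqI, rule has_partial_cong[OF S])
  show "partial_deriv b (\<lambda>x. c * F x) y = c * partial_deriv b F y" if "y \<in> S" for y
    by (rule partial_deriv_eqI) (intro DERIV_cmult Ck_on_has_partial[OF F b that])
  show "((\<lambda>t. c * partial_deriv b F (x + t *\<^sub>R b)) has_real_derivative
      c * partial_deriv b (partial_deriv b F) x) (at 0)"
    by (intro DERIV_cmult Ck_on_has_partial[OF Ck_on_partial[OF F b] b S(2)])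
qed

lemma sphere_laplacian_add:
  assumes "u \<in> smooth_on_sphere" "v \<in> smooth_on_sphere"
  shows "sphere_laplacian (u + v) = sphere_laplacian u + sphere_laplacian v"
proof
  fix x :: 'a
  show "sphere_laplacian (u + v) x = (sphere_laplacian u + sphere_laplacian v) x"
  proof (cases "norm x = 1")
    case True
    then have x: "x \<in> - {0}" by auto
    have "radial_extension (u + v) = (\<lambda>x. radial_extension u x + radial_extension v x)"
      by (simp add: fun_eq_iff radial_extension_def)
    then show ?thesis
      using True partial_partial_add[OF open_minus_zero x smooth_on_sphere_Ck[OF assms(1)] smooth_on_sphere_Ck[OF assms(2)]]
      by (simp add: sphere_laplacian_def sum.distrib)
  qed (simp add: sphere_laplacian_def)
qed

lemma sphere_laplacian_scale:
  assumes "u \<in> smooth_on_sphere"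
  shows "sphere_laplacian (\<lambda>x. c * u x) = (\<lambda>x. c * sphere_laplacian u x)"
proof
  fix x :: 'a
  show "sphere_laplacian (\<lambda>x. c * u x) x = c * sphere_laplacian u x"
  proof (cases "norm x = 1")
    case True
    then have x: "x \<in> - {0}" by auto
    have "radial_extension (\<lambda>x. c * u x) = (\<lambda>x. c * radial_extension u x)"
      by (simp add: fun_eq_iff radial_extension_def)
    then show ?thesis
      using True partial_partial_scale[OF open_minus_zero x smooth_on_sphere_Ck[OF assms(1)]]
      by (simp add: sphere_laplacian_def sum_distrib_left)
  qed (simp add: sphere_laplacian_def)
qed

section \<open>Functions built from the coordinates and the inverse norm\<close>

text \<open>Off \<open>0\<close> this class contains the radial extensions of restricted polynomials
  and is closed under partial derivatives, which yields smoothness of every order by one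
  induction.\<close>

inductive rational_radial :: "('a::euclidean_space \<Rightarrow> real) \<Rightarrow> bool" where
  const: "rational_radial (\<lambda>x. c)"
| coord: "rational_radial (\<lambda>x. x \<bullet> b)"
| inverse_norm: "rational_radial (\<lambda>x. inverse (norm x))"
| add: "rational_radial F \<Longrightarrow> rational_radial G \<Longrightarrow> rational_radial (\<lambda>x. F x + G x)"
| mult: "rational_radial F \<Longrightarrow> rational_radial G \<Longrightarrow> rational_radial (\<lambda>x. F x * G x)"

lemma rational_radial_power: "rational_radial F \<Longrightarrow> rational_radial (\<lambda>x. F x ^ k)"
  by (induction k) (auto intro: rational_radial.intros)

lemma inverse_norm_power_derivative:
  fixes x b :: "'a::euclidean_space"
  assumes "x \<noteq> 0"
  shows "((\<lambda>t. inverse (norm (x + t *\<^sub>R b)) ^ m) has_real_derivative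
     - real m * (x \<bullet> b) * inverse (norm x) ^ (m + 2)) (at 0)"
proof -
  have n: "norm x > 0" using assms by simp
  have "((\<lambda>t. (x + t *\<^sub>R b) \<bullet> (x + t *\<^sub>R b)) has_real_derivative 2 * (x \<bullet> b)) (at 0)"
    by (auto simp: inner_add_left inner_add_right inner_commute intro!: derivative_eq_intros)
  then have "((\<lambda>t. sqrt ((x + t *\<^sub>R b) \<bullet> (x + t *\<^sub>R b))) has_real_derivative inverse (sqrt (x \<bullet> x)) / 2 * (2 * (x \<bullet> b))) (at 0)"
    by (intro DERIV_chain2[where f = sqrt]) (use DERIV_real_sqrt[of "x \<bullet> x"] assms in simp_all)
  then have d: "((\<lambda>t. norm (x + t *\<^sub>R b)) has_real_derivative (x \<bullet> b) / norm x) (at 0)"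
    unfolding norm_eq_sqrt_inner by (simp add: field_simps)
  have "((\<lambda>t. inverse (norm (x + t *\<^sub>R b)) ^ m) has_real_derivative
      real m * (- ((x \<bullet> b) / norm x) * inverse (norm x) ^ 2) * inverse (norm x) ^ (m - 1)) (at 0)"
    using n by (auto intro!: derivative_eq_intros d simp: power2_eq_square)
  moreover have "real m * (- ((x \<bullet> b) / norm x) * inverse (norm x) ^ 2) * inverse (norm x) ^ (m - 1)
     = - real m * (x \<bullet> b) * inverse (norm x) ^ (m + 2)"
    using n by (cases m) (auto simp: field_simps power2_eq_square)
  ultimately show ?thesis by simp
qed

lemma rational_radial_continuous: "rational_radial F \<Longrightarrow> continuous_on (- {0}) F"
  by (induction rule: rational_radial.induct) (auto intro!: continuous_intros)

lemma rational_radial_derivative: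
  "rational_radial F \<Longrightarrow> \<exists>G. rational_radial G \<and> (\<forall>x. x \<noteq> 0 \<longrightarrow> ((\<lambda>t. F (x + t *\<^sub>R b)) has_real_derivative G x) (at 0))"
proof (induction rule: rational_radial.induct)
  case (const c)
  then show ?case by (intro exI[of _ "\<lambda>x. 0"]) (auto intro: rational_radial.intros)
next
  case (coord b')
  have "((\<lambda>t. (x + t *\<^sub>R b) \<bullet> b') has_real_derivative b \<bullet> b') (at 0)" for x
    by (auto simp: inner_add_left intro!: derivative_eq_intros)
  then show ?case by (intro exI[of _ "\<lambda>x. b \<bullet> b'"]) (auto intro: rational_radial.intros)
next
  case inverse_norm
  have "rational_radial (\<lambda>x. (- 1 * (x \<bullet> b)) * inverse (norm x) ^ 3)"
    by (intro rational_radial.intros rational_radial_power)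
  moreover have "((\<lambda>t. inverse (norm (x + t *\<^sub>R b))) has_real_derivative (- 1 * (x \<bullet> b)) * inverse (norm x) ^ 3) (at 0)" if "x \<noteq> 0" for x
    using inverse_norm_power_derivative[OF that, of b 1] by (simp add: numeral_3_eq_3)
  ultimately show ?case by blast
next
  case (add F G)
  then obtain F' G' where "rational_radial F'" "rational_radial G'"
    "\<And>x. x \<noteq> 0 \<Longrightarrow> ((\<lambda>t. F (x + t *\<^sub>R b)) has_real_derivative F' x) (at 0)"
    "\<And>x. x \<noteq> 0 \<Longrightarrow> ((\<lambda>t. G (x + t *\<^sub>R b)) has_real_derivative G' x) (at 0)" by blast
  then show ?case by (intro exI[of _ "\<lambda>x. F' x + G' x"]) (auto intro: rational_radial.intros DERIV_add)
next
  case (mult F G)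
  then obtain F' G' where FG: "rational_radial F'" "rational_radial G'"
    "\<And>x. x \<noteq> 0 \<Longrightarrow> ((\<lambda>t. F (x + t *\<^sub>R b)) has_real_derivative F' x) (at 0)"
    "\<And>x. x \<noteq> 0 \<Longrightarrow> ((\<lambda>t. G (x + t *\<^sub>R b)) has_real_derivative G' x) (at 0)" by blast
  have "((\<lambda>t. F (x + t *\<^sub>R b) * G (x + t *\<^sub>R b)) has_real_derivative F' x * G x + G' x * F x) (at 0)" if "x \<noteq> 0" for x
    using DERIV_mult[OF FG(3)[OF that] FG(4)[OF that]] by simp
  moreover have "rational_radial (\<lambda>x. F' x * G x + G' x * F x)"
    using FG(1,2) mult.hyps by (intro rational_radial.intros)
  ultimately show ?case by blast
qed

lemma rational_radial_Ck: "rational_radial F \<Longrightarrow> Ck_on (- {0}) k F"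
proof (induction k arbitrary: F)
  case 0
  then show ?case by (simp add: rational_radial_continuous)
next
  case (Suc k)
  have "(\<forall>x\<in>- {0}. (\<lambda>t. F (x + t *\<^sub>R b)) differentiable (at 0)) \<and> Ck_on (- {0}) k (partial_deriv b F)" for b
  proof -
    obtain G where G: "rational_radial G" "\<And>x. x \<noteq> 0 \<Longrightarrow> ((\<lambda>t. F (x + t *\<^sub>R b)) has_real_derivative G x) (at 0)"
      using rational_radial_derivative[OF Suc.prems] by blast
    have "Ck_on (- {0}) k (partial_deriv b F)"
      by (rule Ck_on_cong[OF open_minus_zero _ Suc.IH[OF G(1)]]) (use G(2) partial_deriv_eqI in force)
    then show ?thesis using G(2) real_differentiable_def by (metis ComplD singletonI)
  qed
  then show ?case using rational_radial_continuous[OF Suc.prems] by simp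
qed

section \<open>Homogeneous polynomials and their Laplacian\<close>

inductive hpoly :: "nat \<Rightarrow> ('a::euclidean_space \<Rightarrow> real) \<Rightarrow> bool" where
  zero: "hpoly k (\<lambda>x. 0)"
| const: "hpoly 0 (\<lambda>x. c)"
| coord_mult: "b \<in> Basis \<Longrightarrow> hpoly k p \<Longrightarrow> hpoly (Suc k) (\<lambda>x. (x \<bullet> b) * p x)"
| add: "hpoly k p \<Longrightarrow> hpoly k q \<Longrightarrow> hpoly k (\<lambda>x. p x + q x)"

lemma hpoly_homogeneous: "hpoly k p \<Longrightarrow> p (c *\<^sub>R x) = c ^ k * p x"
  by (induction rule: hpoly.induct) (auto simp: algebra_simps)

lemma hpoly_rational_radial: "hpoly k p \<Longrightarrow> rational_radial p"
  by (induction rule: hpoly.induct) (auto intro: rational_radial.intros)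

lemma hpoly_scale: "hpoly k p \<Longrightarrow> hpoly k (\<lambda>x. c * p x)"
proof (induction rule: hpoly.induct)
  case (coord_mult b k p)
  from hpoly.coord_mult[OF coord_mult(1) coord_mult.IH] show ?case by (simp add: mult.left_commute)
next
  case (add k p q)
  from hpoly.add[OF add.IH] show ?case by (simp add: distrib_left)
qed (auto intro: hpoly.intros)

lemma hpoly_finite_sum: "(\<And>i. i \<in> I \<Longrightarrow> hpoly k (p i)) \<Longrightarrow> hpoly k (\<lambda>x. \<Sum>i\<in>I. p i x)"
  by (induction I rule: infinite_finite_induct) (auto intro: hpoly.intros)

lemma hpoly_mult: "hpoly j p \<Longrightarrow> hpoly k q \<Longrightarrow> hpoly (j + k) (\<lambda>x. p x * q x)"
proof (induction rule: hpoly.induct)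
  case (const c)
  then show ?case by (simp add: hpoly_scale)
next
  case (coord_mult b j p)
  from hpoly.coord_mult[OF coord_mult(1) coord_mult.IH[OF coord_mult.prems]] show ?case by (simp add: mult.assoc)
next
  case (add j p p')
  from hpoly.add[OF add.IH[OF add.prems]] show ?case by (simp add: distrib_right)
qed (auto intro: hpoly.intros)

lemma hpoly_inner_self: "hpoly 2 (\<lambda>x. x \<bullet> x)"
proof -
  have "hpoly 2 (\<lambda>x::'a. (x \<bullet> b) * ((x \<bullet> b) * 1))" if "b \<in> Basis" for b
    using hpoly.coord_mult[OF that hpoly.coord_mult[OF that hpoly.const[of 1]]] by (simp add: numeral_2_eq_2)
  then have "hpoly 2 (\<lambda>x::'a. \<Sum>b\<in>Basis. (x \<bullet> b) * ((x \<bullet> b) * 1))" by (rule hpoly_finite_sum)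
  then show ?thesis by (simp add: euclidean_inner[symmetric])
qed

text \<open>For \<open>k = 0\<close> the truncated \<open>k - 1\<close> is \<open>0\<close> and
  would admit nonzero constants. The first conjunct rules this out; the product with a coordinate
  relies on it.\<close>

lemma hpoly_derivative:
  "hpoly k p \<Longrightarrow> b \<in> Basis \<Longrightarrow> \<exists>q. (k = 0 \<longrightarrow> q = (\<lambda>x. 0)) \<and> hpoly (k - 1) q \<and>
     (\<forall>x. ((\<lambda>t. p (x + t *\<^sub>R b)) has_real_derivative q x) (at 0))"
proof (induction rule: hpoly.induct)
  case (zero k)
  then show ?case by (intro exI[of _ "\<lambda>x. 0"]) (auto intro: hpoly.intros)
next
  case (const c)
  then show ?case by (intro exI[of _ "\<lambda>x. 0"]) (auto intro: hpoly.intros)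
next
  case (coord_mult c k p)
  then obtain q where q: "k = 0 \<Longrightarrow> q = (\<lambda>x. 0)" "hpoly (k - 1) q"
    "\<And>x. ((\<lambda>t. p (x + t *\<^sub>R b)) has_real_derivative q x) (at 0)" by blast
  have "((\<lambda>t. ((x + t *\<^sub>R b) \<bullet> c) * p (x + t *\<^sub>R b)) has_real_derivative (b \<bullet> c) * p x + (x \<bullet> c) * q x) (at 0)" for x
  proof -
    have "((\<lambda>t. (x + t *\<^sub>R b) \<bullet> c) has_real_derivative b \<bullet> c) (at 0)"
      by (auto simp: inner_add_left intro!: derivative_eq_intros)
    from DERIV_mult[OF this q(3)] show ?thesis by (simp add: mult.commute)
  qed
  moreover have "hpoly k (\<lambda>x. (b \<bullet> c) * p x + (x \<bullet> c) * q x)"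
  proof (cases k)
    case 0
    then show ?thesis using q(1) hpoly_scale[OF coord_mult(2)] by simp
  next
    case (Suc m)
    then show ?thesis using hpoly.add[OF hpoly_scale[OF coord_mult(2)]] hpoly.coord_mult[OF coord_mult(1) q(2)] by simp
  qed
  ultimately show ?case by (intro exI[of _ "\<lambda>x. (b \<bullet> c) * p x + (x \<bullet> c) * q x"]) simp
next
  case (add k p p')
  then obtain q q' where q: "k = 0 \<Longrightarrow> q = (\<lambda>x. 0)" "hpoly (k - 1) q"
    "\<And>x. ((\<lambda>t. p (x + t *\<^sub>R b)) has_real_derivative q x) (at 0)"
    and q': "k = 0 \<Longrightarrow> q' = (\<lambda>x. 0)" "hpoly (k - 1) q'"
    "\<And>x. ((\<lambda>t. p' (x + t *\<^sub>R b)) has_real_derivative q' x) (at 0)" by blast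
  then show ?case
    by (intro exI[of _ "\<lambda>x. q x + q' x"]) (auto intro: hpoly.intros DERIV_add)
qed

lemma
  assumes "hpoly k p" "b \<in> Basis"
  shows hpoly_has_partial: "((\<lambda>t. p (x + t *\<^sub>R b)) has_real_derivative partial_deriv b p x) (at 0)"
    and hpoly_partial: "hpoly (k - 1) (partial_deriv b p)"
    and hpoly_partial_0: "k = 0 \<Longrightarrow> partial_deriv b p = (\<lambda>x. 0)"
proof -
  obtain q where q: "k = 0 \<longrightarrow> q = (\<lambda>x. 0)" "hpoly (k - 1) q"
    "\<And>x. ((\<lambda>t. p (x + t *\<^sub>R b)) has_real_derivative q x) (at 0)" using hpoly_derivative[OF assms] by blast
  have "partial_deriv b p = q" using partial_deriv_eqI[OF q(3)] by (simp add: fun_eq_iff)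
  with q show "((\<lambda>t. p (x + t *\<^sub>R b)) has_real_derivative partial_deriv b p x) (at 0)"
    "hpoly (k - 1) (partial_deriv b p)" "k = 0 \<Longrightarrow> partial_deriv b p = (\<lambda>x. 0)" by auto
qed

lemma hpoly_euler: "hpoly k p \<Longrightarrow> (\<Sum>b\<in>Basis. (x \<bullet> b) * partial_deriv b p x) = real k * p x"
proof (induction rule: hpoly.induct)
  case (zero k)
  then show ?case by (simp add: partial_deriv_def)
next
  case (const c)
  then show ?case by (simp add: partial_deriv_def)
next
  case (coord_mult c k p)
  have "partial_deriv b (\<lambda>x. (x \<bullet> c) * p x) x = (b \<bullet> c) * p x + (x \<bullet> c) * partial_deriv b p x" if b: "b \<in> Basis" for b
  proof (rule partial_deriv_eqI)
    have "((\<lambda>t. (x + t *\<^sub>R b) \<bullet> c) has_real_derivative b \<bullet> c) (at 0)"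
      by (auto simp: inner_add_left intro!: derivative_eq_intros)
    from DERIV_mult[OF this hpoly_has_partial[OF coord_mult(2) b]]
    show "((\<lambda>t. ((x + t *\<^sub>R b) \<bullet> c) * p (x + t *\<^sub>R b)) has_real_derivative (b \<bullet> c) * p x + (x \<bullet> c) * partial_deriv b p x) (at 0)"
      by (simp add: mult.commute)
  qed
  then have "(\<Sum>b\<in>Basis. (x \<bullet> b) * partial_deriv b (\<lambda>x. (x \<bullet> c) * p x) x) =
     (\<Sum>b\<in>Basis. (x \<bullet> b) * (c \<bullet> b)) * p x + (x \<bullet> c) * (\<Sum>b\<in>Basis. (x \<bullet> b) * partial_deriv b p x)"
    by (simp add: sum_distrib_left sum_distrib_right sum.distrib[symmetric] algebra_simps inner_commute)
  also have "\<dots> = (x \<bullet> c) * p x + (x \<bullet> c) * (real k * p x)"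
    unfolding coord_mult.IH euclidean_inner[of x c, symmetric] ..
  finally show ?case by (simp add: algebra_simps)
next
  case (add k p q)
  have "partial_deriv b (\<lambda>x. p x + q x) x = partial_deriv b p x + partial_deriv b q x" if "b \<in> Basis" for b
    by (rule partial_deriv_eqI) (intro DERIV_add hpoly_has_partial[OF add.hyps(1) that] hpoly_has_partial[OF add.hyps(2) that])
  then show ?case using add.IH by (simp add: distrib_left sum.distrib)
qed

definition restrict_sphere :: "('a::euclidean_space \<Rightarrow> real) \<Rightarrow> 'a \<Rightarrow> real" where
  "restrict_sphere p x = (if norm x = 1 then p x else 0)"

definition euclidean_laplacian :: "('a::euclidean_space \<Rightarrow> real) \<Rightarrow> 'a \<Rightarrow> real" where
  "euclidean_laplacian p x = (\<Sum>b\<in>Basis. partial_deriv b (partial_deriv b p) x)"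

lemma hpoly_laplacian:
  assumes "hpoly k p"
  shows "hpoly (k - 2) (euclidean_laplacian p)" and "k < 2 \<Longrightarrow> euclidean_laplacian p = (\<lambda>x. 0)"
proof -
  have "hpoly (k - 2) (partial_deriv b (partial_deriv b p))" if "b \<in> Basis" for b
    using hpoly_partial[OF hpoly_partial[OF assms that] that] by (simp add: numeral_2_eq_2)
  then show "hpoly (k - 2) (euclidean_laplacian p)"
    unfolding euclidean_laplacian_def[abs_def] by (rule hpoly_finite_sum)
  assume "k < 2"
  then have "partial_deriv b (partial_deriv b p) = (\<lambda>x. 0)" if "b \<in> Basis" for b
    using hpoly_partial_0[OF hpoly_partial[OF assms that] that] by simp
  then show "euclidean_laplacian p = (\<lambda>x. 0)" by (simp add: euclidean_laplacian_def[abs_def])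
qed

lemma radial_extension_hpoly:
  assumes "hpoly k p" "x \<noteq> 0"
  shows "radial_extension (restrict_sphere p) x = p x * inverse (norm x) ^ k"
  using assms by (simp add: radial_extension_def restrict_sphere_def hpoly_homogeneous)

lemma restrict_hpoly_smooth:
  assumes "hpoly k p"
  shows "restrict_sphere p \<in> smooth_on_sphere"
proof -
  have r: "rational_radial (\<lambda>x. p x * inverse (norm x) ^ k)"
    using assms by (intro rational_radial.intros rational_radial_power hpoly_rational_radial)
  have "Ck_on (- {0}) m (radial_extension (restrict_sphere p))" for m
    by (rule Ck_on_cong[OF open_minus_zero _ rational_radial_Ck[OF r]]) (use radial_extension_hpoly[OF assms] in auto)
  then show ?thesis by (simp add: smooth_on_sphere_def restrict_sphere_def)
qed

definition sphere_eigenvalue :: "nat \<Rightarrow> nat \<Rightarrow> real" where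
  "sphere_eigenvalue d k = real k * (real k + real d - 2)"

text \<open>Off \<open>0\<close> the radial extension is \<open>p x * inverse (norm x) ^ k\<close>.
  In its Euclidean Laplacian on the unit sphere, Euler's identity turns the mixed term into
  \<open>- 2 * k * k * p x\<close>, and the power of the norm contributes
  \<open>k * (k + 2) - k * d\<close> times \<open>p x\<close>, with \<open>d\<close> the dimension;
  together this is \<open>- k * (k + d - 2)\<close> times \<open>p x\<close>.\<close>

lemma sphere_laplacian_restrict_hpoly:
  fixes p :: "'a::euclidean_space \<Rightarrow> real"
  assumes p: "hpoly k p"
  shows "sphere_laplacian (restrict_sphere p) x =
    sphere_eigenvalue DIM('a) k * restrict_sphere p x - restrict_sphere (euclidean_laplacian p) x"
proof (cases "norm x = 1")
  case True
  then have x: "x \<noteq> 0" by auto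
  define U where "U = radial_extension (restrict_sphere p)"
  let ?n = "\<lambda>y::'a. inverse (norm y)"
  have U: "U y = p y * ?n y ^ k" if "y \<noteq> 0" for y using radial_extension_hpoly[OF p that] by (simp add: U_def)
  let ?P = "\<lambda>b y. partial_deriv b p y * ?n y ^ k + (- real k * (y \<bullet> b) * ?n y ^ (k + 2)) * p y"
  have P: "partial_deriv b U y = ?P b y" if "b \<in> Basis" "y \<noteq> 0" for b y
  proof (rule partial_deriv_eqI, rule has_partial_cong[OF open_minus_zero])
    show "((\<lambda>t. p (y + t *\<^sub>R b) * ?n (y + t *\<^sub>R b) ^ k) has_real_derivative ?P b y) (at 0)"
      by (rule DERIV_cong[OF DERIV_mult[OF hpoly_has_partial[OF p that(1)] inverse_norm_power_derivative[OF that(2)]]]) simp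
  qed (use U that in auto)
  have "partial_deriv b (partial_deriv b U) x = partial_deriv b (partial_deriv b p) x
      - 2 * real k * ((x \<bullet> b) * partial_deriv b p x) - real k * p x + real k * real (k + 2) * (x \<bullet> b)\<^sup>2 * p x"
    if b: "b \<in> Basis" for b
  proof (rule partial_deriv_eqI, rule has_partial_cong[OF open_minus_zero _ P[OF b]])
    note d1 = DERIV_mult[OF hpoly_has_partial[OF hpoly_partial[OF p b] b] inverse_norm_power_derivative[OF x, of b k]]
    have "((\<lambda>t. - real k * ((x + t *\<^sub>R b) \<bullet> b)) has_real_derivative - real k) (at 0)"
      using b by (auto simp: inner_add_left intro!: derivative_eq_intros)
    note d2 = DERIV_mult[OF DERIV_mult[OF this inverse_norm_power_derivative[OF x, of b "k + 2"]] hpoly_has_partial[OF p b]]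
    show "((\<lambda>t. ?P b (x + t *\<^sub>R b)) has_real_derivative partial_deriv b (partial_deriv b p) x
      - 2 * real k * ((x \<bullet> b) * partial_deriv b p x) - real k * p x + real k * real (k + 2) * (x \<bullet> b)\<^sup>2 * p x) (at 0)"
      by (rule DERIV_cong[OF DERIV_add[OF d1 d2]]) (simp add: True power2_eq_square algebra_simps)
  qed (use x in auto)
  then have "(\<Sum>b\<in>Basis. partial_deriv b (partial_deriv b U) x) =
     (\<Sum>b\<in>Basis. partial_deriv b (partial_deriv b p) x
      - 2 * real k * ((x \<bullet> b) * partial_deriv b p x) - real k * p x + real k * real (k + 2) * (x \<bullet> b)\<^sup>2 * p x)"
    by simp
  also have "\<dots> = euclidean_laplacian p x - 2 * real k * (\<Sum>b\<in>Basis. (x \<bullet> b) * partial_deriv b p x)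
      - real DIM('a) * (real k * p x) + real k * real (k + 2) * (\<Sum>b\<in>Basis. (x \<bullet> b)\<^sup>2) * p x"
    by (simp add: euclidean_laplacian_def sum.distrib sum_subtractf sum_distrib_left sum_distrib_right)
  also have "(\<Sum>b\<in>Basis. (x \<bullet> b)\<^sup>2) = 1"
    using True by (simp add: power2_eq_square euclidean_inner[symmetric] dot_square_norm)
  also have "(\<Sum>b\<in>Basis. (x \<bullet> b) * partial_deriv b p x) = real k * p x" by (rule hpoly_euler[OF p])
  finally show ?thesis
    using True by (simp add: sphere_laplacian_def U_def restrict_sphere_def sphere_eigenvalue_def algebra_simps)
qed (simp add: sphere_laplacian_def restrict_sphere_def)

subsection \<open>Dimensions of polynomial spaces\<close>

text \<open>A union of bases is a basis of the sum. The finite spanning set makes the bases finite,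
  so that their cardinalities add.\<close>

lemma (in vector_space) dim_direct_sum:
  assumes A: "subspace A" and B: "subspace B" and int: "A \<inter> B \<subseteq> {0}"
    and fin: "finite F" "A \<subseteq> span F" "B \<subseteq> span F"
  shows "dim {x + y |x y. x \<in> A \<and> y \<in> B} = dim A + dim B"
proof -
  obtain P where P: "P \<subseteq> A" "independent P" "A \<subseteq> span P" "card P = dim A" using basis_exists by blast
  obtain Q where Q: "Q \<subseteq> B" "independent Q" "B \<subseteq> span Q" "card Q = dim B" using basis_exists by blast
  have fP: "finite P" and fQ: "finite Q"
    using independent_span_bound[OF fin(1)] P Q fin by (meson order_trans)+
  have sP: "span P = A" and sQ: "span Q = B" using span_subspace[OF P(1,3) A] span_subspace[OF Q(1,3) B] by auto
  have "independent (P' \<union> Q)" if "P' \<subseteq> P" for P'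
    using finite_subset[OF that fP] that
  proof (induction P' rule: finite_induct)
    case empty
    then show ?case using Q by simp
  next
    case (insert a P')
    \<comment> \<open>A dependence \<open>a = x + y\<close> would put \<open>y = a - x\<close> into
      both \<open>A\<close> and \<open>B\<close>, so \<open>a\<close> would depend on other elements
      of the basis \<open>P\<close>.\<close>
    have "a \<notin> span (P' \<union> Q)"
    proof
      assume "a \<in> span (P' \<union> Q)"
      then obtain x y where xy: "a = x + y" "x \<in> span P'" "y \<in> span Q" unfolding span_Un by blast
      have "x \<in> A" using xy(2) insert.prems sP span_mono[of P' P] by auto
      moreover have "a \<in> A" using insert.prems P by auto
      ultimately have "a - x \<in> A" by (rule subspace_diff[OF A, rotated])
      then have "y \<in> A \<inter> B" using xy sQ by (auto simp: xy(1))
      then have "a = x" using int xy(1) by auto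
      then have "a \<in> span P'" using xy by simp
      moreover have "independent (insert a P')" using independent_mono[OF P(2)] insert.prems by blast
      ultimately show False using insert.hyps by (simp add: independent_insert)
    qed
    moreover have "independent (P' \<union> Q)" using insert by simp
    ultimately show ?case using independent_insertI by simp
  qed
  then have ind: "independent (P \<union> Q)" by blast
  have disj: "P \<inter> Q = {}"
  proof -
    have "P \<inter> Q \<subseteq> {0}" using P(1) Q(1) int by auto
    moreover have "0 \<notin> P" using P(2) dependent_zero by auto
    ultimately show ?thesis by auto
  qed
  have "span (P \<union> Q) = {x + y |x y. x \<in> A \<and> y \<in> B}" unfolding span_Un sP sQ ..
  then have "dim {x + y |x y. x \<in> A \<and> y \<in> B} = card (P \<union> Q)"
    using dim_span_eq_card_independent[OF ind] by simp
  then show ?thesis using card_Un_disjoint[OF fP fQ disj] P(4) Q(4) by simp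
qed

section \<open>Monomials and their independence on the sphere\<close>

fun monom_list :: "'a::euclidean_space list \<Rightarrow> nat list \<Rightarrow> 'a \<Rightarrow> real" where
  "monom_list (b # bs) (e # es) x = (x \<bullet> b) ^ e * monom_list bs es x"
| "monom_list _ _ x = 1"

lemma hpoly_coord_power: "b \<in> Basis \<Longrightarrow> hpoly e (\<lambda>x. (x \<bullet> b) ^ e)"
proof (induction e)
  case 0
  then show ?case using hpoly.const[of 1] by simp
next
  case (Suc e)
  then show ?case using hpoly.coord_mult[of b e "\<lambda>x. (x \<bullet> b) ^ e"] by simp
qed

lemma hpoly_monom_list:
  "set bs \<subseteq> Basis \<Longrightarrow> length es = length bs \<Longrightarrow> hpoly (sum_list es) (monom_list bs es)"
proof (induction bs arbitrary: es)
  case Nil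
  then show ?case using hpoly.const[of 1] by (simp add: fun_eq_iff[symmetric])
next
  case (Cons b bs)
  then obtain e es' where es: "es = e # es'" "length es' = length bs" by (cases es) auto
  have "hpoly (e + sum_list es') (\<lambda>x. (x \<bullet> b) ^ e * monom_list bs es' x)"
    using Cons es by (intro hpoly_mult hpoly_coord_power) auto
  then show ?case by (simp add: es)
qed

lemma coord_mult_monom_list:
  "b \<in> set bs \<Longrightarrow> length es = length bs \<Longrightarrow> \<exists>es'. length es' = length bs \<and> sum_list es' = Suc (sum_list es) \<and>
     (\<forall>x. (x \<bullet> b) * monom_list bs es x = monom_list bs es' x)"
proof (induction bs arbitrary: es)
  case (Cons c bs)
  then obtain e es0 where es: "es = e # es0" "length es0 = length bs" by (cases es) auto
  show ?case
  proof (cases "b = c")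
    case True
    then show ?thesis using es by (intro exI[of _ "Suc e # es0"]) auto
  next
    case False
    then obtain es' where "length es' = length bs" "sum_list es' = Suc (sum_list es0)"
      "\<And>x. (x \<bullet> b) * monom_list bs es0 x = monom_list bs es' x"
      using Cons.IH[OF _ es(2)] Cons.prems by auto
    then show ?thesis using es by (intro exI[of _ "e # es'"]) (auto simp: mult.left_commute)
  qed
qed simp

definition exponents :: "nat \<Rightarrow> nat \<Rightarrow> nat list set" where
  "exponents N k = {l. length l = N \<and> sum_list l = k}"

lemma card_exponents: "N > 0 \<Longrightarrow> card (exponents N k) = (k + N - 1) choose (N - 1)"
proof -
  assume N: "N > 0"
  have "card (exponents N k) = (k + N - 1) choose k" unfolding exponents_def by (rule card_length_sum_list)
  also have "\<dots> = (k + N - 1) choose (k + N - 1 - k)" by (rule binomial_symmetric) (use N in simp)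
  also have "k + N - 1 - k = N - 1" using N by simp
  finally show ?thesis .
qed

lemma finite_exponents: "N > 0 \<Longrightarrow> finite (exponents N k)"
  by (rule card_ge_0_finite) (simp add: card_exponents zero_less_binomial_iff)

lemma hpoly_span_monom_list:
  assumes bs: "set bs = (Basis :: 'a::euclidean_space set)"
  shows "hpoly k p \<Longrightarrow> p \<in> real_fun.span (monom_list bs ` exponents (length bs) k)"
proof (induction rule: hpoly.induct)
  case (zero k)
  show ?case using real_fun.span_zero by (simp add: zero_fun_def)
next
  case (const c)
  have "monom_list bs (replicate (length bs) 0) = (\<lambda>x. 1)"
  proof
    show "monom_list bs (replicate (length bs) 0) x = 1" for x by (induction bs) auto
  qed
  moreover have "replicate (length bs) 0 \<in> exponents (length bs) 0" by (simp add: exponents_def)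
  ultimately have "(\<lambda>x. 1) \<in> real_fun.span (monom_list bs ` exponents (length bs) 0)"
    by (intro real_fun.span_base) force
  from real_fun.span_scale[OF this, of c] show ?case by simp
next
  case (coord_mult b k p)
  let ?S = "real_fun.span (monom_list bs ` exponents (length bs) (Suc k))"
  from coord_mult.IH show ?case
  proof (induction rule: real_fun.span_induct_alt)
    case base
    show ?case using real_fun.span_zero by (simp add: zero_fun_def)
  next
    case (step c q r)
    then obtain es where es: "q = monom_list bs es" "length es = length bs" "sum_list es = k"
      by (auto simp: exponents_def)
    obtain es' where es': "length es' = length bs" "sum_list es' = Suc k" "\<And>x. (x \<bullet> b) * q x = monom_list bs es' x"
      using coord_mult_monom_list[OF _ es(2), of b] coord_mult bs es by auto
    have "(\<lambda>x. (x \<bullet> b) * q x) \<in> ?S"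
      unfolding es'(3) by (rule real_fun.span_base) (use es' in \<open>auto simp: exponents_def\<close>)
    from real_fun.span_add[OF real_fun.span_scale[OF this, of c] step(2)]
    show ?case by (simp add: plus_fun_def algebra_simps)
  qed
next
  case (add k p q)
  from real_fun.span_add[OF add.IH] show ?case by (simp add: plus_fun_def)
qed

text \<open>Exponents are read as digits to base \<open>M\<close>, least significant first.\<close>

fun kronecker_code :: "nat \<Rightarrow> nat list \<Rightarrow> nat" where
  "kronecker_code M [] = 0"
| "kronecker_code M (e # es) = e + M * kronecker_code M es"

lemma kronecker_code_inj:
  "length es = length es' \<Longrightarrow> \<forall>e\<in>set es. e < M \<Longrightarrow> \<forall>e\<in>set es'. e < M \<Longrightarrow> kronecker_code M es = kronecker_code M es' \<Longrightarrow> es = es'"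
proof (induction es es' rule: list_induct2)
  case (Cons e es e' es')
  have "e = e'" using arg_cong[OF Cons.prems(3), of "\<lambda>n. n mod M"] Cons.prems by simp
  moreover have "kronecker_code M es = kronecker_code M es'" using Cons.prems \<open>e = e'\<close> by auto
  ultimately show ?case using Cons by simp
qed simp

text \<open>Kronecker substitution: on the curve with coordinates \<open>t ^ (M ^ i)\<close>, monomials whose exponents
  are less than \<open>M\<close> become distinct powers of \<open>t\<close>.\<close>
lemma monom_list_curve:
  "length es = length bs \<Longrightarrow> (\<And>i. i < length bs \<Longrightarrow> x \<bullet> (bs ! i) = t ^ (c * M ^ i)) \<Longrightarrow>
     monom_list bs es x = t ^ (c * kronecker_code M es)"
proof (induction bs arbitrary: es c)
  case (Cons b bs)
  then obtain e es' where es: "es = e # es'" "length es' = length bs" by (cases es) auto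
  have "x \<bullet> b = t ^ c" using Cons.prems(2)[of 0] by simp
  moreover have "monom_list bs es' x = t ^ ((c * M) * kronecker_code M es')"
    by (rule Cons.IH[OF es(2)]) (use Cons.prems(2)[of "Suc _"] in \<open>simp add: mult.assoc\<close>)
  ultimately show ?case by (simp add: es power_add power_mult[symmetric] algebra_simps)
qed simp

text \<open>By homogeneity a relation on the sphere holds at every nonzero point, in particular on
  the Kronecker curve. There it becomes a polynomial in one variable with infinitely many zeros,
  whose coefficients are the \<open>c es\<close>.\<close>

lemma monom_list_independent:
  fixes bs :: "'a::euclidean_space list"
  assumes bs: "set bs = Basis" "distinct bs"
    and z: "\<And>x. norm x = 1 \<Longrightarrow> (\<Sum>es\<in>exponents (length bs) k. c es * monom_list bs es x) = 0"
    and es: "es \<in> exponents (length bs) k"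
  shows "c es = 0"
proof -
  let ?A = "exponents (length bs) k"
  \<comment> \<open>All exponents are at most \<open>k\<close>, so they are digits to base
    \<open>k + 1\<close>.\<close>
  define M where "M = Suc k"
  have len: "length bs > 0" using bs(1) nonempty_Basis by (metis length_greater_0_conv list.set(1))
  have fA: "finite ?A" by (rule finite_exponents[OF len])
  have zy: "(\<Sum>es\<in>?A. c es * monom_list bs es y) = 0" if "y \<noteq> 0" for y
  proof -
    have "monom_list bs es y = norm y ^ k * monom_list bs es (y /\<^sub>R norm y)" if "es \<in> ?A" for es
    proof -
      have "hpoly k (monom_list bs es)" using hpoly_monom_list[of bs es] bs that by (auto simp: exponents_def)
      from hpoly_homogeneous[OF this, of "norm y" "y /\<^sub>R norm y"] show ?thesis using \<open>y \<noteq> 0\<close> by simp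
    qed
    then have "(\<Sum>es\<in>?A. c es * monom_list bs es y) = norm y ^ k * (\<Sum>es\<in>?A. c es * monom_list bs es (y /\<^sub>R norm y))"
      by (simp add: sum_distrib_left mult.left_commute)
    then show ?thesis using z[of "y /\<^sub>R norm y"] that by simp
  qed
  define p where "p = (\<Sum>es\<in>?A. monom (c es) (kronecker_code M es))"
  have "poly p t = 0" if t: "t > 0" for t
  proof -
    define y where "y = (\<Sum>i<length bs. t ^ (M ^ i) *\<^sub>R bs ! i)"
    have yb: "y \<bullet> (bs ! i) = t ^ (M ^ i)" if "i < length bs" for i
    proof -
      have "y \<bullet> (bs ! i) = (\<Sum>j<length bs. t ^ (M ^ j) * (bs ! j \<bullet> bs ! i))" by (simp add: y_def inner_sum_left)
      also have "\<dots> = (\<Sum>j<length bs. if j = i then t ^ (M ^ i) else 0)"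
      proof (intro sum.cong refl)
        fix j assume "j \<in> {..<length bs}"
        then have "bs ! j \<in> Basis" "bs ! i \<in> Basis" "bs ! j = bs ! i \<longleftrightarrow> j = i"
          using that bs nth_eq_iff_index_eq by auto
        then show "t ^ (M ^ j) * (bs ! j \<bullet> bs ! i) = (if j = i then t ^ (M ^ i) else 0)"
          by (auto simp: inner_Basis)
      qed
      finally show ?thesis using that by simp
    qed
    have "y \<noteq> 0" using yb[OF len] t by auto
    have "poly p t = (\<Sum>es\<in>?A. c es * t ^ kronecker_code M es)" by (simp add: p_def poly_sum poly_monom)
    also have "\<dots> = (\<Sum>es\<in>?A. c es * monom_list bs es y)"
      using monom_list_curve[of _ bs y t 1 M] yb by (intro sum.cong) (auto simp: exponents_def)
    also have "\<dots> = 0" by (rule zy[OF \<open>y \<noteq> 0\<close>])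
    finally show ?thesis .
  qed
  then have "{0<..} \<subseteq> {t. poly p t = 0}" by auto
  then have "infinite {t. poly p t = 0}" using infinite_Ioi infinite_super by blast
  then have "p = 0" using poly_roots_finite by blast
  then have "0 = coeff p (kronecker_code M es)" by simp
  also have "\<dots> = (\<Sum>es'\<in>?A. if es' = es then c es' else 0)"
    unfolding p_def coeff_sum
  proof (intro sum.cong refl)
    fix es' assume es': "es' \<in> ?A"
    have lt: "\<forall>e\<in>set l. e < M" if "l \<in> ?A" for l
      using that member_le_sum_list[of _ l] by (auto simp: exponents_def M_def less_Suc_eq_le)
    have "kronecker_code M es' = kronecker_code M es \<longleftrightarrow> es' = es"
      using kronecker_code_inj[of es' es M] lt es es' by (auto simp: exponents_def)
    then show "coeff (monom (c es') (kronecker_code M es')) (kronecker_code M es) = (if es' = es then c es' else 0)" by simp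
  qed
  also have "\<dots> = c es" using es fA by (simp add: sum.delta)
  finally show ?thesis by simp
qed

lemma sum_fun_apply: "(\<Sum>i\<in>I. f i) x = (\<Sum>i\<in>I. f i x :: 'b :: comm_monoid_add)"
  by (induction I rule: infinite_finite_induct) auto

definition sphere_polys :: "nat \<Rightarrow> ('a::euclidean_space \<Rightarrow> real) set" where
  "sphere_polys k = restrict_sphere ` {p. hpoly k p}"

lemma sphere_polys_subspace: "real_fun.subspace (sphere_polys k)"
proof (rule real_fun.subspaceI)
  show "0 \<in> (sphere_polys k :: ('a \<Rightarrow> real) set)"
    unfolding sphere_polys_def by (rule image_eqI[of _ _ "\<lambda>x. 0"]) (auto simp: restrict_sphere_def fun_eq_iff intro: hpoly.zero)
next
  fix u v :: "'a \<Rightarrow> real" assume "u \<in> sphere_polys k" "v \<in> sphere_polys k"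
  then obtain p q where "hpoly k p" "hpoly k q" "u = restrict_sphere p" "v = restrict_sphere q"
    by (auto simp: sphere_polys_def)
  then show "u + v \<in> sphere_polys k"
    unfolding sphere_polys_def by (intro image_eqI[of _ _ "\<lambda>x. p x + q x"]) (auto simp: restrict_sphere_def fun_eq_iff intro: hpoly.add)
next
  fix c and u :: "'a \<Rightarrow> real" assume "u \<in> sphere_polys k"
  then obtain p where "hpoly k p" "u = restrict_sphere p"
    by (auto simp: sphere_polys_def)
  then show "(\<lambda>x. c * u x) \<in> sphere_polys k"
    unfolding sphere_polys_def by (intro image_eqI[of _ _ "\<lambda>x. c * p x"]) (auto simp: restrict_sphere_def fun_eq_iff intro: hpoly_scale)
qed

lemma sphere_polys_basis:
  fixes k :: nat
  obtains B :: "('a::euclidean_space \<Rightarrow> real) set" where "finite B" "real_fun.independent B"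
    "real_fun.span B = sphere_polys k" "card B = (k + DIM('a) - 1) choose (DIM('a) - 1)"
proof -
  obtain bs :: "'a list" where bs: "set bs = Basis" "distinct bs"
    using finite_distinct_list[OF finite_Basis] by blast
  have len: "length bs = DIM('a)" using bs distinct_card by fastforce
  define E where "E = exponents (length bs) k"
  define m where "m es = restrict_sphere (monom_list bs es)" for es
  have fE: "finite E" unfolding E_def by (rule finite_exponents) (simp add: len)
  have zero: "c es = 0" if "(\<Sum>es\<in>E. (\<lambda>x. c es * m es x)) = 0" "es \<in> E" for c es
  proof (rule monom_list_independent[OF bs, where k = k])
    fix x :: 'a assume "norm x = 1"
    then show "(\<Sum>es\<in>exponents (length bs) k. c es * monom_list bs es x) = 0"
      using fun_cong[OF that(1), of x] by (simp add: m_def restrict_sphere_def E_def sum_fun_apply)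
  qed (use that in \<open>auto simp: E_def\<close>)
  \<comment> \<open>Equal images of distinct exponent lists would be a linear relation with
    coefficients \<open>1\<close> and \<open>-1\<close>.\<close>
  have inj: "inj_on m E"
  proof (rule inj_onI, rule ccontr)
    fix es es' assume e: "es \<in> E" "es' \<in> E" "m es = m es'" "es \<noteq> es'"
    define c where "c l = (if l = es then 1 else if l = es' then -1 else 0 :: real)" for l
    have "(\<Sum>l\<in>E. (\<lambda>x. c l * m l x)) = (\<Sum>l\<in>{es, es'}. (\<lambda>x. c l * m l x))"
      by (rule sum.mono_neutral_right) (use e fE in \<open>auto simp: c_def zero_fun_def\<close>)
    also have "\<dots> = 0" using e by (simp add: c_def fun_eq_iff)
    finally have "c es = 0" using zero e by blast
    then show False by (simp add: c_def)
  qed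
  have ind: "real_fun.independent (m ` E)"
  proof
    assume "real_fun.dependent (m ` E)"
    then obtain u v where u: "v \<in> m ` E" "u v \<noteq> 0" "(\<Sum>v\<in>m ` E. (\<lambda>x. u v * v x)) = 0"
      unfolding real_fun.dependent_finite[OF finite_imageI[OF fE]] by blast
    have "(\<Sum>es\<in>E. (\<lambda>x. u (m es) * m es x)) = 0" using u(3) by (simp add: sum.reindex[OF inj])
    then show False using u zero[of "\<lambda>es. u (m es)"] by blast
  qed
  have "real_fun.span (m ` E) = sphere_polys k"
  proof (rule real_fun.span_subspace[OF _ _ sphere_polys_subspace])
    have "hpoly k (monom_list bs es)" if "es \<in> E" for es
      using hpoly_monom_list[of bs es] bs that by (auto simp: E_def exponents_def)
    then show "m ` E \<subseteq> sphere_polys k" by (auto simp: m_def sphere_polys_def)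
    show "sphere_polys k \<subseteq> real_fun.span (m ` E)"
    proof
      fix u :: "'a \<Rightarrow> real" assume "u \<in> sphere_polys k"
      then obtain p where p: "hpoly k p" "u = restrict_sphere p" by (auto simp: sphere_polys_def)
      have "restrict_sphere q \<in> real_fun.span (m ` E)" if "q \<in> real_fun.span (monom_list bs ` E)" for q
        using that
      proof (induction rule: real_fun.span_induct_alt)
        case base
        have "restrict_sphere 0 = (0 :: 'a \<Rightarrow> real)" by (simp add: fun_eq_iff restrict_sphere_def)
        then show ?case using real_fun.span_zero by metis
      next
        case (step c q r)
        then have "restrict_sphere q \<in> real_fun.span (m ` E)"
          by (intro real_fun.span_base) (auto simp: m_def)
        from real_fun.span_add[OF real_fun.span_scale[OF this, of c] step(2)]
        have "(\<lambda>x. c * restrict_sphere q x) + restrict_sphere r \<in> real_fun.span (m ` E)" .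
        moreover have "(\<lambda>x. c * restrict_sphere q x) + restrict_sphere r = restrict_sphere ((\<lambda>x. c * q x) + r)"
          by (simp add: fun_eq_iff restrict_sphere_def)
        ultimately show ?case by (simp only:)
      qed
      then show "u \<in> real_fun.span (m ` E)"
        using hpoly_span_monom_list[OF bs(1) p(1)] p(2) by (simp add: E_def)
    qed
  qed
  moreover have "card (m ` E) = (k + DIM('a) - 1) choose (DIM('a) - 1)"
    using card_exponents[of "DIM('a)" k] card_image[OF inj] by (simp add: E_def len)
  ultimately show thesis using that[of "m ` E"] fE ind by blast
qed

lemma dim_sphere_polys:
  "real_fun.dim (sphere_polys k :: ('a::euclidean_space \<Rightarrow> real) set) = (k + DIM('a) - 1) choose (DIM('a) - 1)"
proof (rule sphere_polys_basis[of k, where ?'a = 'a])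
  fix B :: "('a \<Rightarrow> real) set"
  assume "real_fun.independent B" "real_fun.span B = sphere_polys k" "card B = (k + DIM('a) - 1) choose (DIM('a) - 1)"
  then show ?thesis using real_fun.dim_span_eq_card_independent[of B] by simp
qed

subsection \<open>The spectrum of the sphere Laplacian\<close>

text \<open>The case distinction guards against truncated subtraction, which would give the
  constants for \<open>k < 2\<close>.\<close>

definition lower_polys :: "nat \<Rightarrow> ('a::euclidean_space \<Rightarrow> real) set" where
  "lower_polys k = (if k < 2 then {0} else sphere_polys (k - 2))"

definition harmonics :: "nat \<Rightarrow> ('a::euclidean_space \<Rightarrow> real) set" where
  "harmonics k = {u \<in> sphere_polys k. sphere_laplacian u = (\<lambda>x. sphere_eigenvalue DIM('a) k * u x)}"

lemma sphere_polys_smooth: "u \<in> sphere_polys k \<Longrightarrow> u \<in> smooth_on_sphere"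
  by (auto simp: sphere_polys_def restrict_hpoly_smooth)

lemma lower_polys_subspace: "real_fun.subspace (lower_polys k)"
  by (simp add: lower_polys_def sphere_polys_subspace)

text \<open>Multiplying by \<open>x \<bullet> x\<close> raises the degree by two and changes nothing
  on the unit sphere.\<close>

lemma lower_polys_subset: "lower_polys k \<subseteq> sphere_polys k"
proof (cases "k < 2")
  case True
  then show ?thesis using real_fun.subspace_0[OF sphere_polys_subspace] by (simp add: lower_polys_def)
next
  case False
  have "restrict_sphere p \<in> sphere_polys k" if "hpoly (k - 2) p" for p :: "'a \<Rightarrow> real"
  proof -
    have "2 + (k - 2) = k" using False by simp
    with hpoly_mult[OF hpoly_inner_self that] have "hpoly k (\<lambda>x. (x \<bullet> x) * p x)" by metis
    moreover have "restrict_sphere p = restrict_sphere (\<lambda>x. (x \<bullet> x) * p x)"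
      by (simp add: fun_eq_iff restrict_sphere_def dot_square_norm)
    ultimately show ?thesis unfolding sphere_polys_def by blast
  qed
  then show ?thesis using False by (auto simp: lower_polys_def sphere_polys_def[of "k - 2"])
qed

lemma sphere_polys_laplacian:
  fixes u :: "'a::euclidean_space \<Rightarrow> real"
  assumes "u \<in> sphere_polys k"
  obtains r where "r \<in> lower_polys k" "sphere_laplacian u = (\<lambda>x. sphere_eigenvalue DIM('a) k * u x - r x)"
proof -
  obtain p where p: "hpoly k p" "u = restrict_sphere p" using assms by (auto simp: sphere_polys_def)
  have "restrict_sphere (euclidean_laplacian p) \<in> lower_polys k"
  proof (cases "k < 2")
    case True
    then show ?thesis using hpoly_laplacian(2)[OF p(1)] by (simp add: lower_polys_def restrict_sphere_def fun_eq_iff)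
  next
    case False
    then show ?thesis using hpoly_laplacian(1)[OF p(1)] by (simp add: lower_polys_def sphere_polys_def)
  qed
  then show thesis using that sphere_laplacian_restrict_hpoly[OF p(1)] p(2) by blast
qed

lemma sphere_eigenvalue_strict_mono:
  assumes "d \<ge> 2" "i < k"
  shows "sphere_eigenvalue d i < sphere_eigenvalue d k"
proof -
  have "real i * (real i + real d - 2) \<le> real i * (real k + real d - 2)"
    using assms by (intro mult_left_mono) auto
  also have "\<dots> < real k * (real k + real d - 2)"
    using assms by (intro mult_strict_right_mono) auto
  finally show ?thesis by (simp add: sphere_eigenvalue_def)
qed

lemma sphere_eigenvalue_inj:
  "d \<ge> 2 \<Longrightarrow> sphere_eigenvalue d i = sphere_eigenvalue d k \<longleftrightarrow> i = k"
  using sphere_eigenvalue_strict_mono[of d i k] sphere_eigenvalue_strict_mono[of d k i] by (metis less_irrefl linorder_neqE_nat)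

lemma fun_smooth_arith:
  assumes "u \<in> smooth_on_sphere" "v \<in> smooth_on_sphere"
  shows "(\<lambda>x. c * u x + v x) \<in> smooth_on_sphere"
    "sphere_laplacian (\<lambda>x. c * u x + v x) = (\<lambda>x. c * sphere_laplacian u x + sphere_laplacian v x)"
proof -
  have s: "(\<lambda>x. c * u x) \<in> smooth_on_sphere"
    using real_fun.subspace_scale[OF smooth_on_sphere_subspace assms(1)] .
  have e: "(\<lambda>x. c * u x + v x) = (\<lambda>x. c * u x) + v" by (simp add: fun_eq_iff)
  show "(\<lambda>x. c * u x + v x) \<in> smooth_on_sphere"
    unfolding e by (rule real_fun.subspace_add[OF smooth_on_sphere_subspace s assms(2)])
  show "sphere_laplacian (\<lambda>x. c * u x + v x) = (\<lambda>x. c * sphere_laplacian u x + sphere_laplacian v x)"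
    unfolding e sphere_laplacian_add[OF s assms(2)] sphere_laplacian_scale[OF assms(1)] by (simp add: fun_eq_iff)
qed

lemma fun_subspace_arith:
  assumes "real_fun.subspace V" "u \<in> V" "v \<in> V"
  shows "(\<lambda>x. c * u x + v x) \<in> V"
  using real_fun.subspace_add[OF assms(1) real_fun.subspace_scale[OF assms(1,2)] assms(3), of c] by (simp add: plus_fun_def)

text \<open>The Laplacian minus \<open>l\<close> is triangular in the degree: at the top it
  multiplies by the eigenvalue of degree \<open>k\<close> minus \<open>l\<close>, and the error lies
  two degrees lower. Dividing by that number and correcting recursively solves the equation; only
  degrees of the parity of \<open>k\<close> occur.\<close>

lemma laplacian_minus_const_onto:
  fixes u :: "'a::euclidean_space \<Rightarrow> real"
  assumes "\<And>i. i \<le> k \<Longrightarrow> even (i + k) \<Longrightarrow> l \<noteq> sphere_eigenvalue DIM('a) i" "u \<in> sphere_polys k"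
  shows "\<exists>w\<in>sphere_polys k. sphere_laplacian w = (\<lambda>x. l * w x + u x)"
  using assms
proof (induction k arbitrary: u rule: less_induct)
  case (less k)
  let ?e = "sphere_eigenvalue DIM('a) k"
  have ne: "?e - l \<noteq> 0" using less.prems(1)[of k] by auto
  obtain r where r: "r \<in> lower_polys k" "sphere_laplacian u = (\<lambda>x. ?e * u x - r x)"
    using sphere_polys_laplacian[OF less.prems(2)] by blast
  \<comment> \<open>\<open>?c * u\<close> solves the equation up to the error \<open>?c * r\<close>
    in lower degree, which \<open>w'\<close> has to absorb.\<close>
  let ?c = "1 / (?e - l)"
  have "\<exists>w'\<in>lower_polys k. sphere_laplacian w' = (\<lambda>x. l * w' x + ?c * r x)"
  proof (cases "k < 2")
    case True
    have "sphere_laplacian 0 = (0 :: 'a \<Rightarrow> real)"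
      using sphere_laplacian_scale[OF real_fun.subspace_0[OF smooth_on_sphere_subspace], of 0] by (simp add: zero_fun_def)
    then show ?thesis using True r(1) by (simp add: lower_polys_def zero_fun_def)
  next
    case False
    have "\<exists>w\<in>sphere_polys (k - 2). sphere_laplacian w = (\<lambda>x. l * w x + (?c * r x))"
    proof (rule less.IH)
      show "l \<noteq> sphere_eigenvalue DIM('a) i" if "i \<le> k - 2" "even (i + (k - 2))" for i
        using less.prems(1)[of i] that False by auto
      show "(\<lambda>x. ?c * r x) \<in> sphere_polys (k - 2)"
        using real_fun.subspace_scale[OF sphere_polys_subspace, of r "k - 2" ?c] r(1) False by (simp add: lower_polys_def)
    qed (use False in simp)
    then show ?thesis using False by (simp add: lower_polys_def)
  qed
  then obtain w' where w': "w' \<in> lower_polys k" "sphere_laplacian w' = (\<lambda>x. l * w' x + ?c * r x)" by blast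
  have w'k: "w' \<in> sphere_polys k" using w'(1) lower_polys_subset by blast
  show ?case
  proof (intro bexI)
    show "(\<lambda>x. ?c * u x + w' x) \<in> sphere_polys k"
      by (rule fun_subspace_arith[OF sphere_polys_subspace less.prems(2) w'k])
    have "?c * (?e * a - b) + (l * c + ?c * b) = l * (?c * a + c) + a" for a b c
    proof -
      have "?c * (?e * a - b) + (l * c + ?c * b) = ?c * ((?e - l) * a) + l * (?c * a + c)" by (simp add: algebra_simps)
      also have "?c * ((?e - l) * a) = a" using ne by simp
      finally show ?thesis by simp
    qed
    then show "sphere_laplacian (\<lambda>x. ?c * u x + w' x) = (\<lambda>x. l * (?c * u x + w' x) + u x)"
      unfolding fun_smooth_arith(2)[OF sphere_polys_smooth[OF less.prems(2)] sphere_polys_smooth[OF w'k]] r(2) w'(2)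
      by simp
  qed
qed

text \<open>The error term \<open>r\<close> is removed by solving in lower degree with
  \<open>l\<close> the eigenvalue of degree \<open>k\<close>. This is possible because eigenvalues
  of different degrees differ, which is where dimension at least two enters. Subtracting the
  solution from \<open>u\<close> leaves an eigenfunction.\<close>

lemma sphere_polys_decomposition:
  fixes u :: "'a::euclidean_space \<Rightarrow> real"
  assumes d: "DIM('a) \<ge> 2" and u: "u \<in> sphere_polys k"
  obtains h w where "h \<in> harmonics k" "w \<in> lower_polys k" "u = h + w"
proof -
  let ?e = "sphere_eigenvalue DIM('a) k"
  obtain r where r: "r \<in> lower_polys k" "sphere_laplacian u = (\<lambda>x. ?e * u x - r x)"
    using sphere_polys_laplacian[OF u] by blast
  have "\<exists>w\<in>lower_polys k. sphere_laplacian w = (\<lambda>x. ?e * w x + (- r x))"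
  proof (cases "k < 2")
    case True
    have "sphere_laplacian 0 = (0 :: 'a \<Rightarrow> real)"
      using sphere_laplacian_scale[OF real_fun.subspace_0[OF smooth_on_sphere_subspace], of 0] by (simp add: zero_fun_def)
    then show ?thesis using True r(1) by (simp add: lower_polys_def zero_fun_def)
  next
    case False
    have r': "(\<lambda>x. - r x) \<in> sphere_polys (k - 2)"
      using real_fun.subspace_scale[OF sphere_polys_subspace, of r "k - 2" "-1"] r(1) False by (simp add: lower_polys_def)
    have ne: "?e \<noteq> sphere_eigenvalue DIM('a) i" if "i \<le> k - 2" "even (i + (k - 2))" for i
      using sphere_eigenvalue_inj[OF d, of k i] that False by auto
    show ?thesis using laplacian_minus_const_onto[OF ne r'] False by (simp only: lower_polys_def if_False)
  qed
  then obtain w where w: "w \<in> lower_polys k" "sphere_laplacian w = (\<lambda>x. ?e * w x + (- r x))" by blast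
  have wk: "w \<in> sphere_polys k" using w(1) lower_polys_subset by blast
  let ?h = "\<lambda>x. (-1) * w x + u x"
  have "?h \<in> sphere_polys k" by (rule fun_subspace_arith[OF sphere_polys_subspace wk u])
  moreover have "sphere_laplacian ?h = (\<lambda>x. ?e * ?h x)"
    unfolding fun_smooth_arith(2)[OF sphere_polys_smooth[OF wk] sphere_polys_smooth[OF u]] r(2) w(2)
    by (simp add: algebra_simps)
  ultimately have "?h \<in> harmonics k" by (simp add: harmonics_def)
  moreover have "u = ?h + w" by (simp add: fun_eq_iff)
  ultimately show thesis using that w(1) by blast
qed

lemma smooth_continuous_on_sphere: "u \<in> smooth_on_sphere \<Longrightarrow> continuous_on_sphere u"
  using smooth_on_sphere_Ck Ck_on_continuous by blast

lemma continuous_on_sphere_arith: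
  "continuous_on_sphere u \<Longrightarrow> continuous_on_sphere v \<Longrightarrow> continuous_on_sphere (\<lambda>x. c * u x + v x)"
  unfolding radial_extension_def[abs_def] by (intro continuous_intros)

lemma sphere_ip_arith:
  assumes "continuous_on_sphere u" "continuous_on_sphere v" "continuous_on_sphere w"
  shows "sphere_ip (\<lambda>x. c * u x + v x) w = c * sphere_ip u w + sphere_ip v w"
    "sphere_ip w (\<lambda>x. c * u x + v x) = c * sphere_ip w u + sphere_ip w v"
proof -
  have "continuous_on (- {0}) (radial_extension (\<lambda>x. c * u x))"
    using assms(1) unfolding radial_extension_def[abs_def] by (intro continuous_intros)
  from sphere_ip_add_left[OF this assms(2,3)]
  show 1: "sphere_ip (\<lambda>x. c * u x + v x) w = c * sphere_ip u w + sphere_ip v w"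
    by (simp add: plus_fun_def sphere_ip_scale_left)
  show "sphere_ip w (\<lambda>x. c * u x + v x) = c * sphere_ip w u + sphere_ip w v"
    using 1 by (simp add: sphere_ip_commute[of w])
qed

lemma sphere_ip_scale_right: "sphere_ip w (\<lambda>x. c * u x) = c * sphere_ip w u"
  by (simp add: sphere_ip_commute[of w] sphere_ip_scale_left)

text \<open>The polynomial \<open>v\<close> lies in the image of the Laplacian minus
  \<open>l\<close>; symmetry moves this operator onto \<open>u\<close>, which it
  annihilates.\<close>

lemma eigenfunction_perp_polys:
  fixes u :: "'a::euclidean_space \<Rightarrow> real"
  assumes u: "u \<in> smooth_on_sphere" "sphere_laplacian u = (\<lambda>x. l * u x)"
    and l: "\<And>i. i \<le> k \<Longrightarrow> even (i + k) \<Longrightarrow> l \<noteq> sphere_eigenvalue DIM('a) i" and v: "v \<in> sphere_polys k"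
  shows "sphere_ip u v = 0"
proof -
  obtain w where w: "w \<in> sphere_polys k" "sphere_laplacian w = (\<lambda>x. l * w x + v x)"
    using laplacian_minus_const_onto[OF l v] by blast
  note c = smooth_continuous_on_sphere[OF u(1)] smooth_continuous_on_sphere[OF sphere_polys_smooth[OF w(1)]]
    smooth_continuous_on_sphere[OF sphere_polys_smooth[OF v]]
  have "sphere_ip (sphere_laplacian u) w = sphere_ip u (sphere_laplacian w)"
    by (rule sphere_laplacian_symmetric[OF u(1) sphere_polys_smooth[OF w(1)]])
  then show ?thesis unfolding u(2) w(2) using sphere_ip_arith(2)[OF c(2,3,1)] by (simp add: sphere_ip_scale_left)
qed

lemma eigenfunction_perp_eigenfunction:
  assumes u: "u \<in> smooth_on_sphere" "sphere_laplacian u = (\<lambda>x. l * u x)"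
    and v: "v \<in> smooth_on_sphere" "sphere_laplacian v = (\<lambda>x. m * v x)" and "l \<noteq> m"
  shows "sphere_ip u v = 0"
proof -
  have "l * sphere_ip u v = m * sphere_ip u v"
    using sphere_laplacian_symmetric[OF u(1) v(1)] unfolding u(2) v(2)
    by (simp add: sphere_ip_scale_left sphere_ip_scale_right)
  then show ?thesis using assms(5) by simp
qed

lemma harmonics_smooth: "h \<in> harmonics k \<Longrightarrow> h \<in> smooth_on_sphere"
  unfolding harmonics_def using sphere_polys_smooth by blast

text \<open>The orthogonality hypothesis is vacuous if \<open>l\<close> is no
  \<open>sphere_eigenvalue\<close> and concerns a single degree otherwise, so that one induction
  serves both for the list of eigenvalues and for the eigenspaces. Harmonics of the other degrees
  are orthogonal to \<open>u\<close> by symmetry.\<close>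

lemma eigenfunction_perp_all_polys:
  fixes u :: "'a::euclidean_space \<Rightarrow> real"
  assumes d: "DIM('a) \<ge> 2" and u: "u \<in> smooth_on_sphere" "sphere_laplacian u = (\<lambda>x. l * u x)"
    and perp: "\<And>k v. l = sphere_eigenvalue DIM('a) k \<Longrightarrow> v \<in> sphere_polys k \<Longrightarrow> sphere_ip u v = 0"
    and v: "v \<in> sphere_polys j"
  shows "sphere_ip u v = 0"
  using v
proof (induction j arbitrary: v rule: less_induct)
  case (less j)
  obtain h w where hw: "h \<in> harmonics j" "w \<in> lower_polys j" "v = h + w"
    using sphere_polys_decomposition[OF d less.prems] by blast
  have "sphere_ip u w = 0"
  proof (cases "j < 2")
    case True
    then have "w = (\<lambda>x. 0 * w x)" using hw(2) by (simp add: lower_polys_def fun_eq_iff)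
    then show ?thesis using sphere_ip_scale_right[of u 0 w] by simp
  next
    case False
    then show ?thesis using less.IH[of "j - 2" w] hw(2) by (simp add: lower_polys_def)
  qed
  moreover have "sphere_ip u h = 0"
  proof (cases "l = sphere_eigenvalue DIM('a) j")
    case True
    then show ?thesis using perp hw(1) by (simp add: harmonics_def)
  next
    case False
    have "sphere_laplacian h = (\<lambda>x. sphere_eigenvalue DIM('a) j * h x)" using hw(1) by (simp add: harmonics_def)
    then show ?thesis by (rule eigenfunction_perp_eigenfunction[OF u harmonics_smooth[OF hw(1)] _ False])
  qed
  moreover have "v = (\<lambda>x. 1 * h x + w x)" using hw(3) by (simp add: fun_eq_iff)
  moreover have "w \<in> smooth_on_sphere" using hw(2) lower_polys_subset sphere_polys_smooth by blast
  ultimately show ?case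
    using sphere_ip_arith(2)[OF smooth_continuous_on_sphere[OF harmonics_smooth[OF hw(1)]] smooth_continuous_on_sphere smooth_continuous_on_sphere[OF u(1)], of w 1]
    by simp
qed

section \<open>Density of polynomials and completeness of the harmonics\<close>

text \<open>Stone-Weierstrass yields inhomogeneous polynomials; these are sums of homogeneous
  ones.\<close>

inductive hpoly_sum :: "('a::euclidean_space \<Rightarrow> real) \<Rightarrow> bool" where
  base: "hpoly k p \<Longrightarrow> hpoly_sum p"
| add: "hpoly_sum p \<Longrightarrow> hpoly_sum q \<Longrightarrow> hpoly_sum (\<lambda>x. p x + q x)"

lemma hpoly_sum_mult:
  assumes "hpoly_sum p" "hpoly_sum q"
  shows "hpoly_sum (\<lambda>x. p x * q x)"
  using assms
proof (induction arbitrary: q rule: hpoly_sum.induct)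
  case (base k p)
  from base.prems show ?case
  proof (induction rule: hpoly_sum.induct)
    case (base k' q)
    then show ?case using hpoly_mult[OF \<open>hpoly k p\<close>] hpoly_sum.base by blast
  next
    case (add q q')
    from hpoly_sum.add[OF add.IH] show ?case by (simp add: distrib_left)
  qed
next
  case (add p p')
  from hpoly_sum.add[OF add.IH(1)[OF add.prems] add.IH(2)[OF add.prems]] show ?case by (simp add: distrib_right)
qed

lemma real_polynomial_function_hpoly_sum:
  "real_polynomial_function g \<Longrightarrow> hpoly_sum g"
proof (induction rule: real_polynomial_function.induct)
  case (linear f)
  interpret f: bounded_linear f by fact
  have "f = (\<lambda>x. \<Sum>b\<in>Basis. f b * ((x \<bullet> b) * 1))"
  proof
    fix x
    have "f x = f (\<Sum>b\<in>Basis. (x \<bullet> b) *\<^sub>R b)" by (simp add: euclidean_representation)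
    then show "f x = (\<Sum>b\<in>Basis. f b * ((x \<bullet> b) * 1))" by (simp add: f.sum f.scaleR mult.commute)
  qed
  moreover have "hpoly (Suc 0) (\<lambda>x. \<Sum>b\<in>Basis. f b * ((x \<bullet> b) * 1))"
    by (intro hpoly_finite_sum hpoly_scale hpoly.coord_mult hpoly.const)
  ultimately have "hpoly (Suc 0) f" by metis
  then show ?case by (rule hpoly_sum.base)
next
  case (const c)
  show ?case by (rule hpoly_sum.base[OF hpoly.const])
next
  case (add f g)
  then show ?case by (intro hpoly_sum.add)
next
  case (mult f g)
  then show ?case by (intro hpoly_sum_mult)
qed

lemma hpoly_sum_restrict_smooth: "hpoly_sum g \<Longrightarrow> restrict_sphere g \<in> smooth_on_sphere"
proof (induction rule: hpoly_sum.induct)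
  case (base k p)
  then show ?case by (rule restrict_hpoly_smooth)
next
  case (add p q)
  have "restrict_sphere (\<lambda>x. p x + q x) = (\<lambda>x. 1 * restrict_sphere p x + restrict_sphere q x)"
    by (simp add: fun_eq_iff restrict_sphere_def)
  then show ?case using fun_smooth_arith(1)[OF add.IH] by metis
qed

text \<open>For a polynomial \<open>g\<close> within \<open>e\<close> of \<open>u\<close> on the
  sphere, the product of \<open>u\<close> with itself equals that of \<open>u\<close> with
  \<open>u - g\<close>, hence is at most \<open>e\<close> times the constant \<open>C\<close>, a
  weighted L1 norm of \<open>u\<close>.\<close>

lemma perp_all_polys_eq_0:
  fixes u :: "'a::euclidean_space \<Rightarrow> real"
  assumes u: "continuous_on_sphere u" and perp: "\<And>j v. v \<in> sphere_polys j \<Longrightarrow> sphere_ip u v = 0"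
    and x: "norm x = 1"
  shows "u x = 0"
proof (rule sphere_ip_definite[OF u _ x])
  let ?U = "radial_extension u"
  define C where "C = (\<integral>x. cutoff (x \<bullet> x) * (\<bar>?U x\<bar> / (x \<bullet> x)) \<partial>lborel)"
  have iC: "integrable lborel (\<lambda>x. cutoff (x \<bullet> x) * (\<bar>?U x\<bar> / (x \<bullet> x)))"
    by (rule cutoff_mult(3)[OF continuous_cutoff(1) cutoff_eq_0(1)]) (use u in \<open>auto intro!: continuous_intros\<close>)
  have C0: "C \<ge> 0" unfolding C_def by (intro Bochner_Integration.integral_nonneg) (auto simp: cutoff_def)
  have perp': "sphere_ip u (restrict_sphere g) = 0" if "hpoly_sum g" for g
    using that
  proof (induction rule: hpoly_sum.induct)
    case (base k p)
    then show ?case using perp[of "restrict_sphere p" k] by (auto simp: sphere_polys_def)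
  next
    case (add p q)
    have "restrict_sphere (\<lambda>x. p x + q x) = (\<lambda>x. 1 * restrict_sphere p x + restrict_sphere q x)"
      by (simp add: fun_eq_iff restrict_sphere_def)
    then show ?case
      using sphere_ip_arith(2)[OF smooth_continuous_on_sphere[OF hpoly_sum_restrict_smooth[OF add.hyps(1)]]
          smooth_continuous_on_sphere[OF hpoly_sum_restrict_smooth[OF add.hyps(2)]] u, of 1] add.IH by simp
  qed
  have le: "sphere_ip u u \<le> e * C" if e: "e > 0" for e
  proof -
    have "continuous_on (sphere 0 1) ?U" by (rule continuous_on_subset[OF u]) auto
    then obtain g where g: "real_polynomial_function g" "\<And>y. y \<in> sphere 0 1 \<Longrightarrow> \<bar>?U y - g y\<bar> < e"
      using Stone_Weierstrass_real_polynomial_function[OF compact_sphere _ e] by metis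
    have gs: "hpoly_sum g" by (rule real_polynomial_function_hpoly_sum[OF g(1)])
    note cg = smooth_continuous_on_sphere[OF hpoly_sum_restrict_smooth[OF gs]]
    let ?v = "\<lambda>x. (-1) * restrict_sphere g x + u x"
    have cv: "continuous_on_sphere ?v" by (rule continuous_on_sphere_arith[OF cg u])
    have "sphere_ip u u = sphere_ip u ?v"
      using sphere_ip_arith(2)[OF cg u u, of "-1"] perp'[OF gs] by simp
    also have "\<dots> \<le> (\<integral>x. e * (cutoff (x \<bullet> x) * (\<bar>?U x\<bar> / (x \<bullet> x))) \<partial>lborel)"
      unfolding sphere_ip_def
    proof (rule integral_mono)
      show "integrable lborel (\<lambda>x. cutoff (x \<bullet> x) * (?U x * radial_extension ?v x / (x \<bullet> x)))"
        by (rule ip_integrand(3)[OF _ u cv])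
      show "integrable lborel (\<lambda>x. e * (cutoff (x \<bullet> x) * (\<bar>?U x\<bar> / (x \<bullet> x))))"
        by (rule integrable_mult_right[OF iC])
      fix y :: 'a
      show "cutoff (y \<bullet> y) * (?U y * radial_extension ?v y / (y \<bullet> y)) \<le> e * (cutoff (y \<bullet> y) * (\<bar>?U y\<bar> / (y \<bullet> y)))"
      proof (cases "y = 0")
        case True
        then show ?thesis by (simp add: cutoff_eq_0)
      next
        case False
        define z where "z = y /\<^sub>R norm y"
        have z: "norm z = 1" using False by (simp add: z_def)
        have "radial_extension ?v y = ?U z - g z"
          using z by (simp add: radial_extension_def restrict_sphere_def z_def)
        then have "\<bar>radial_extension ?v y\<bar> \<le> e" using g(2)[of z] z by simp
        have "?U y * radial_extension ?v y \<le> e * \<bar>?U y\<bar>"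
        proof -
          have "?U y * radial_extension ?v y \<le> \<bar>?U y\<bar> * \<bar>radial_extension ?v y\<bar>"
            unfolding abs_mult[symmetric] by (rule abs_ge_self)
          also have "\<dots> \<le> \<bar>?U y\<bar> * e"
            by (rule mult_left_mono[OF \<open>\<bar>radial_extension ?v y\<bar> \<le> e\<close> abs_ge_zero])
          finally show ?thesis by (simp add: mult.commute)
        qed
        then have "cutoff (y \<bullet> y) * ((?U y * radial_extension ?v y) / (y \<bullet> y)) \<le> cutoff (y \<bullet> y) * ((e * \<bar>?U y\<bar>) / (y \<bullet> y))"
          by (intro mult_left_mono divide_right_mono) (auto simp: cutoff_def)
        then show ?thesis by (simp add: mult_ac)
      qed
    qed
    also have "\<dots> = e * C" unfolding C_def by (rule integral_mult_right_zero)
    finally show ?thesis .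
  qed
  have "sphere_ip u u \<le> 0"
  proof (rule field_le_epsilon)
    fix e :: real assume "0 < e"
    \<comment> \<open>\<open>C\<close> may vanish, hence the division by
      \<open>C + 1\<close>.\<close>
    then have "sphere_ip u u \<le> (e / (C + 1)) * C" using C0 by (intro le) simp
    also have "\<dots> \<le> 0 + e" using C0 \<open>0 < e\<close> by (simp add: field_simps)
    finally show "sphere_ip u u \<le> 0 + e" .
  qed
  moreover have "sphere_ip u u \<ge> 0"
    unfolding sphere_ip_def by (intro Bochner_Integration.integral_nonneg) (auto simp: cutoff_def)
  ultimately show "sphere_ip u u = 0" by simp
qed

lemma smooth_eqI:
  assumes "u \<in> smooth_on_sphere" "\<And>x. norm x = 1 \<Longrightarrow> u x = 0"
  shows "u = 0"
  using assms by (auto simp: fun_eq_iff smooth_on_sphere_def)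

text \<open>Gram-Schmidt by induction: \<open>b'\<close> is the new vector made orthogonal to the
  span of \<open>B\<close>, and the projection gains a multiple of it. If \<open>b\<close> already
  lies in that span, then \<open>b'\<close> is zero and division by zero makes \<open>c\<close> zero
  as well.\<close>

lemma sphere_projection:
  fixes u :: "'a::euclidean_space \<Rightarrow> real"
  assumes "finite B" "B \<subseteq> smooth_on_sphere" "u \<in> smooth_on_sphere"
  shows "\<exists>p\<in>real_fun.span B. \<forall>b\<in>real_fun.span B. sphere_ip (\<lambda>x. (-1) * p x + u x) b = 0"
  using assms
proof (induction B arbitrary: u rule: finite_induct)
  case empty
  have "sphere_ip w (\<lambda>x. 0 * (0 :: 'a \<Rightarrow> real) x) = 0 * sphere_ip w 0" for w by (rule sphere_ip_scale_right)
  then have "sphere_ip w 0 = 0" for w :: "'a \<Rightarrow> real" by (simp add: zero_fun_def)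
  then show ?case unfolding real_fun.span_empty by blast
next
  case (insert b B)
  have sB: "real_fun.span B \<subseteq> smooth_on_sphere" "real_fun.span (insert b B) \<subseteq> smooth_on_sphere"
    using insert.prems(1) by (intro real_fun.span_minimal smooth_on_sphere_subspace; blast)+
  have b: "b \<in> smooth_on_sphere" using insert.prems by simp
  obtain q where q: "q \<in> real_fun.span B" "\<And>c. c \<in> real_fun.span B \<Longrightarrow> sphere_ip (\<lambda>x. (-1) * q x + b x) c = 0"
    using insert.IH[OF _ b] insert.prems by blast
  obtain p where p: "p \<in> real_fun.span B" "\<And>c. c \<in> real_fun.span B \<Longrightarrow> sphere_ip (\<lambda>x. (-1) * p x + u x) c = 0"
    using insert.IH[OF _ insert.prems(2)] insert.prems by blast
  define b' where "b' = (\<lambda>x. (-1) * q x + b x)"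
  define u' where "u' = (\<lambda>x. (-1) * p x + u x)"
  have b's: "b' \<in> smooth_on_sphere" unfolding b'_def using q sB b by (intro fun_smooth_arith) auto
  have u's: "u' \<in> smooth_on_sphere" unfolding u'_def using p sB insert.prems by (intro fun_smooth_arith) auto
  define c where "c = sphere_ip u' b' / sphere_ip b' b'"
  let ?p = "\<lambda>x. c * b' x + p x"
  have sub: "real_fun.span B \<subseteq> real_fun.span (insert b B)" by (rule real_fun.span_mono) auto
  have bsp: "b \<in> real_fun.span (insert b B)" by (rule real_fun.span_base) simp
  have b'sp: "b' \<in> real_fun.span (insert b B)"
    unfolding b'_def by (rule fun_subspace_arith[OF real_fun.subspace_span]) (use q sub bsp in auto)
  have psp: "?p \<in> real_fun.span (insert b B)"
    by (rule fun_subspace_arith[OF real_fun.subspace_span b'sp]) (use p sub in auto)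
  let ?r = "\<lambda>x. (-1) * ?p x + u x"
  have r: "?r = (\<lambda>x. (- c) * b' x + u' x)" by (simp add: u'_def fun_eq_iff algebra_simps)
  note cont = smooth_continuous_on_sphere
  have rv: "sphere_ip ?r v = - c * sphere_ip b' v + sphere_ip u' v" if "v \<in> smooth_on_sphere" for v
    unfolding r by (rule sphere_ip_arith(1)[OF cont[OF b's] cont[OF u's] cont[OF that]])
  have rB: "sphere_ip ?r v = 0" if "v \<in> real_fun.span B" for v
  proof -
    have "v \<in> smooth_on_sphere" using that sB by blast
    moreover have "sphere_ip b' v = 0" unfolding b'_def by (rule q(2)[OF that])
    moreover have "sphere_ip u' v = 0" unfolding u'_def by (rule p(2)[OF that])
    ultimately show ?thesis using rv[of v] by simp
  qed
  have rb': "sphere_ip ?r b' = 0"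
  proof (cases "sphere_ip b' b' = 0")
    case True
    then have "b' x = 0" if "norm x = 1" for x using sphere_ip_definite[OF cont[OF b's]] that by blast
    then have "b' = 0" by (rule smooth_eqI[OF b's])
    then have "b' = (\<lambda>x. 0 * b' x)" by (simp add: fun_eq_iff)
    then show ?thesis using sphere_ip_scale_right[of ?r 0 b'] by simp
  next
    case False
    then show ?thesis unfolding rv[OF b's] by (simp add: c_def)
  qed
  have "sphere_ip ?r v = 0" if vB: "v \<in> real_fun.span (insert b B)" for v
  proof -
    obtain k where k0: "v - (\<lambda>x. k * b x) \<in> real_fun.span B"
      using vB unfolding real_fun.span_insert by blast
    have "v - (\<lambda>x. k * b x) = (\<lambda>x. v x - k * b x)" by (simp add: fun_eq_iff)
    with k0 have k: "(\<lambda>x. v x - k * b x) \<in> real_fun.span B" by (simp only:)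
    have vk: "(\<lambda>x. k * q x + (v x - k * b x)) \<in> real_fun.span B"
      by (rule fun_subspace_arith[OF real_fun.subspace_span q(1) k])
    have v: "v = (\<lambda>x. k * b' x + (k * q x + (v x - k * b x)))" by (simp add: b'_def fun_eq_iff algebra_simps)
    have rs: "?r \<in> smooth_on_sphere" unfolding r by (rule fun_smooth_arith[OF b's u's])
    have vks: "(\<lambda>x. k * q x + (v x - k * b x)) \<in> smooth_on_sphere" using vk sB by blast
    have "sphere_ip ?r v = k * sphere_ip ?r b' + sphere_ip ?r (\<lambda>x. k * q x + (v x - k * b x))"
      by (subst v) (rule sphere_ip_arith(2)[OF cont[OF b's] cont[OF vks] cont[OF rs]])
    then show ?thesis using rb' rB[OF vk] by simp
  qed
  then show ?case by (intro bexI[OF _ psp] ballI)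
qed

lemma harmonics_subspace: "real_fun.subspace (harmonics k :: ('a::euclidean_space \<Rightarrow> real) set)"
proof (rule real_fun.subspaceI)
  have "sphere_laplacian 0 = (0 :: 'a \<Rightarrow> real)"
    using sphere_laplacian_scale[OF real_fun.subspace_0[OF smooth_on_sphere_subspace], of 0] by (simp add: zero_fun_def)
  then show "0 \<in> (harmonics k :: ('a \<Rightarrow> real) set)"
    using real_fun.subspace_0[OF sphere_polys_subspace] by (simp add: harmonics_def zero_fun_def)
next
  fix u v :: "'a \<Rightarrow> real" assume uv: "u \<in> harmonics k" "v \<in> harmonics k"
  then show "u + v \<in> harmonics k"
    using sphere_laplacian_add[OF harmonics_smooth[OF uv(1)] harmonics_smooth[OF uv(2)]]
      real_fun.subspace_add[OF sphere_polys_subspace, of u k v]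
    by (simp add: harmonics_def fun_eq_iff algebra_simps)
next
  fix c and u :: "'a \<Rightarrow> real" assume u: "u \<in> harmonics k"
  then show "(\<lambda>x. c * u x) \<in> harmonics k"
    using sphere_laplacian_scale[OF harmonics_smooth[OF u], of c]
      real_fun.subspace_scale[OF sphere_polys_subspace, of u k c]
    by (simp add: harmonics_def fun_eq_iff algebra_simps)
qed

lemma harmonics_perp_lower:
  fixes u :: "'a::euclidean_space \<Rightarrow> real"
  assumes d: "DIM('a) \<ge> 2" and u: "u \<in> smooth_on_sphere" "sphere_laplacian u = (\<lambda>x. sphere_eigenvalue DIM('a) k * u x)"
    and w: "w \<in> lower_polys k"
  shows "sphere_ip u w = 0"
proof (cases "k < 2")
  case True
  then have "w = (\<lambda>x. 0 * w x)" using w by (simp add: lower_polys_def fun_eq_iff)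
  then show ?thesis using sphere_ip_scale_right[of u 0 w] by simp
next
  case False
  show ?thesis
    by (rule eigenfunction_perp_polys[OF u, of "k - 2"])
      (use w False sphere_eigenvalue_inj[OF d] in \<open>auto simp: lower_polys_def\<close>)
qed

text \<open>The projection of \<open>u\<close> onto the harmonics is subtracted. What is left is an
  eigenfunction orthogonal to the harmonics and to the lower polynomials, hence to all polynomials
  of degree \<open>k\<close>, hence to all polynomials, and is zero by density.\<close>

lemma sphere_eigenspace:
  fixes u :: "'a::euclidean_space \<Rightarrow> real"
  assumes d: "DIM('a) \<ge> 2" and u: "u \<in> smooth_on_sphere" "sphere_laplacian u = (\<lambda>x. sphere_eigenvalue DIM('a) k * u x)"
  shows "u \<in> harmonics k"
proof -
  let ?e = "sphere_eigenvalue DIM('a) k"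
  obtain F :: "('a \<Rightarrow> real) set" where F: "finite F" "real_fun.span F = sphere_polys k"
    using sphere_polys_basis by blast
  obtain B :: "('a \<Rightarrow> real) set" where B: "B \<subseteq> harmonics k" "real_fun.independent B" "harmonics k \<subseteq> real_fun.span B"
      "card B = real_fun.dim (harmonics k :: ('a \<Rightarrow> real) set)"
    by (rule real_fun.basis_exists)
  have sB: "real_fun.span B = harmonics k" by (rule real_fun.span_subspace[OF B(1,3) harmonics_subspace])
  have "B \<subseteq> real_fun.span F" using B(1) F(2) by (auto simp: harmonics_def)
  then have fB: "finite B" using real_fun.independent_span_bound[OF F(1) B(2)] by blast
  have "B \<subseteq> smooth_on_sphere" using B(1) harmonics_smooth by blast
  from sphere_projection[OF fB this u(1)]
  have "\<exists>p\<in>harmonics k. \<forall>h\<in>harmonics k. sphere_ip (\<lambda>x. (-1) * p x + u x) h = 0"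
    unfolding sB .
  then obtain p where p: "p \<in> harmonics k" "\<And>h. h \<in> harmonics k \<Longrightarrow> sphere_ip (\<lambda>x. (-1) * p x + u x) h = 0"
    by (elim bexE) (rule that, assumption, erule bspec)
  let ?v = "\<lambda>x. (-1) * p x + u x"
  have vs: "?v \<in> smooth_on_sphere" by (rule fun_smooth_arith[OF harmonics_smooth[OF p(1)] u(1)])
  have vl: "sphere_laplacian ?v = (\<lambda>x. ?e * ?v x)"
    unfolding fun_smooth_arith(2)[OF harmonics_smooth[OF p(1)] u(1)] u(2)
    using p(1) by (simp add: harmonics_def algebra_simps)
  have "sphere_ip ?v z = 0" if z: "z \<in> sphere_polys k" for z
  proof -
    obtain h w where hw: "h \<in> harmonics k" "w \<in> lower_polys k" "z = h + w"
      using sphere_polys_decomposition[OF d z] by blast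
    have "z = (\<lambda>x. 1 * h x + w x)" using hw(3) by (simp add: fun_eq_iff)
    moreover have "w \<in> smooth_on_sphere" using hw(2) lower_polys_subset sphere_polys_smooth by blast
    ultimately have "sphere_ip ?v z = 1 * sphere_ip ?v h + sphere_ip ?v w"
      using sphere_ip_arith(2)[OF smooth_continuous_on_sphere[OF harmonics_smooth[OF hw(1)]]
        smooth_continuous_on_sphere smooth_continuous_on_sphere[OF vs], of w 1] by simp
    then show ?thesis using p(2)[OF hw(1)] harmonics_perp_lower[OF d vs vl hw(2)] by simp
  qed
  then have "sphere_ip ?v z = 0" if "z \<in> sphere_polys j" for z j
    using eigenfunction_perp_all_polys[OF d vs vl _ that] sphere_eigenvalue_inj[OF d] by metis
  then have "?v x = 0" if "norm x = 1" for x
    using perp_all_polys_eq_0[OF smooth_continuous_on_sphere[OF vs] _ that] by blast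
  then have "?v = 0" by (rule smooth_eqI[OF vs])
  then have "u = p" by (simp add: fun_eq_iff)
  then show ?thesis using p(1) by simp
qed

lemma sphere_spectrum:
  fixes u :: "'a::euclidean_space \<Rightarrow> real"
  assumes d: "DIM('a) \<ge> 2" and u: "u \<in> smooth_on_sphere" "sphere_laplacian u = (\<lambda>x. l * u x)"
    and x: "u x \<noteq> 0"
  obtains k where "l = sphere_eigenvalue DIM('a) k"
proof (rule ccontr)
  assume n: "\<not> thesis"
  have ne: "l \<noteq> sphere_eigenvalue DIM('a) k" for k using n that by blast
  have "sphere_ip u v = 0" if "v \<in> sphere_polys j" for v j
    by (rule eigenfunction_perp_all_polys[OF d u _ that]) (use ne in blast)
  then have "u y = 0" if "norm y = 1" for y
    using perp_all_polys_eq_0[OF smooth_continuous_on_sphere[OF u(1)] _ that] by blast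
  then have "u = 0" by (rule smooth_eqI[OF u(1)])
  then show False using x by simp
qed

text \<open>Degree \<open>k\<close> is the sum of harmonics and lower polynomials, which meet only
  in zero by orthogonality. The additive form avoids subtraction of natural numbers.\<close>

lemma dim_harmonics:
  fixes k :: nat
  assumes d: "DIM('a::euclidean_space) \<ge> 2"
  shows "real_fun.dim (harmonics k :: ('a \<Rightarrow> real) set) + (if k < 2 then 0 else (k - 2 + DIM('a) - 1) choose (DIM('a) - 1))
    = (k + DIM('a) - 1) choose (DIM('a) - 1)"
proof -
  obtain F :: "('a \<Rightarrow> real) set" where F: "finite F" "real_fun.span F = sphere_polys k"
    using sphere_polys_basis by blast
  have eq: "{x + y |x y. x \<in> harmonics k \<and> y \<in> lower_polys k} = (sphere_polys k :: ('a \<Rightarrow> real) set)"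
  proof (intro equalityI subsetI)
    fix u :: "'a \<Rightarrow> real" assume "u \<in> sphere_polys k"
    then show "u \<in> {x + y |x y. x \<in> harmonics k \<and> y \<in> lower_polys k}"
      using sphere_polys_decomposition[OF d] by blast
  next
    fix u :: "'a \<Rightarrow> real" assume "u \<in> {x + y |x y. x \<in> harmonics k \<and> y \<in> lower_polys k}"
    then obtain x y where xy: "u = x + y" "x \<in> sphere_polys k" "y \<in> lower_polys k"
      unfolding harmonics_def by blast
    have "y \<in> sphere_polys k" using xy(3) lower_polys_subset by blast
    then show "u \<in> sphere_polys k"
      unfolding xy(1) by (rule real_fun.subspace_add[OF sphere_polys_subspace xy(2)])
  qed
  have "harmonics k \<inter> lower_polys k \<subseteq> {0 :: 'a \<Rightarrow> real}"
  proof
    fix u :: "'a \<Rightarrow> real" assume "u \<in> harmonics k \<inter> lower_polys k"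
    then have u: "u \<in> harmonics k" "u \<in> lower_polys k" by auto
    note us = harmonics_smooth[OF u(1)]
    have "sphere_ip u u = 0"
      by (rule harmonics_perp_lower[OF d us _ u(2)]) (use u(1) in \<open>simp add: harmonics_def\<close>)
    then have "u = 0"
      using smooth_eqI[OF us] sphere_ip_definite[OF smooth_continuous_on_sphere[OF us]] by blast
    then show "u \<in> {0}" by simp
  qed
  then have "real_fun.dim (sphere_polys k :: ('a \<Rightarrow> real) set) =
      real_fun.dim (harmonics k :: ('a \<Rightarrow> real) set) + real_fun.dim (lower_polys k :: ('a \<Rightarrow> real) set)"
    unfolding eq[symmetric]
    by (rule real_fun.dim_direct_sum[OF harmonics_subspace lower_polys_subspace _ F(1)])
      (use F(2) lower_polys_subset in \<open>auto simp: harmonics_def\<close>)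
  moreover have "real_fun.dim (lower_polys k :: ('a \<Rightarrow> real) set) = (if k < 2 then 0 else (k - 2 + DIM('a) - 1) choose (DIM('a) - 1))"
  proof (cases "k < 2")
    case True
    have "real_fun.dim {0 :: 'a \<Rightarrow> real} = 0"
      using real_fun.dim_le_card[of "{0 :: 'a \<Rightarrow> real}" "{}"] by (simp add: real_fun.span_empty)
    then show ?thesis using True by (simp add: lower_polys_def)
  next
    case False
    then show ?thesis using dim_sphere_polys[of "k - 2", where ?'a = 'a] by (simp add: lower_polys_def)
  qed
  ultimately show ?thesis unfolding dim_sphere_polys by simp
qed

subsection \<open>Polynomial identities and the determinant\<close>

lemma even_poly_iff: "even_poly (p :: rat poly) \<longleftrightarrow> (\<forall>i. odd i \<longrightarrow> coeff p i = 0)"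
proof -
  have "even_poly p \<longleftrightarrow> (\<forall>i. (- 1) ^ i * coeff p i = coeff p i)"
    by (simp add: even_poly_def poly_eq_iff coeff_pcompose_linear)
  also have "\<dots> \<longleftrightarrow> (\<forall>i. odd i \<longrightarrow> coeff p i = 0)"
    by (intro all_cong1) (auto simp: uminus_power_if)
  finally show ?thesis .
qed

lemma even_poly_add: "even_poly p \<Longrightarrow> even_poly q \<Longrightarrow> even_poly (p + q :: rat poly)"
  and even_poly_diff: "even_poly p \<Longrightarrow> even_poly q \<Longrightarrow> even_poly (p - q :: rat poly)"
  and even_poly_smult: "even_poly p \<Longrightarrow> even_poly (smult c p :: rat poly)"
  and even_poly_0: "even_poly (0 :: rat poly)"
  and even_poly_const: "even_poly ([:c:] :: rat poly)"
  by (auto simp: even_poly_iff coeff_pCons split: nat.splits)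

lemma even_poly_sum: "(\<And>i. i \<in> I \<Longrightarrow> even_poly (p i)) \<Longrightarrow> even_poly (\<Sum>i\<in>I. p i :: rat poly)"
  by (induction I rule: infinite_finite_induct) (auto simp: even_poly_add even_poly_0)

lemma even_poly_monom_mult: "even k \<Longrightarrow> even_poly p \<Longrightarrow> even_poly (monom 1 k * p :: rat poly)"
  by (auto simp: even_poly_iff coeff_monom_mult)

lemma rpoly_add: "rpoly (p + q) s = rpoly p s + rpoly q s"
  and rpoly_diff: "rpoly (p - q) s = rpoly p s - rpoly q s"
  and rpoly_smult: "rpoly (smult c p) s = of_rat c * rpoly p s"
  and rpoly_0: "rpoly 0 s = 0"
  and rpoly_const: "rpoly [:c:] s = of_rat c"
  and rpoly_uminus: "rpoly (- p) s = - rpoly p s"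
proof -
  have "map_poly of_rat (p + q) = (map_poly of_rat p + map_poly of_rat q :: real poly)"
    by (rule poly_eqI) (simp add: coeff_map_poly of_rat_add)
  then show "rpoly (p + q) s = rpoly p s + rpoly q s" by (simp add: rpoly_def)
  have "map_poly of_rat (p - q) = (map_poly of_rat p - map_poly of_rat q :: real poly)"
    by (rule poly_eqI) (simp add: coeff_map_poly of_rat_diff)
  then show "rpoly (p - q) s = rpoly p s - rpoly q s" by (simp add: rpoly_def)
  have "map_poly of_rat (smult c p) = (smult (of_rat c) (map_poly of_rat p) :: real poly)"
    by (rule poly_eqI) (simp add: coeff_map_poly of_rat_mult)
  then show "rpoly (smult c p) s = of_rat c * rpoly p s" by (simp add: rpoly_def)
  have "map_poly of_rat (- p) = (- map_poly of_rat p :: real poly)"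
    by (rule poly_eqI) (simp add: coeff_map_poly of_rat_minus)
  then show "rpoly (- p) s = - rpoly p s" by (simp add: rpoly_def)
  show "rpoly 0 s = 0" "rpoly [:c:] s = of_rat c" by (simp_all add: rpoly_def map_poly_pCons)
qed

lemma rpoly_sum: "rpoly (\<Sum>i\<in>I. p i) s = (\<Sum>i\<in>I. rpoly (p i) s)"
  by (induction I rule: infinite_finite_induct) (auto simp: rpoly_add rpoly_0)

lemma rpoly_mult: "rpoly (p * q) s = rpoly p s * rpoly q s"
proof -
  have "map_poly of_rat (p * q) = (map_poly of_rat p * map_poly of_rat q :: real poly)"
    by (rule poly_eqI) (simp add: coeff_map_poly coeff_mult of_rat_sum of_rat_mult)
  then show ?thesis by (simp add: rpoly_def)
qed

lemma rpoly_monom: "rpoly (monom 1 k) s = s ^ k"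
  by (simp add: rpoly_def map_poly_monom poly_monom)

lemma rpoly_prod: "rpoly (\<Prod>i\<in>I. p i) s = (\<Prod>i\<in>I. rpoly (p i) s)"
proof (induction I rule: infinite_finite_induct)
  case (infinite A)
  then show ?case using rpoly_const[of 1] by (simp add: one_pCons)
next
  case empty
  then show ?case using rpoly_const[of 1] by (simp add: one_pCons)
qed (auto simp: rpoly_mult)

lemma rpoly_expand:
  assumes "\<And>i. i \<ge> n \<Longrightarrow> coeff p i = 0"
  shows "rpoly p x = (\<Sum>i<n. of_rat (coeff p i) * x ^ i)"
proof -
  have "rpoly p x = (\<Sum>i\<le>degree (map_poly of_rat p :: real poly). of_rat (coeff p i) * x ^ i)"
    by (simp add: rpoly_def poly_altdef coeff_map_poly)
  also have "\<dots> = (\<Sum>i\<in>{..degree (map_poly of_rat p :: real poly)} \<inter> {..<n}. of_rat (coeff p i) * x ^ i)"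
    by (rule sum.mono_neutral_right) (auto simp: assms not_less)
  also have "\<dots> = (\<Sum>i<n. of_rat (coeff p i) * x ^ i)"
  proof (rule sum.mono_neutral_left)
    show "\<forall>i\<in>{..<n} - {..degree (map_poly of_rat p :: real poly)} \<inter> {..<n}. of_rat (coeff p i) * x ^ i = 0"
      using coeff_eq_0[of "map_poly of_rat p :: real poly"] by (auto simp: coeff_map_poly not_le)
  qed auto
  finally show ?thesis .
qed

section \<open>Multiplicities and weights as rational polynomials\<close>

text \<open>The Pochhammer symbols become products \<open>A\<close> and \<open>B\<close> of linear
  factors in \<open>x = j + 1 + ncheck n\<close>. About this centre the reflection of
  \<open>x\<close> exchanges \<open>A\<close> and \<open>B\<close> up to the sign
  \<open>(- 1) ^ n\<close>, so \<open>A - B\<close> has the parity of \<open>n - 1\<close>.\<close>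

lemma multiplicity_poly:
  assumes n: "n \<ge> 1"
  obtains Q :: "rat poly" where "\<And>q. even (q + n) \<Longrightarrow> coeff Q q = 0" "\<And>q. q \<ge> n \<Longrightarrow> coeff Q q = 0"
    "\<And>j. rpoly Q (real j + (1 + ncheck n)) = (pochhammer (real j + 2) n - pochhammer (real j) n) / fact n"
proof -
  define c :: rat where "c = (of_nat n - 1) / 2"
  define A where "A = (\<Prod>i=0..<n. [:1 + of_nat i - c, 1:])"
  define B where "B = (\<Prod>i=0..<n. [:of_nat i - 1 - c, 1:])"
  define Q where "Q = smult (1 / fact n) (A - B)"
  have rA: "poly A (- x) = (- 1) ^ n * poly B x" for x
  proof -
    have "poly A (- x) = (\<Prod>i=0..<n. 1 + of_nat i - c - x)" by (simp add: A_def poly_prod)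
    \<comment> \<open>Reversing the order of the factors, with \<open>n - 1 = 2 * c\<close>, turns a
      factor of \<open>A\<close> at \<open>- x\<close> into minus a factor of \<open>B\<close> at
      \<open>x\<close>.\<close>
    also have "\<dots> = (\<Prod>i=0..<n. 1 + of_nat (n - 1 - i) - c - x)"
      by (rule prod.reindex_bij_witness[of _ "\<lambda>i. n - 1 - i" "\<lambda>i. n - 1 - i"]) auto
    also have "\<dots> = (\<Prod>i=0..<n. (- 1) * (of_nat i - 1 - c + x))"
    proof (intro prod.cong refl)
      fix i assume "i \<in> {0..<n}"
      then have "(of_nat (n - 1 - i) :: rat) = of_nat n - 1 - of_nat i" by (simp add: of_nat_diff)
      then show "1 + of_nat (n - 1 - i) - c - x = (- 1) * (of_nat i - 1 - c + x)" by (simp add: c_def field_simps)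
    qed
    also have "\<dots> = (- 1) ^ n * poly B x"
      by (simp only: prod.distrib) (simp add: B_def poly_prod)
    finally show ?thesis .
  qed
  have rB: "poly B (- x) = (- 1) ^ n * poly A x" for x
  proof -
    have "(- 1) ^ n * poly A x = ((- 1) ^ n * (- 1) ^ n) * poly B (- x)" using rA[of "- x"] by simp
    also have "((- 1) ^ n * (- 1) ^ n :: rat) = 1" by (simp flip: power_mult_distrib)
    finally show ?thesis by simp
  qed
  have "poly (pcompose (A - B) [:0, -1:]) = poly (smult (- ((- 1) ^ n)) (A - B))"
    by (rule ext) (simp add: poly_pcompose rA rB algebra_simps)
  then have "pcompose (A - B) [:0, -1:] = smult (- ((- 1) ^ n)) (A - B)" by (simp only: poly_eq_poly_eq_iff)
  then have "coeff (pcompose (A - B) [:0, -1:]) q = coeff (smult (- ((- 1) ^ n)) (A - B)) q" for q by simp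
  then have c: "(- 1) ^ q * coeff (A - B) q = - ((- 1) ^ n) * coeff (A - B) q" for q
    unfolding coeff_pcompose_linear by simp
  have par: "coeff Q q = 0" if "even (q + n)" for q
  proof -
    have "(- 1 :: rat) ^ q = (- 1) ^ n" using that by (auto simp: minus_one_power_iff)
    then have "(- 1) ^ n * coeff (A - B) q = - ((- 1) ^ n * coeff (A - B) q)" using c[of q] by simp
    then have "(- 1) ^ n * coeff (A - B) q = 0" by linarith
    then have "coeff (A - B) q = 0" by simp
    then show ?thesis by (simp add: Q_def)
  qed
  have deg: "degree (\<Prod>i=0..<n. [:f i, 1 :: rat:]) \<le> n" for f
    using degree_prod_sum_le[of "{0..<n}" "\<lambda>i. [:f i, 1 :: rat:]"] by simp
  have "degree (A - B) \<le> n" unfolding A_def B_def by (intro degree_diff_le deg)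
  then have "degree Q \<le> n" unfolding Q_def using degree_smult_le order_trans by blast
  \<comment> \<open>Parity removes the coefficient of \<open>x ^ n\<close>, the only one that the
    degree bound leaves open.\<close>
  then have hi: "coeff Q q = 0" if "q \<ge> n" for q
    using that par[of n] by (cases "q = n") (auto intro: coeff_eq_0)
  have val: "rpoly Q (real j + (1 + ncheck n)) = (pochhammer (real j + 2) n - pochhammer (real j) n) / fact n" for j
  proof -
    have c': "(of_rat c :: real) = ncheck n"
      by (simp add: c_def ncheck_def of_rat_divide of_rat_diff)
    have l: "rpoly [:u, 1:] x = of_rat u + x" for u x by (simp add: rpoly_def map_poly_pCons)
    have "rpoly A (real j + (1 + ncheck n)) = pochhammer (real j + 2) n"
      unfolding A_def rpoly_prod l pochhammer_prod by (intro prod.cong) (auto simp: of_rat_diff of_rat_add c')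
    moreover have "rpoly B (real j + (1 + ncheck n)) = pochhammer (real j) n"
      unfolding B_def rpoly_prod l pochhammer_prod by (intro prod.cong) (auto simp: of_rat_diff of_rat_add c')
    moreover have "(of_rat (1 / fact n) :: real) = 1 / fact n"
      using of_rat_of_nat_eq[of "fact n", where ?'a = real] by (simp add: of_rat_divide)
    ultimately show ?thesis by (simp add: Q_def rpoly_smult rpoly_diff)
  qed
  show thesis by (rule that[OF par hi val])
qed

lemma bivariate_expansion:
  fixes Q :: "rat poly"
  assumes Q: "\<And>q. even (q + n) \<Longrightarrow> coeff Q q = 0" "\<And>q. q \<ge> n \<Longrightarrow> coeff Q q = 0"
  shows "\<exists>p :: nat \<Rightarrow> rat poly. (\<forall>q. even_poly (p q)) \<and> (\<forall>q. even (q + n) \<longrightarrow> p q = 0) \<and>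
     (\<forall>q\<ge>n + 2 * r. p q = 0) \<and>
     (\<forall>x s. (\<Sum>q<n + 2 * r. rpoly (p q) s * x ^ q) = rpoly Q x * (x\<^sup>2 - s\<^sup>2) ^ r)"
proof (induction r)
  case 0
  show ?case
    by (rule exI[of _ "\<lambda>q. [:coeff Q q:]"]) (use Q in \<open>auto simp: even_poly_const rpoly_const rpoly_expand[OF Q(2)]\<close>)
next
  case (Suc r)
  then obtain p where p: "\<And>q. even_poly (p q)" "\<And>q. even (q + n) \<Longrightarrow> p q = 0" "\<And>q. q \<ge> n + 2 * r \<Longrightarrow> p q = 0"
    "\<And>x s. (\<Sum>q<n + 2 * r. rpoly (p q) s * x ^ q) = rpoly Q x * (x\<^sup>2 - s\<^sup>2) ^ r" by blast
  \<comment> \<open>The index counts powers of \<open>x\<close>, while the polynomials are in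
    \<open>s\<close>: the factor \<open>x ^ 2 - s ^ 2\<close> shifts the index by two and subtracts
    a multiple by the monomial \<open>s ^ 2\<close>. Both operations preserve the parities.\<close>
  define p' where "p' q = (if q < 2 then 0 else p (q - 2)) - monom 1 2 * p q" for q
  have "even_poly (p' q)" for q
    unfolding p'_def by (intro even_poly_diff even_poly_monom_mult p(1)) (auto simp: p(1) even_poly_0)
  moreover have "p' q = 0" if "even (q + n)" for q
    using that p(2)[of q] p(2)[of "q - 2"] by (auto simp: p'_def)
  moreover have "p' q = 0" if "q \<ge> n + 2 * Suc r" for q
    using that p(3)[of q] p(3)[of "q - 2"] by (auto simp: p'_def)
  moreover have "(\<Sum>q<n + 2 * Suc r. rpoly (p' q) s * x ^ q) = rpoly Q x * (x\<^sup>2 - s\<^sup>2) ^ Suc r" for x s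
  proof -
    let ?N = "n + 2 * r"
    have "(\<Sum>q<?N + 2. rpoly (p' q) s * x ^ q)
        = (\<Sum>q<?N + 2. rpoly (if q < 2 then 0 else p (q - 2)) s * x ^ q) - s\<^sup>2 * (\<Sum>q<?N + 2. rpoly (p q) s * x ^ q)"
      by (simp add: p'_def rpoly_diff rpoly_mult rpoly_monom left_diff_distrib sum_subtractf sum_distrib_left mult.assoc del: sum.lessThan_Suc add_2_eq_Suc')
    also have "(\<Sum>q<?N + 2. rpoly (p q) s * x ^ q) = (\<Sum>q<?N. rpoly (p q) s * x ^ q)"
      by (rule sum.mono_neutral_right) (auto simp: p(3) rpoly_0)
    also have "(\<Sum>q<?N + 2. rpoly (if q < 2 then 0 else p (q - 2)) s * x ^ q) = (\<Sum>q<?N. rpoly (p q) s * x ^ (q + 2))"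
    proof -
      have "(\<Sum>q<Suc (Suc ?N). rpoly (if q < 2 then 0 else p (q - 2)) s * x ^ q) = (\<Sum>q<?N. rpoly (p q) s * x ^ (q + 2))"
        unfolding sum.lessThan_Suc_shift by (simp add: rpoly_0)
      then show ?thesis by simp
    qed
    also have "\<dots> = x\<^sup>2 * (\<Sum>q<?N. rpoly (p q) s * x ^ q)"
      by (simp add: sum_distrib_left power_add mult_ac power2_eq_square)
    finally show ?thesis unfolding p(4) by (simp add: algebra_simps)
  qed
  ultimately show ?case by (intro exI[of _ p']) auto
qed

text \<open>Coefficients of \<open>(j + a) ^ q\<close> in the basis
  \<open>e m = (j + m) choose m\<close>. The recursion comes from
  \<open>(j + a) * e m = (m + 1) * e (m + 1) + (a - m - 1) * e m\<close>. At \<open>m = 0\<close>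
  the truncated index is harmless because of the factor \<open>m\<close>.\<close>

fun newton_coeff :: "rat \<Rightarrow> nat \<Rightarrow> nat \<Rightarrow> rat" where
  "newton_coeff a 0 m = (if m = 0 then 1 else 0)"
| "newton_coeff a (Suc q) m = of_nat m * newton_coeff a q (m - 1) + (a - of_nat m - 1) * newton_coeff a q m"

lemma newton_coeff_eq_0: "m > q \<Longrightarrow> newton_coeff a q m = 0"
proof (induction q arbitrary: m)
  case (Suc q)
  then show ?case using Suc.IH[of m] Suc.IH[of "m - 1"] by simp
qed simp

lemma newton_expansion:
  "D > q \<Longrightarrow> (real j + of_rat a) ^ q = (\<Sum>m<D. of_rat (newton_coeff a q m) * real ((j + m) choose m))"
proof (induction q)
  case 0
  then have "{..<D} = insert 0 {1..<D}" by auto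
  then show ?case by simp
next
  case (Suc q)
  define c where "c m = (of_rat (newton_coeff a q m) :: real)" for m
  define e where "e m = real ((j + m) choose m)" for m
  have D: "D > q" and c0: "c (D - 1) = 0" using Suc.prems by (auto simp: c_def newton_coeff_eq_0)
  obtain D' where D': "D = Suc D'" using D by (cases D) auto
  have step: "(real j + of_rat a) * e m = real (Suc m) * e (Suc m) + (of_rat a - real m - 1) * e m" for m
  proof -
    have "real (Suc m) * e (Suc m) = real (j + Suc m) * e m"
      using Suc_times_binomial_eq[of "j + m" m] unfolding e_def of_nat_mult[symmetric] by (simp add: mult.commute)
    then show ?thesis by (simp add: algebra_simps)
  qed
  have "(real j + of_rat a) ^ Suc q = (real j + of_rat a) * (\<Sum>m<D. c m * e m)"
    using Suc.IH[OF D] by (simp add: c_def e_def)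
  also have "\<dots> = (\<Sum>m<D. c m * ((real j + of_rat a) * e m))"
    by (simp add: sum_distrib_left mult.left_commute)
  also have "\<dots> = (\<Sum>m<D. real (Suc m) * c m * e (Suc m)) + (\<Sum>m<D. (of_rat a - real m - 1) * c m * e m)"
    unfolding step sum.distrib[symmetric] by (intro sum.cong refl) (simp only: distrib_left mult_ac)
  also have "(\<Sum>m<D. real (Suc m) * c m * e (Suc m)) = (\<Sum>m<D'. real (Suc m) * c m * e (Suc m))"
    using c0 by (simp add: D')
  also have "\<dots> = (\<Sum>m<D. real m * c (m - 1) * e m)"
    unfolding D' sum.lessThan_Suc_shift by simp
  also have "(\<Sum>m<D. real m * c (m - 1) * e m) + (\<Sum>m<D. (of_rat a - real m - 1) * c m * e m)
     = (\<Sum>m<D. of_rat (newton_coeff a (Suc q) m) * e m)"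
    unfolding sum.distrib[symmetric]
    by (intro sum.cong) (auto simp: c_def of_rat_add of_rat_mult of_rat_diff algebra_simps)
  finally show ?case by (simp add: e_def)
qed

section \<open>The spectrum of \<open>L_op\<close>\<close>

lemma eigenspace_L_op:
  "eigenspace D (L_op n s) \<mu> = {u \<in> D. sphere_laplacian u = (\<lambda>x. (\<mu> - ((ncheck n)\<^sup>2 - s\<^sup>2)) * u x)}"
  by (auto simp: eigenspace_def L_op_def fun_eq_iff algebra_simps)

definition L_eigenvalue :: "nat \<Rightarrow> real \<Rightarrow> nat \<Rightarrow> real" where
  "L_eigenvalue n s k = (real k + ncheck n)\<^sup>2 - s\<^sup>2"

lemma L_eigenvalue_alt: "L_eigenvalue n s k = sphere_eigenvalue (n + 1) k + ((ncheck n)\<^sup>2 - s\<^sup>2)"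
  by (simp add: L_eigenvalue_def sphere_eigenvalue_def ncheck_def power2_eq_square field_simps)

lemma eigenspace_L_eigenvalue:
  assumes "DIM('a::euclidean_space) = n + 1" "n \<ge> 1"
  shows "eigenspace (smooth_on_sphere :: ('a \<Rightarrow> real) set) (L_op n s) (L_eigenvalue n s k) = harmonics k"
proof -
  have d: "DIM('a) \<ge> 2" using assms by simp
  have "L_eigenvalue n s k - ((ncheck n)\<^sup>2 - s\<^sup>2) = sphere_eigenvalue DIM('a) k"
    unfolding L_eigenvalue_alt assms(1) by simp
  then show ?thesis
    unfolding eigenspace_L_op using sphere_eigenspace[OF d] harmonics_smooth by (auto simp: harmonics_def)
qed

lemma dim_harmonics_0:
  assumes "DIM('a::euclidean_space) = n + 1" "n \<ge> 1"
  shows "real_fun.dim (harmonics 0 :: ('a \<Rightarrow> real) set) = 1"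
  using dim_harmonics[where ?'a = 'a and k = 0] assms by simp

lemma dim_harmonics_Suc:
  assumes "DIM('a::euclidean_space) = n + 1" "n \<ge> 1"
  shows "real (real_fun.dim (harmonics (Suc j) :: ('a \<Rightarrow> real) set)) = (pochhammer (real j + 2) n - pochhammer (real j) n) / fact n"
proof -
  have p: "real ((i + n) choose n) = pochhammer (real i + 1) n / fact n" for i
    using gbinomial_pochhammer'[of "real (i + n)" n] by (simp add: binomial_gbinomial)
  have "real (if Suc j < 2 then 0 else (Suc j - 2 + DIM('a) - 1) choose (DIM('a) - 1)) = pochhammer (real j) n / fact n"
  \<comment> \<open>For \<open>j = 0\<close> the Pochhammer symbol has a zero factor, in agreement
    with the absence of a lower space in degree \<open>1\<close>.\<close>
  proof (cases j)
    case 0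
    then show ?thesis using assms(2) by (simp add: pochhammer_0_left)
  next
    case (Suc i)
    then show ?thesis using p[of i] assms(1) by (simp add: add_ac)
  qed
  moreover have "real ((Suc j + DIM('a) - 1) choose (DIM('a) - 1)) = pochhammer (real j + 2) n / fact n"
    using p[of "Suc j"] assms(1) by (simp add: add_ac)
  moreover have "real (real_fun.dim (harmonics (Suc j) :: ('a \<Rightarrow> real) set)) +
      real (if Suc j < 2 then 0 else (Suc j - 2 + DIM('a) - 1) choose (DIM('a) - 1)) = real ((Suc j + DIM('a) - 1) choose (DIM('a) - 1))"
    unfolding of_nat_add[symmetric] using dim_harmonics[where ?'a = 'a and k = "Suc j"] assms by (intro arg_cong[of _ _ real]) simp
  ultimately show ?thesis by (simp add: diff_divide_distrib)
qed

lemma harmonics_nonzero: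
  assumes "real_fun.dim (harmonics k :: ('a::euclidean_space \<Rightarrow> real) set) > 0"
  obtains u :: "'a::euclidean_space \<Rightarrow> real" and x where "u \<in> harmonics k" "u x \<noteq> 0"
proof -
  have "\<not> harmonics k \<subseteq> {0 :: 'a \<Rightarrow> real}"
  proof
    assume "harmonics k \<subseteq> {0 :: 'a \<Rightarrow> real}"
    then have "real_fun.dim (harmonics k :: ('a \<Rightarrow> real) set) \<le> card ({} :: ('a \<Rightarrow> real) set)"
      by (intro real_fun.dim_le_card) (auto simp: real_fun.span_empty)
    then show False using assms by simp
  qed
  then obtain u :: "'a \<Rightarrow> real" where u: "u \<in> harmonics k" "u \<noteq> 0" by blast
  then obtain x where "u x \<noteq> 0" by (auto simp: fun_eq_iff)
  then show thesis using that u(1) by blast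
qed

lemma L_eigenvalue_inj: "n \<ge> 1 \<Longrightarrow> inj (L_eigenvalue n s)"
  by (rule injI) (use sphere_eigenvalue_inj[of "n + 1"] in \<open>auto simp: L_eigenvalue_alt\<close>)

lemma pos_eigenvalues_L_op:
  assumes d: "DIM('a::euclidean_space) = n + 1" "n \<ge> 1" and s: "\<bar>s\<bar> < 1 + ncheck n"
  shows "pos_eigenvalues (smooth_on_sphere :: ('a \<Rightarrow> real) set) (L_op n s) =
    L_eigenvalue n s ` ((if \<bar>s\<bar> < ncheck n then {0} else {}) \<union> range Suc)"
proof -
  have nn: "ncheck n \<ge> 0" using d(2) by (simp add: ncheck_def)
  have d2: "DIM('a) \<ge> 2" using d by simp
  \<comment> \<open>The interval for \<open>s\<close> is the one on which all indices from
    \<open>1\<close> on have positive eigenvalues; only the sign at index \<open>0\<close> varies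
    with \<open>s\<close>.\<close>
  have pos_Suc: "L_eigenvalue n s (Suc j) > 0" for j
  proof -
    have "\<bar>s\<bar> < \<bar>real (Suc j) + ncheck n\<bar>" using s nn by simp
    then show ?thesis by (simp add: L_eigenvalue_def abs_le_square_iff[symmetric] flip: not_le)
  qed
  have pos_0: "L_eigenvalue n s 0 > 0 \<longleftrightarrow> \<bar>s\<bar> < ncheck n"
    using nn by (simp add: L_eigenvalue_def abs_le_square_iff[symmetric] flip: not_le)
  \<comment> \<open>Membership in \<open>pos_eigenvalues\<close> asks for a nonzero eigenfunction,
    so the harmonics of every degree have to be nontrivial.\<close>
  have dim_pos: "real_fun.dim (harmonics k :: ('a \<Rightarrow> real) set) > 0" for k
  proof (cases k)
    case 0
    then show ?thesis using dim_harmonics_0[OF d] by simp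
  next
    case (Suc j)
    have "pochhammer (real j) n < pochhammer (real j + 2) n"
    proof -
      have "(\<Prod>i=0..<n. real j + real i) \<le> (\<Prod>i=0..<n. real j + 1 + real i)" by (intro prod_mono) auto
      also have "\<dots> < (\<Prod>i=0..<n. real j + 2 + real i)"
        using d(2) by (intro prod_mono_strict[of 0]) auto
      finally show ?thesis by (simp add: pochhammer_prod)
    qed
    then have "real (real_fun.dim (harmonics k :: ('a \<Rightarrow> real) set)) > 0"
      unfolding Suc dim_harmonics_Suc[OF d] by simp
    then show ?thesis by simp
  qed
  show ?thesis
  proof (intro equalityI subsetI)
    fix \<mu> assume "\<mu> \<in> pos_eigenvalues (smooth_on_sphere :: ('a \<Rightarrow> real) set) (L_op n s)"
    then obtain u :: "'a \<Rightarrow> real" and x where u: "\<mu> > 0" "u \<in> smooth_on_sphere"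
      "sphere_laplacian u = (\<lambda>x. (\<mu> - ((ncheck n)\<^sup>2 - s\<^sup>2)) * u x)" "u x \<noteq> 0"
      unfolding pos_eigenvalues_def eigenspace_L_op by blast
    obtain k where "\<mu> - ((ncheck n)\<^sup>2 - s\<^sup>2) = sphere_eigenvalue DIM('a) k"
      using sphere_spectrum[OF d2 u(2,3,4)] by blast
    then have k: "\<mu> = L_eigenvalue n s k" by (simp add: L_eigenvalue_alt d(1))
    then show "\<mu> \<in> L_eigenvalue n s ` ((if \<bar>s\<bar> < ncheck n then {0} else {}) \<union> range Suc)"
      using u(1) pos_0 by (cases k) auto
  next
    fix \<mu> assume "\<mu> \<in> L_eigenvalue n s ` ((if \<bar>s\<bar> < ncheck n then {0} else {}) \<union> range Suc)"
    then obtain k where k: "\<mu> = L_eigenvalue n s k" "\<mu> > 0"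
      using pos_0 pos_Suc by (auto split: if_splits)
    obtain u :: "'a \<Rightarrow> real" and x where "u \<in> harmonics k" "u x \<noteq> 0" using harmonics_nonzero[OF dim_pos] by blast
    then show "\<mu> \<in> pos_eigenvalues (smooth_on_sphere :: ('a \<Rightarrow> real) set) (L_op n s)"
      using k eigenspace_L_eigenvalue[OF d, of s k] unfolding pos_eigenvalues_def by blast
  qed
qed

section \<open>The spectral zeta function and the determinant\<close>

text \<open>Here \<open>r\<close> is the depth less one. The weight carries
  \<open>\<mu> ^ r\<close>, and
  \<open>\<mu> powr (- w) = \<mu> ^ r * \<mu> powr (- (w + r))\<close>, so the spectral zeta
  function at \<open>w\<close> is the weighted one at \<open>w + r\<close>, and the point
  \<open>- r\<close> moves to \<open>0\<close>. The index \<open>0\<close>, when its eigenvalue is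
  positive, adds an entire term.\<close>

lemma spectral_zeta_deriv:
  fixes s :: real and p :: "nat \<Rightarrow> real" and N n r :: nat
  assumes d: "DIM('a::euclidean_space) = n + 1" "n \<ge> 1" and s: "\<bar>s\<bar> < 1 + ncheck n"
    and p: "\<And>j. (\<Sum>q<N. p q * (real j + (1 + ncheck n)) ^ q) =
      real (real_fun.dim (harmonics (Suc j) :: ('a \<Rightarrow> real) set)) * L_eigenvalue n s (Suc j) ^ r"
  shows "deriv (spectral_zeta (smooth_on_sphere :: ('a \<Rightarrow> real) set) (L_op n s)) (- of_nat r) =
    deriv (poly_zeta_comb (1 + ncheck n) 2 (- s\<^sup>2) N p) 0 -
    (if \<bar>s\<bar> < ncheck n then of_real (((ncheck n)\<^sup>2 - s\<^sup>2) ^ r * ln ((ncheck n)\<^sup>2 - s\<^sup>2)) else 0)"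
proof -
  let ?a = "1 + ncheck n"
  let ?\<mu> = "L_eigenvalue n s"
  let ?M = "(ncheck n)\<^sup>2 - s\<^sup>2"
  let ?H = "\<lambda>k. harmonics k :: ('a \<Rightarrow> real) set"
  have nn: "ncheck n \<ge> 0" using d(2) by (simp add: ncheck_def)
  have a: "?a > 0" using nn by simp
  have \<kappa>: "\<bar>- s\<^sup>2\<bar> < ?a ^ 2" using s nn by (simp add: abs_le_square_iff[symmetric] flip: not_le)
  let ?P = "poly_zeta_comb ?a 2 (- s\<^sup>2) N p"
  note P = poly_zeta_comb_meromorphic[OF a \<kappa> zero_less_numeral] poly_zeta_comb_analytic[OF a \<kappa> zero_less_numeral]
    poly_zeta_comb_analytic_0[OF a \<kappa> zero_less_numeral] poly_zeta_comb_sums[OF a \<kappa> zero_less_numeral]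
    poly_zeta_comb_abs_summable[OF a \<kappa> zero_less_numeral]
  define E where "E w = (if \<bar>s\<bar> < ncheck n then complex_of_real ?M powr (- w) else 0)" for w
  have Mpos: "?M > 0" if "\<bar>s\<bar> < ncheck n"
    using that nn by (simp add: abs_le_square_iff[symmetric] flip: not_le)
  have Ed: "(E has_field_derivative - (if \<bar>s\<bar> < ncheck n then complex_of_real ?M powr (- w) * of_real (ln ?M) else 0)) (at w)" for w
  proof (cases "\<bar>s\<bar> < ncheck n")
    case True
    note M = Mpos[OF True]
    have "((\<lambda>w. exp (- w * of_real (ln ?M))) has_field_derivative - (exp (- w * of_real (ln ?M)) * of_real (ln ?M))) (at w)"
      by (auto intro!: derivative_eq_intros)
    then show ?thesis using True M unfolding E_def[abs_def] by (simp only: powr_of_real_pos[OF M] if_True)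
  next
    case False
    then show ?thesis by (simp add: E_def[abs_def])
  qed
  then have "E field_differentiable at w" for w unfolding field_differentiable_def by blast
  then have "E holomorphic_on UNIV" by (simp add: holomorphic_on_def)
  then have "E analytic_on UNIV" by (simp add: analytic_on_open)
  then have Ea: "E analytic_on X" for X by (rule analytic_on_subset) simp
  define T where "T w = ?P (w + of_nat r) + E w" for w
  have Tm: "T meromorphic_on UNIV"
    unfolding T_def[abs_def]
    by (rule meromorphic_on_add[OF meromorphic_on_compose[OF P(1) _ subset_UNIV] analytic_on_imp_meromorphic_on[OF Ea]])
      (intro analytic_intros)
  have Ta: "T analytic_on {w}" if "?P analytic_on {w + of_nat r}" for w
  proof -
    have "(?P \<circ> (\<lambda>w. w + of_nat r)) analytic_on {w}"
      by (rule analytic_on_compose) (use that in \<open>auto intro!: analytic_intros\<close>)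
    then have "(\<lambda>w. ?P (w + of_nat r)) analytic_on {w}" by (simp add: o_def)
    then show ?thesis unfolding T_def[abs_def] by (intro analytic_on_add Ea)
  qed
  have eq: "spectral_zeta (smooth_on_sphere :: ('a \<Rightarrow> real) set) (L_op n s) = remove_sings T"
    unfolding spectral_zeta_def
  proof (rule series_continuation_eqI)
    show "remove_sings T nicely_meromorphic_on UNIV" by (rule remove_sings_nicely_meromorphic[OF Tm])
    fix w :: complex assume w: "Re w > real N"
    let ?t = "\<lambda>\<mu>. of_nat (real_fun.dim (eigenspace (smooth_on_sphere :: ('a \<Rightarrow> real) set) (L_op n s) \<mu>)) * complex_of_real \<mu> powr (- w)"
    have w': "Re (of_nat 2 * (w + of_nat r)) > real N" using w by simp
    have "?P analytic_on {w + of_nat r}" by (rule analytic_on_subset[OF P(2)[of N]]) (use w' in simp)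
    then have T: "remove_sings T w = ?P (w + of_nat r) + E w"
      using remove_sings_at_analytic[OF Ta] by (simp add: T_def)
    have summand: "?t (?\<mu> (Suc j)) = of_real (\<Sum>q<N. p q * (real j + ?a) ^ q) * of_real ((real j + ?a) ^ 2 + - s\<^sup>2) powr (- (w + of_nat r))" for j
    proof -
      have m: "?\<mu> (Suc j) = (real j + ?a) ^ 2 + - s\<^sup>2" by (simp add: L_eigenvalue_def add_ac)
      have pos: "?\<mu> (Suc j) > 0" unfolding m using rem_term_expand(1)[OF a \<kappa>] .
      have "complex_of_real (?\<mu> (Suc j)) powr (- w) = of_real (?\<mu> (Suc j)) powr (of_nat r + - (w + of_nat r))" by simp
      also have "\<dots> = of_real (?\<mu> (Suc j) ^ r) * of_real (?\<mu> (Suc j)) powr (- (w + of_nat r))"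
        unfolding powr_add using pos by (simp add: powr_nat')
      finally show ?thesis
        unfolding p eigenspace_L_eigenvalue[OF d] m[symmetric] by simp
    qed
    have "((\<lambda>j. ?t (?\<mu> (Suc j))) has_sum ?P (w + of_nat r)) UNIV"
      unfolding summand by (rule norm_summable_imp_has_sum[OF P(5)[OF w'] P(4)[OF w']])
    then have "(((\<lambda>k. ?t (?\<mu> k)) \<circ> Suc) has_sum ?P (w + of_nat r)) UNIV" by (simp add: o_def)
    then have 1: "((\<lambda>k. ?t (?\<mu> k)) has_sum ?P (w + of_nat r)) (range Suc)"
      by (subst has_sum_reindex) auto
    have "((\<lambda>k. ?t (?\<mu> k)) has_sum E w) (if \<bar>s\<bar> < ncheck n then {0} else {})"
    proof (cases "\<bar>s\<bar> < ncheck n")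
      case True
      have "?t (?\<mu> 0) = complex_of_real ?M powr (- w)"
        unfolding eigenspace_L_eigenvalue[OF d] dim_harmonics_0[OF d] by (simp add: L_eigenvalue_def)
      then show ?thesis using True has_sum_finiteI[of "{0}" _ "\<lambda>k. ?t (?\<mu> k)"] by (simp add: E_def)
    qed (simp add: E_def)
    from has_sum_Un_disjoint[OF this 1]
    have "((\<lambda>k. ?t (?\<mu> k)) has_sum E w + ?P (w + of_nat r)) ((if \<bar>s\<bar> < ncheck n then {0} else {}) \<union> range Suc)"
      by (auto split: if_splits)
    then have "((?t \<circ> ?\<mu>) has_sum remove_sings T w) ((if \<bar>s\<bar> < ncheck n then {0} else {}) \<union> range Suc)"
      unfolding T by (simp add: o_def add.commute)
    \<comment> \<open>The eigenvalue is injective in the index, so the sum over distinct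
      eigenvalues, weighted by dimension, is a sum over indices.\<close>
    then show "(?t has_sum remove_sings T w) (pos_eigenvalues (smooth_on_sphere :: ('a \<Rightarrow> real) set) (L_op n s))"
      unfolding pos_eigenvalues_L_op[OF d s]
      by (subst has_sum_reindex) (use L_eigenvalue_inj[OF d(2), of s] inj_on_subset in blast)+
  qed
  have P0: "?P analytic_on {- of_nat r + of_nat r}" using P(3) by simp
  have "deriv (remove_sings T) (- of_nat r) = deriv T (- of_nat r)"
    by (rule deriv_remove_sings_at_analytic[OF Ta[OF P0]])
  moreover have "(?P has_field_derivative deriv ?P 0) (at (- of_nat r + of_nat r))"
    using analytic_derivI[OF P(3)] by simp
  then have "((\<lambda>w. ?P (w + of_nat r)) has_field_derivative deriv ?P 0 * 1) (at (- of_nat r))"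
    by (rule DERIV_chain2) (auto intro!: derivative_eq_intros)
  from DERIV_add[OF this Ed]
  have "deriv T (- of_nat r) = deriv ?P 0 * 1 + - (if \<bar>s\<bar> < ncheck n then complex_of_real ?M powr (- (- of_nat r)) * of_real (ln ?M) else 0)"
    unfolding T_def[abs_def] by (rule DERIV_imp_deriv)
  moreover have "complex_of_real ?M powr (- (- of_nat r)) = of_real (?M ^ r)" if "\<bar>s\<bar> < ncheck n"
    using Mpos[OF that] by (simp add: powr_nat' del: of_real_diff)
  ultimately show ?thesis unfolding eq by simp
qed

text \<open>The derivatives are real, so the product of the gamma values is a positive real and the
  principal logarithm in \<open>powr\<close> returns exactly the sum of the exponents, with no
  multiple of \<open>2 * pi * i\<close> added.\<close>

lemma multiple_Gamma_powr:
  assumes "x > 0" "y > 0" "l \<ge> 1"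
  shows "(multiple_Gamma l (of_real x) * multiple_Gamma l (of_real y)) powr of_real b =
    exp (of_real b * (deriv (barnes_zeta l (of_real x)) 0 + deriv (barnes_zeta l (of_real y)) 0))"
proof -
  obtain u v where uv: "deriv (barnes_zeta l (of_real x)) 0 = of_real u" "deriv (barnes_zeta l (of_real y)) 0 = of_real v"
    using barnes_zeta_deriv_real[OF assms(1,3)] barnes_zeta_deriv_real[OF assms(2,3)] by (auto elim!: Reals_cases)
  have "multiple_Gamma l (of_real x) * multiple_Gamma l (of_real y) = of_real (exp (u + v))"
    unfolding multiple_Gamma_def uv exp_of_real by (simp add: exp_add)
  then show ?thesis unfolding uv by (simp add: powr_of_real_pos flip: of_real_add)
qed

theorem theorem1p1:
  fixes n r :: nat
  assumes "n \<ge> 1" and "r \<ge> 1"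
    and "DIM('a::euclidean_space) = n + 1"
  shows "\<exists>(f :: rat poly) (\<beta> :: nat \<Rightarrow> rat poly).
    even_poly f \<and> (\<forall>l\<in>{1..2 * r + n - 2}. even_poly (\<beta> l)) \<and>
    (\<forall>s\<in>{- ncheck n - 1 <..< ncheck n + 1}.
       Det r (smooth_on_sphere :: ('a \<Rightarrow> real) set) (L_op n s) =
         complex_of_real
           (if \<bar>s\<bar> < ncheck n
            then ((ncheck n)\<^sup>2 - s\<^sup>2) powr (((ncheck n)\<^sup>2 - s\<^sup>2) ^ (r - 1)) else 1)
         * complex_of_real (exp (rpoly f s))
         * (\<Prod>l=1..2 * r + n - 2.
              (multiple_Gamma l (complex_of_real (1 + ncheck n + s))
               * multiple_Gamma l (complex_of_real (1 + ncheck n - s)))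
              powr complex_of_real (rpoly (\<beta> l) s))) \<and>
    (odd n \<longrightarrow> f = 0)"
proof -
  obtain r' where r': "r = Suc r'" using assms(2) by (cases r) auto
  \<comment> \<open>The multiplicity has degree below \<open>n\<close> and the power of the
    eigenvalue has degree \<open>2 * r'\<close> in \<open>x\<close>, so \<open>d\<close> bounds the
    degree of the weight and with it the orders of the gamma functions.\<close>
  define d where "d = n + 2 * r'"
  have d: "2 * r + n - 2 = d" by (simp add: d_def r')
  note dim = assms(3,1)
  obtain Q :: "rat poly" where Q: "\<And>q. even (q + n) \<Longrightarrow> coeff Q q = 0" "\<And>q. q \<ge> n \<Longrightarrow> coeff Q q = 0"
    "\<And>j. rpoly Q (real j + (1 + ncheck n)) = (pochhammer (real j + 2) n - pochhammer (real j) n) / fact n"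
    using multiplicity_poly[OF assms(1)] by metis
  have "\<exists>p :: nat \<Rightarrow> rat poly. (\<forall>q. even_poly (p q)) \<and> (\<forall>q. even (q + n) \<longrightarrow> p q = 0) \<and>
     (\<forall>q\<ge>d. p q = 0) \<and>
     (\<forall>x s. (\<Sum>q<d. rpoly (p q) s * x ^ q) = rpoly Q x * (x\<^sup>2 - s\<^sup>2) ^ r')"
    unfolding d_def by (rule bivariate_expansion[OF Q(1,2)])
  then obtain p :: "nat \<Rightarrow> rat poly" where p: "\<And>q. even_poly (p q)" "\<And>q. even (q + n) \<Longrightarrow> p q = 0"
    "\<And>x s. (\<Sum>q<d. rpoly (p q) s * x ^ q) = rpoly Q x * (x\<^sup>2 - s\<^sup>2) ^ r'" by blast
  define a :: rat where "a = (of_nat n + 1) / 2"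
  have a: "(of_rat a :: real) = 1 + ncheck n" by (simp add: a_def ncheck_def of_rat_divide of_rat_add field_simps)
  \<comment> \<open>Coefficients of the weight in the binomial basis, shifted by one since
    \<open>l\<close> starts at \<open>1\<close>. The exponents in the product are
    \<open>- b l\<close> because of the minus sign in \<open>Det\<close>.\<close>
  define b where "b l = (\<Sum>q<d. smult (newton_coeff a q (l - 1)) (p q))" for l
  \<comment> \<open>A rational counterpart of \<open>harm\<close>, so that \<open>f\<close> is a
    polynomial over the rationals.\<close>
  define h :: "nat \<Rightarrow> rat" where "h n = (\<Sum>k=1..n. inverse (of_nat k))" for n
  have h: "(of_rat (h n) :: real) = harm n" for n by (simp add: h_def harm_def of_rat_sum of_rat_inverse)
  define f where "f = (\<Sum>q<d. if odd q then smult ((2 * h q - h (q div 2)) / of_nat (q + 1)) (monom 1 (q + 1) * p q) else 0)"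
  have f: "rpoly f s = (\<Sum>q<d. if odd q then rpoly (p q) s * (s ^ (q + 1) * (2 * harm q - harm (q div 2)) / real (q + 1)) else 0)" for s
    unfolding f_def rpoly_sum
    by (intro sum.cong refl)
      (auto simp: rpoly_0 rpoly_smult rpoly_mult rpoly_monom of_rat_divide of_rat_diff of_rat_mult of_rat_add h simp del: power_Suc)
  \<comment> \<open>Only odd \<open>q\<close> are summed, so the monomials have even degree
    \<open>q + 1\<close>.\<close>
  have "even_poly f" unfolding f_def
    by (intro even_poly_sum) (auto intro!: even_poly_smult even_poly_monom_mult p(1) even_poly_0 simp del: monom_Suc)
  moreover have "even_poly (- b l)" for l
  proof -
    have "even_poly (0 - b l)" unfolding b_def
      by (intro even_poly_diff even_poly_0 even_poly_sum even_poly_smult p(1))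
    then show ?thesis by simp
  qed
  moreover have "f = 0" if "odd n"
    unfolding f_def by (rule sum.neutral) (use p(2) that in auto)
  moreover have "Det r (smooth_on_sphere :: ('a \<Rightarrow> real) set) (L_op n s) =
         complex_of_real
           (if \<bar>s\<bar> < ncheck n
            then ((ncheck n)\<^sup>2 - s\<^sup>2) powr (((ncheck n)\<^sup>2 - s\<^sup>2) ^ (r - 1)) else 1)
         * complex_of_real (exp (rpoly f s))
         * (\<Prod>l=1..d.
              (multiple_Gamma l (complex_of_real (1 + ncheck n + s))
               * multiple_Gamma l (complex_of_real (1 + ncheck n - s)))
              powr complex_of_real (rpoly (- b l) s))"
    if "s \<in> {- ncheck n - 1 <..< ncheck n + 1}" for s
  proof -
    let ?a = "1 + ncheck n"
    let ?M = "(ncheck n)\<^sup>2 - s\<^sup>2"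
    have nn: "ncheck n \<ge> 0" using assms(1) by (simp add: ncheck_def)
    have s: "\<bar>s\<bar> < ?a" and pos: "?a > 0" "?a + s > 0" "?a - s > 0" using that nn by auto
    have pd: "(\<Sum>q<d. rpoly (p q) s * (real j + ?a) ^ q) =
      real (real_fun.dim (harmonics (Suc j) :: ('a \<Rightarrow> real) set)) * L_eigenvalue n s (Suc j) ^ r'" for j
      unfolding p(3) Q(3) dim_harmonics_Suc[OF dim] by (simp add: L_eigenvalue_def add_ac)
    have pb: "(\<Sum>q<d. rpoly (p q) s * (real j + ?a) ^ q) = (\<Sum>l=1..d. rpoly (b l) s * real ((j + l - 1) choose (l - 1)))" for j
    proof -
      have "(\<Sum>q<d. rpoly (p q) s * (real j + ?a) ^ q) =
        (\<Sum>q<d. \<Sum>m<d. rpoly (p q) s * (of_rat (newton_coeff a q m) * real ((j + m) choose m)))"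
        unfolding a[symmetric] sum_distrib_left[symmetric] by (intro sum.cong refl arg_cong2[of _ _ _ _ "(*)"] newton_expansion) auto
      also have "\<dots> = (\<Sum>m<d. \<Sum>q<d. rpoly (p q) s * (of_rat (newton_coeff a q m) * real ((j + m) choose m)))"
        by (rule sum.swap)
      also have "\<dots> = (\<Sum>m<d. rpoly (b (Suc m)) s * real ((j + m) choose m))"
        unfolding b_def rpoly_sum rpoly_smult sum_distrib_right by (intro sum.cong refl) simp
      also have "\<dots> = (\<Sum>l=1..d. rpoly (b l) s * real ((j + l - 1) choose (l - 1)))"
        by (rule sum.reindex_bij_witness[of _ "\<lambda>l. l - 1" Suc]) auto
      finally show ?thesis .
    qed
    let ?D = "\<lambda>l. deriv (barnes_zeta l (of_real (?a + s))) 0 + deriv (barnes_zeta l (of_real (?a - s))) 0"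
    have "deriv (spectral_zeta (smooth_on_sphere :: ('a \<Rightarrow> real) set) (L_op n s)) (1 - of_nat r) =
       (\<Sum>l=1..d. of_real (rpoly (b l) s) * ?D l) - of_real (rpoly f s)
       - (if \<bar>s\<bar> < ncheck n then of_real (?M ^ r' * ln ?M) else 0)"
      using spectral_zeta_deriv[OF dim s pd] unfolding spectral_comb_deriv[OF pos(1) s pb] f[symmetric] r' by simp
    then have "Det r (smooth_on_sphere :: ('a \<Rightarrow> real) set) (L_op n s) =
       exp ((if \<bar>s\<bar> < ncheck n then of_real (?M ^ r' * ln ?M) else 0) + of_real (rpoly f s) + (\<Sum>l=1..d. of_real (rpoly (- b l) s) * ?D l))"
    proof -
      have neg: "(\<Sum>l=1..d. of_real (rpoly (- b l) s) * ?D l) = - (\<Sum>l=1..d. of_real (rpoly (b l) s) * ?D l)"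
        by (simp add: rpoly_uminus sum_negf)
      have "- (x - y - z) = z + y + - x" for x y z :: complex by simp
      then show ?thesis
        unfolding Det_def \<open>deriv _ _ = _\<close> neg by (rule arg_cong)
    qed
    also have "\<dots> = exp (if \<bar>s\<bar> < ncheck n then of_real (?M ^ r' * ln ?M) else 0) * exp (of_real (rpoly f s)) *
        (\<Prod>l=1..d. exp (of_real (rpoly (- b l) s) * ?D l))"
      by (simp only: exp_add exp_sum finite_atLeastAtMost)
    also have "(\<Prod>l=1..d. exp (of_real (rpoly (- b l) s) * ?D l)) =
       (\<Prod>l=1..d. (multiple_Gamma l (complex_of_real (?a + s)) * multiple_Gamma l (complex_of_real (?a - s)))
              powr complex_of_real (rpoly (- b l) s))"
      by (intro prod.cong refl multiple_Gamma_powr[symmetric] pos) auto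
    also have "exp (if \<bar>s\<bar> < ncheck n then of_real (?M ^ r' * ln ?M) else 0) =
       complex_of_real (if \<bar>s\<bar> < ncheck n then ?M powr (?M ^ (r - 1)) else 1)"
    proof (cases "\<bar>s\<bar> < ncheck n")
      case True
      then have "?M > 0" using nn by (simp add: abs_le_square_iff[symmetric] flip: not_le)
      then show ?thesis using True by (simp add: powr_def r' exp_of_real del: of_real_diff of_real_mult of_real_power)
    qed simp
    finally show ?thesis by (simp only: exp_of_real)
  qed
  ultimately show ?thesis unfolding d
    by (intro exI[of _ f] exI[of _ "\<lambda>l. - b l"]) blast
qed

end
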